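(* Let $N^n=\mathrm{OB}(V^{n-1},\phi)$ be a closed oriented manifold with an open book decomposition, and regard $V$ as a submanifold of $N$ by embedding it as a page. Then there exists a Seifert type embedding $h$ of $V$ in $N\times[-1,0]\subset N\times[-1,1]$ (with $h(\partial V)\subset N\times\{-1\}$), and an isotopy $\tilde\Gamma_s$ ($s\in[0,1]$) of $N\times[-1,1]$ through diffeomorphisms, relative to the boundary $N\times\{-1,1\}$, such that $\tilde\Gamma_0=\mathrm{id}$ and $\tilde\Gamma_1\circ h=h\circ\phi$.
   Context: All manifolds and maps are smooth. Open books. Let $V$ be a compact manifold with non-empty boundary and let $\phi$ be a diffeomorphism of $V$ that is the identity near $\partial V$. Let $\mathcal{MT}(V,\phi)$ be the mapping torus of $\phi$. Then $\mathrm{OB}(V,\phi)$ denotes the closed manifold $\mathcal{MT}(V,\phi)\cup_{\mathrm{id}}(\partial V\times \mathbb{D}^2)$ together with this decomposition. Here $V$ is the page, $\partial V$ the binding and $\phi$ the monodromy. The pages in $\mathrm{OB}(V,\phi)$ are the fibers of the mapping torus, extended radially over $\partial V\times\mathbb{D}^2$ to the binding $\partial V\times\{0\}$; each is diffeomorphic to $V$. Seifert type embedding. Let $\Sigma^{n-1}$ be an oriented compact submanifold, with non-empty boundary, of an oriented closed manifold $M^n$, and let $a<b$. A Seifert type embedding of $\Sigma$ in $M\times[a,b]$ is an embedding $f$ of $\Sigma$ obtained by isotoping the interior of $\Sigma\times\{a\}\subset M\times\{a\}$ into $M\times(a,b]$, fixing $\partial\Sigma\times\{a\}$ pointwise, so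 that $f(\Sigma)\cap(M\times\{b\})=\Sigma\times\{b\}$ and $f(\Sigma)\cap(M\times\{t\})=\partial\Sigma\times\{t\}$ for all $t\in[a,b)$. Thus $f(\Sigma)=(\partial\Sigma\times[a,b])\cup(\Sigma\times\{b\})$, where the corner along $\partial\Sigma\times\{b\}$ is understood to be rounded in an arbitrarily small neighborhood so that $f$ is smooth. *)

theory Defs
  imports "HOL-Analysis.Analysis"
begin

subsection \<open>Smooth functions on subsets of Euclidean spaces\<close>

text \<open>\<open>C_k_on k S f\<close>: \<open>f\<close> is of class \<open>C\<^sup>k\<close> on the open set \<open>S\<close>. In finite dimension,
  continuity of the derivative is continuity of all directional derivatives.\<close>

primrec C_k_on :: "nat \<Rightarrow> 'a::euclidean_space set \<Rightarrow> ('a \<Rightarrow> 'b::real_normed_vector) \<Rightarrow> bool"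
  where
  "C_k_on 0 S f \<longleftrightarrow> continuous_on S f"
| "C_k_on (Suc k) S f \<longleftrightarrow>
     (\<forall>x\<in>S. f differentiable at x) \<and> (\<forall>v. C_k_on k S (\<lambda>x. frechet_derivative f (at x) v))"

text \<open>On an arbitrary set, in particular on a relatively open subset of a half-space or of a
  hyperplane, smoothness means local extendability to a smooth function on an open set.\<close>

definition smooth_on :: "'a::euclidean_space set \<Rightarrow> ('a \<Rightarrow> 'b::real_normed_vector) \<Rightarrow> bool"
  where "smooth_on S f \<longleftrightarrow>
    (\<forall>x\<in>S. \<exists>W g. open W \<and> x \<in> W \<and> (\<forall>k. C_k_on k W g) \<and> (\<forall>y\<in>S \<inter> W. g y = f y))"

subsection \<open>Atlases and manifolds with boundary\<close>

text \<open>A manifold is given by its atlas; the underlying set is the union of the chart domains and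
  the topology is the one induced by the charts. Atlases in which the chart images are not
  of full dimension (as for the boundary of a manifold) or have corners (as for
  \<open>[0,1] \<times> M\<close>) are also used as domains and targets of smooth maps.\<close>

type_synonym ('a, 'e) atlas = "('a set \<times> ('a \<Rightarrow> 'e)) set"

definition points :: "('a, 'e) atlas \<Rightarrow> 'a set"
  where "points M = (\<Union>(U, \<kappa>)\<in>M. U)"

definition mtop :: "('a, 'e::euclidean_space) atlas \<Rightarrow> 'a topology"
  where "mtop M = topology (\<lambda>S. S \<subseteq> points M \<and>
    (\<forall>(U, \<kappa>)\<in>M. openin (pullback_topology U \<kappa> euclidean) (S \<inter> U)))"

lemma openin_mtop:
  "openin (mtop M) S \<longleftrightarrow> S \<subseteq> points M \<and>
    (\<forall>(U, \<kappa>)\<in>M. openin (pullback_topology U \<kappa> euclidean) (S \<inter> U))"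
proof -
  have "istopology (\<lambda>S. S \<subseteq> points M \<and>
    (\<forall>(U, \<kappa>)\<in>M. openin (pullback_topology U \<kappa> euclidean) (S \<inter> U)))"
    unfolding istopology_def
  proof (intro conjI allI impI)
    fix S T
    assume S: "S \<subseteq> points M \<and> (\<forall>(U, \<kappa>)\<in>M. openin (pullback_topology U \<kappa> euclidean) (S \<inter> U))"
      and T: "T \<subseteq> points M \<and> (\<forall>(U, \<kappa>)\<in>M. openin (pullback_topology U \<kappa> euclidean) (T \<inter> U))"
    show "S \<inter> T \<subseteq> points M" using S by blast
    show "\<forall>(U, \<kappa>)\<in>M. openin (pullback_topology U \<kappa> euclidean) (S \<inter> T \<inter> U)"
    proof clarify
      fix U \<kappa> assume "(U, \<kappa>) \<in> M"
      with S T have "openin (pullback_topology U \<kappa> euclidean) (S \<inter> U)"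
        and "openin (pullback_topology U \<kappa> euclidean) (T \<inter> U)"
        by auto
      then have "openin (pullback_topology U \<kappa> euclidean) ((S \<inter> U) \<inter> (T \<inter> U))"
        by (rule openin_Int)
      moreover have "(S \<inter> U) \<inter> (T \<inter> U) = S \<inter> T \<inter> U" by blast
      ultimately show "openin (pullback_topology U \<kappa> euclidean) (S \<inter> T \<inter> U)" by simp
    qed
  next
    fix \<K>
    assume K: "\<forall>S\<in>\<K>. S \<subseteq> points M \<and>
      (\<forall>(U, \<kappa>)\<in>M. openin (pullback_topology U \<kappa> euclidean) (S \<inter> U))"
    show "\<Union>\<K> \<subseteq> points M" using K by blast
    show "\<forall>(U, \<kappa>)\<in>M. openin (pullback_topology U \<kappa> euclidean) (\<Union>\<K> \<inter> U)"
    proof clarify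
      fix U \<kappa> assume "(U, \<kappa>) \<in> M"
      with K have "openin (pullback_topology U \<kappa> euclidean) (\<Union>S\<in>\<K>. S \<inter> U)"
        by (intro openin_Union) auto
      moreover have "(\<Union>S\<in>\<K>. S \<inter> U) = \<Union>\<K> \<inter> U" by blast
      ultimately show "openin (pullback_topology U \<kappa> euclidean) (\<Union>\<K> \<inter> U)" by simp
    qed
  qed
  then show ?thesis by (simp add: mtop_def)
qed

lemma topspace_mtop: "topspace (mtop M) = points M"
proof
  show "topspace (mtop M) \<subseteq> points M"
    unfolding topspace_def openin_mtop by blast
  have "points M \<inter> U = U" if "(U, \<kappa>) \<in> M" for U and \<kappa> :: "'a \<Rightarrow> 'b"
    using that by (auto simp: points_def)
  moreover have "openin (pullback_topology U \<kappa> euclidean) U" for U and \<kappa> :: "'a \<Rightarrow> 'b"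
    unfolding openin_pullback_topology by (rule exI[of _ UNIV]) simp
  ultimately have "openin (mtop M) (points M)"
    unfolding openin_mtop by auto
  then show "points M \<subseteq> topspace (mtop M)" by (rule openin_subset)
qed

definition smooth_manifold :: "('a, 'e::euclidean_space) atlas \<Rightarrow> bool"
  where "smooth_manifold M \<longleftrightarrow>
    (\<forall>(U, \<kappa>)\<in>M. inj_on \<kappa> U \<and> (\<exists>b c. openin (top_of_set {y. c \<le> b \<bullet> y}) (\<kappa> ` U))) \<and>
    (\<forall>(U, \<kappa>)\<in>M. \<forall>(U', \<kappa>')\<in>M.
       openin (top_of_set (\<kappa> ` U)) (\<kappa> ` (U \<inter> U')) \<and>
       smooth_on (\<kappa> ` (U \<inter> U')) (\<kappa>' \<circ> inv_into U \<kappa>)) \<and>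
    Hausdorff_space (mtop M) \<and> second_countable (mtop M)"

text \<open>The choice \<open>b = 0\<close>, \<open>c = 0\<close> above gives the whole model space.\<close>

definition bdry :: "('a, 'e::euclidean_space) atlas \<Rightarrow> 'a set"
  where "bdry M = {x. \<exists>(U, \<kappa>)\<in>M. x \<in> U \<and> \<kappa> x \<notin> interior (\<kappa> ` U)}"

definition compact_manifold :: "('a, 'e::euclidean_space) atlas \<Rightarrow> bool"
  where "compact_manifold M \<longleftrightarrow> smooth_manifold M \<and> compact_space (mtop M)"

definition closed_manifold :: "('a, 'e::euclidean_space) atlas \<Rightarrow> bool"
  where "closed_manifold M \<longleftrightarrow> compact_manifold M \<and> bdry M = {}"

text \<open>An oriented manifold is given by an oriented atlas.\<close>

definition oriented :: "('a, real^'n::finite) atlas \<Rightarrow> bool"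
  where "oriented M \<longleftrightarrow>
    (\<forall>(U, \<kappa>)\<in>M. \<forall>(U', \<kappa>')\<in>M. \<forall>x\<in>U \<inter> U'. \<exists>D.
       ((\<kappa>' \<circ> inv_into U \<kappa>) has_derivative D) (at (\<kappa> x) within \<kappa> ` (U \<inter> U')) \<and>
       det (matrix D) > 0)"

subsection \<open>Smooth maps\<close>

definition smooth_map ::
    "('a, 'e::euclidean_space) atlas \<Rightarrow> ('b, 'f::euclidean_space) atlas \<Rightarrow> ('a \<Rightarrow> 'b) \<Rightarrow> bool"
  where "smooth_map M N f \<longleftrightarrow>
    continuous_map (mtop M) (mtop N) f \<and>
    (\<forall>(U, \<kappa>)\<in>M. \<forall>(U', \<kappa>')\<in>N.
       smooth_on (\<kappa> ` (U \<inter> f -` U')) (\<kappa>' \<circ> f \<circ> inv_into U \<kappa>))"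

definition diffeo ::
    "('a, 'e::euclidean_space) atlas \<Rightarrow> ('b, 'f::euclidean_space) atlas \<Rightarrow> ('a \<Rightarrow> 'b) \<Rightarrow> bool"
  where "diffeo M N f \<longleftrightarrow>
    bij_betw f (points M) (points N) \<and> smooth_map M N f \<and>
    smooth_map N M (inv_into (points M) f)"

text \<open>Immersions are only considered for manifolds \<open>M\<close> with full-dimensional charts, so that
  the derivative \<open>D\<close> below is unique, also at boundary points.\<close>

definition smooth_embedding ::
    "('a, 'e::euclidean_space) atlas \<Rightarrow> ('b, 'f::euclidean_space) atlas \<Rightarrow> ('a \<Rightarrow> 'b) \<Rightarrow> bool"
  where "smooth_embedding M N f \<longleftrightarrow>
    smooth_map M N f \<and> embedding_map (mtop M) (mtop N) f \<and>
    (\<forall>(U, \<kappa>)\<in>M. \<forall>(U', \<kappa>')\<in>N. \<forall>x\<in>U \<inter> f -` U'. \<exists>D.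
       ((\<kappa>' \<circ> f \<circ> inv_into U \<kappa>) has_derivative D) (at (\<kappa> x) within \<kappa> ` (U \<inter> f -` U')) \<and>
       inj D)"

subsection \<open>Constructions\<close>

definition prod_atlas ::
    "('a, 'e) atlas \<Rightarrow> ('b, 'f) atlas \<Rightarrow> ('a \<times> 'b, 'e \<times> 'f) atlas"  (infixr \<open>\<times>\<^sub>A\<close> 80)
  where "M \<times>\<^sub>A N = (\<lambda>((U, \<kappa>), (U', \<kappa>')). (U \<times> U', map_prod \<kappa> \<kappa>')) ` (M \<times> N)"

definition sub_atlas :: "'a set \<Rightarrow> ('a, 'e) atlas \<Rightarrow> ('a, 'e) atlas"
  where "sub_atlas S M = (\<lambda>(U, \<kappa>). (U \<inter> S, \<kappa>)) ` M"

text \<open>The image of an atlas under a map that is injective on every chart domain.\<close>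

definition push_atlas :: "('a \<Rightarrow> 'b) \<Rightarrow> ('a, 'e) atlas \<Rightarrow> ('b, 'e) atlas"
  where "push_atlas f M = (\<lambda>(U, \<kappa>). (f ` U, \<kappa> \<circ> inv_into U f)) ` M"

definition interval :: "real \<Rightarrow> real \<Rightarrow> (real, real) atlas"
  where "interval a b = {({a..<b}, id), ({a<..b}, id)}"

text \<open>The real line, with charts so short that \<open>V \<times> \<real> \<rightarrow> V \<times> \<real> / \<int>\<close> is injective on them.\<close>

definition line :: "(real, real) atlas"
  where "line = range (\<lambda>a. ({a<..<a + 1}, id))"

subsection \<open>Open books\<close>

text \<open>The mapping torus is \<open>V \<times> \<real>\<close> modulo \<open>(x, t + 1) \<sim> (\<phi> x, t)\<close>, that is, \<open>V \<times> [0,1]\<close> with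
  \<open>(x, 1)\<close> glued to \<open>(\<phi> x, 0)\<close>.\<close>

definition mt_class ::
    "('v, 'e) atlas \<Rightarrow> ('v \<Rightarrow> 'v) \<Rightarrow> 'v \<times> real \<Rightarrow> ('v \<times> real) set"
  where "mt_class V \<phi> = (\<lambda>(x, t). {(y, s). y \<in> points V \<and>
    (\<exists>k::nat. (s = t + real k \<and> (\<phi> ^^ k) y = x) \<or> (t = s + real k \<and> (\<phi> ^^ k) x = y))})"

definition mapping_torus ::
    "('v, 'e) atlas \<Rightarrow> ('v \<Rightarrow> 'v) \<Rightarrow> (('v \<times> real) set, 'e \<times> real) atlas"
  where "mapping_torus V \<phi> = push_atlas (mt_class V \<phi>) (V \<times>\<^sub>A line)"

definition collar_image :: "('v, 'e::euclidean_space) atlas \<Rightarrow> ('v \<times> real \<Rightarrow> 'v) \<Rightarrow> 'v set"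
  where "collar_image V c = c ` (bdry V \<times> {0..<1})"

definition collar :: "('v, 'e::euclidean_space) atlas \<Rightarrow> ('v \<times> real \<Rightarrow> 'v) \<Rightarrow> bool"
  where "collar V c \<longleftrightarrow>
    openin (mtop V) (collar_image V c) \<and>
    (\<forall>x\<in>bdry V. c (x, 0) = x) \<and>
    diffeo (sub_atlas (bdry V) V \<times>\<^sub>A {({0..<1}, id)}) (sub_atlas (collar_image V c) V) c"

text \<open>The set underlying \<open>MT(V,\<phi>) \<union> (\<partial>V \<times> D\<^sup>2)\<close> is the disjoint union of \<open>MT(V,\<phi>)\<close> and
  \<open>\<partial>V \<times> int D\<^sup>2\<close>, since a point \<open>(x, exp(2\<pi>it))\<close> of \<open>\<partial>V \<times> \<partial>D\<^sup>2\<close> is identified with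
  the class of \<open>(x, t)\<close>. As usual, the smooth structure across the glued boundaries is
  defined by collars. Here \<open>c\<close> is a collar of \<open>\<partial>V\<close> on whose image \<open>\<phi>\<close> is the identity. The
  set \<open>\<partial>V \<times> D\<^sup>2\<close> together with the resulting collar \<open>\<partial>V \<times> S\<^sup>1 \<times> [0,1)\<close> of \<open>\<partial>MT(V,\<phi>)\<close> is
  parametrized by the product of \<open>\<partial>V\<close> and the open disc of radius 2.\<close>

definition tube ::
    "('v, 'e) atlas \<Rightarrow> ('v \<Rightarrow> 'v) \<Rightarrow> ('v \<times> real \<Rightarrow> 'v) \<Rightarrow> 'v \<times> complex \<Rightarrow>
     ('v \<times> real) set + 'v \<times> complex"
  where "tube V \<phi> c = (\<lambda>(x, z).
    if norm z < 1 then Inr (x, z)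
    else Inl (mt_class V \<phi> (c (x, norm z - 1), Arg2pi z / (2 * pi))))"

text \<open>The charts are those of the interior of \<open>MT(V,\<phi>)\<close> and those of the enlarged
  \<open>\<partial>V \<times> D\<^sup>2\<close>. The linear embedding of \<open>'e \<times> \<real>\<close> into \<open>'e \<times> \<complex>\<close> only serves
  to give all charts the same target type; the chart images lie in codimension-one affine
  subspaces.\<close>

definition open_book ::
    "('v, 'e::euclidean_space) atlas \<Rightarrow> ('v \<Rightarrow> 'v) \<Rightarrow> ('v \<times> real \<Rightarrow> 'v) \<Rightarrow>
     (('v \<times> real) set + 'v \<times> complex, 'e \<times> complex) atlas"
  where "open_book V \<phi> c =
    (\<lambda>(U, \<kappa>). (U, map_prod id of_real \<circ> \<kappa>)) `
      push_atlas Inl (sub_atlas (- bdry (mapping_torus V \<phi>)) (mapping_torus V \<phi>)) \<union>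
    push_atlas (tube V \<phi> c) (sub_atlas (bdry V) V \<times>\<^sub>A {(ball 0 2, id)})"

definition page ::
    "('v, 'e::euclidean_space) atlas \<Rightarrow> ('v \<Rightarrow> 'v) \<Rightarrow> ('v \<times> real \<Rightarrow> 'v) \<Rightarrow> real \<Rightarrow>
     (('v \<times> real) set + 'v \<times> complex) set"
  where "page V \<phi> c \<theta> =
    (\<lambda>x. Inl (mt_class V \<phi> (x, \<theta>))) ` points V \<union>
    (\<lambda>(x, r). tube V \<phi> c (x, rcis r (2 * pi * \<theta>))) ` (bdry V \<times> {0..1})"

text \<open>The page is \<open>V \<times> {\<theta>}\<close> with an annulus attached, so it is identified with \<open>V\<close> by stretching
  the collar: away from the collar the identification is the obvious one, and it takes
  \<open>\<partial>V\<close> to the binding by \<open>x \<mapsto> (x, 0)\<close>. Some such condition is needed for \<open>\<phi>\<close>, rather than a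
  conjugate of it, to be the monodromy with respect to the embedded page.\<close>

definition page_embedding ::
    "('v, 'e::euclidean_space) atlas \<Rightarrow> ('v \<Rightarrow> 'v) \<Rightarrow> ('v \<times> real \<Rightarrow> 'v) \<Rightarrow> real \<Rightarrow>
     ('v \<Rightarrow> ('v \<times> real) set + 'v \<times> complex) \<Rightarrow> bool"
  where "page_embedding V \<phi> c \<theta> j \<longleftrightarrow>
    smooth_embedding V (open_book V \<phi> c) j \<and>
    j ` points V = page V \<phi> c \<theta> \<and>
    (\<forall>x\<in>points V - collar_image V c. j x = Inl (mt_class V \<phi> (x, \<theta>))) \<and>
    (\<forall>x\<in>bdry V. j x = tube V \<phi> c (x, 0))"

subsection \<open>Isotopies and Seifert type embeddings\<close>

definition isotopy_of_embeddings ::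
    "('a, 'e::euclidean_space) atlas \<Rightarrow> ('b, 'f::euclidean_space) atlas \<Rightarrow>
     (real \<Rightarrow> 'a \<Rightarrow> 'b) \<Rightarrow> bool"
  where "isotopy_of_embeddings M N F \<longleftrightarrow>
    smooth_map (interval 0 1 \<times>\<^sub>A M) N (\<lambda>(s, x). F s x) \<and>
    (\<forall>s\<in>{0..1}. smooth_embedding M N (F s))"

definition isotopy_of_diffeos ::
    "('a, 'e::euclidean_space) atlas \<Rightarrow> (real \<Rightarrow> 'a \<Rightarrow> 'a) \<Rightarrow> bool"
  where "isotopy_of_diffeos M \<Gamma> \<longleftrightarrow>
    smooth_map (interval 0 1 \<times>\<^sub>A M) M (\<lambda>(s, x). \<Gamma> s x) \<and>
    (\<forall>s\<in>{0..1}. diffeo M M (\<Gamma> s))"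

text \<open>\<open>\<Sigma>\<close> is a submanifold of \<open>M\<close> by means of the embedding \<open>\<iota>\<close>. The set \<open>W\<close> is the neighborhood
  of the corner \<open>\<iota>(\<partial>\<Sigma>) \<times> {b}\<close> in which the image \<open>(\<partial>\<Sigma> \<times> [a,b]) \<union> (\<Sigma> \<times> {b})\<close> is rounded; the
  rounding takes place inside \<open>\<Sigma> \<times> [a,b]\<close>.\<close>

definition seifert_embedding ::
    "('a, 'e::euclidean_space) atlas \<Rightarrow> real \<Rightarrow> real \<Rightarrow> ('s, 'f::euclidean_space) atlas \<Rightarrow>
     ('s \<Rightarrow> 'a) \<Rightarrow> ('a \<times> real) set \<Rightarrow> ('s \<Rightarrow> 'a \<times> real) \<Rightarrow> bool"
  where "seifert_embedding M a b \<Sigma> \<iota> W f \<longleftrightarrow>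
    (\<exists>F. isotopy_of_embeddings \<Sigma> (M \<times>\<^sub>A interval a b) F \<and>
         (\<forall>x\<in>points \<Sigma>. F 0 x = (\<iota> x, a) \<and> F 1 x = f x) \<and>
         (\<forall>s\<in>{0..1}. \<forall>x\<in>bdry \<Sigma>. F s x = (\<iota> x, a))) \<and>
    f ` (points \<Sigma> - bdry \<Sigma>) \<subseteq> points M \<times> {a<..b} \<and>
    f ` points \<Sigma> - W = (\<iota> ` bdry \<Sigma> \<times> {a..b} \<union> \<iota> ` points \<Sigma> \<times> {b}) - W \<and>
    f ` points \<Sigma> \<subseteq> \<iota> ` points \<Sigma> \<times> {a..b}"

end

theory Submission
  imports Defs
begin

text \<open>Rotating the open book once around its binding moves every page through all the others back to
  itself; on the mapping torus this is the flow in the \<open>\<real>\<close>-direction, whose time-one map restricts to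
  \<open>\<phi>\<close> on a page, and on \<open>\<partial>V \<times> D\<^sup>2\<close> it is the rotation of the disc, which fixes the binding. Performing
  the rotation by the angle \<open>2\<pi> s \<lambda>(t)\<close> on the level \<open>N \<times> {t}\<close>, with \<open>\<lambda> = 1\<close> on \<open>[-1/2,0]\<close> and
  \<open>\<lambda>(\<plusminus>1) = 0\<close>, gives the isotopy. A Seifert type embedding of the page consists of a vertical part
  over the binding, fixed by all rotations, and of a part lying in the levels where \<open>\<lambda> = 1\<close>, which is
  rotated once. Its corner is rounded in the collar, where \<open>\<phi>\<close> is the identity.\<close>

text \<open>The hypotheses do not say directly that the charts of the open book are compatible;
  their images lie in affine subspaces of codimension one, and the two kinds of charts overlap along
  the collar. Compatibility is extracted from the diffeomorphism \<Psi> onto \<open>N\<close> by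
  invariance of domain. The rotation is an action of the additive group of real numbers, jointly
  smooth in the point and the angle. Hence the inverse of each level-preserving map of the isotopy
  is given by the opposite time. Away from \<open>W\<close> the image of the embedding must be
  exactly a vertical wall with a horizontal top. In a collar it is therefore a plane curve whose
  horizontal coordinate \<open>stretch\<close> is constant up to \<open>p\<close> and whose level
  \<open>lift\<close> is constant from \<open>q\<close> on; with p < q the two derivatives never
  vanish together, and the corner is rounded for arguments between \<open>p\<close> and
  \<open>q\<close>. How the page embedding stretches the collar is not known. It suffices that
  collar points land in the tube around the binding, where a full rotation is the identity.\<close>

section \<open>Calculus of finitely often differentiable functions on open sets\<close>

lemma C_k_on_subset: "C_k_on k S f \<Longrightarrow> T \<subseteq> S \<Longrightarrow> C_k_on k T f"
  by (induction k arbitrary: f) (auto intro: continuous_on_subset)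

lemma C_k_on_cong:
  assumes "open S" "\<And>x. x \<in> S \<Longrightarrow> f x = g x" "C_k_on k S f"
  shows "C_k_on k S g"
  using assms(2,3)
proof (induction k arbitrary: f g)
  case 0
  then show ?case by (auto cong: continuous_on_cong)
next
  case (Suc k)
  have d: "(g has_derivative frechet_derivative f (at x)) (at x)" if "x \<in> S" for x
  proof -
    have "(f has_derivative frechet_derivative f (at x)) (at x)"
      using Suc.prems(2) that by (auto simp: frechet_derivative_works)
    then show ?thesis
      by (rule has_derivative_transform_within_open[OF _ \<open>open S\<close> that]) (use Suc.prems(1) in auto)
  qed
  have "C_k_on k S (\<lambda>x. frechet_derivative g (at x) v)" for v
    by (rule Suc.IH[of "\<lambda>x. frechet_derivative f (at x) v"])
      (use Suc.prems(2) frechet_derivative_at[OF d] in auto)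
  with d show ?case by (auto simp: differentiable_def)
qed

text \<open>\<open>C_k_on\<close> is phrased with the chosen \<open>frechet_derivative\<close>. The
  derivative at a point is unique, so any explicit formula for it may be used instead; the
  regularity proofs for sums, products and compositions go through this rule.\<close>

lemma C_k_on_SucI:
  assumes "open S" and d: "\<And>x. x \<in> S \<Longrightarrow> (f has_derivative f' x) (at x)"
    and "\<And>v. C_k_on k S (\<lambda>x. f' x v)"
  shows "C_k_on (Suc k) S f"
proof -
  have "C_k_on k S (\<lambda>x. frechet_derivative f (at x) v)" for v
    by (rule C_k_on_cong[OF \<open>open S\<close> _ assms(3)[of v]]) (simp add: frechet_derivative_at[OF d, symmetric])
  then show ?thesis using d by (auto simp: differentiable_def)
qed

lemma C_k_on_Suc_derivative:
  assumes "C_k_on (Suc k) S f" "x \<in> S"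
  shows "(f has_derivative frechet_derivative f (at x)) (at x)"
  using assms by (auto simp: frechet_derivative_works)

lemma C_k_on_continuous: "C_k_on k S f \<Longrightarrow> continuous_on S f"
  by (cases k) (auto intro!: continuous_at_imp_continuous_on differentiable_imp_continuous_within)

lemma C_k_on_SucD: "C_k_on (Suc k) S f \<Longrightarrow> C_k_on k S f"
proof (induction k arbitrary: f)
  case 0
  then show ?case using C_k_on_continuous[of "Suc 0"] by simp
next
  case (Suc k)
  then have "\<forall>x\<in>S. f differentiable at x" "\<And>v. C_k_on (Suc k) S (\<lambda>x. frechet_derivative f (at x) v)"
    by simp_all
  with Suc.IH show ?case by (metis C_k_on.simps(2))
qed

lemma C_k_on_const: "open S \<Longrightarrow> C_k_on k S (\<lambda>x. d)"
proof (induction k arbitrary: d)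
  case (Suc k)
  then show ?case by (intro C_k_on_SucI[where f' = "\<lambda>x v. 0"]) auto
qed simp

lemma C_k_on_linear:
  assumes "open S" "bounded_linear L"
  shows "C_k_on k S L"
proof (cases k)
  case 0
  then show ?thesis by (simp add: assms(2) linear_continuous_on)
next
  case (Suc n)
  show ?thesis unfolding Suc
    by (rule C_k_on_SucI[where f' = "\<lambda>x. L"])
      (use assms in \<open>auto intro: C_k_on_const bounded_linear_imp_has_derivative\<close>)
qed

lemma C_k_on_linear_compose:
  assumes "open S" "bounded_linear L" "C_k_on k S f"
  shows "C_k_on k S (\<lambda>x. L (f x))"
  using assms(3)
proof (induction k arbitrary: f)
  case 0
  then show ?case using bounded_linear.continuous_on[OF assms(2), of S f] by simp
next
  case (Suc k)
  show ?case
  proof (rule C_k_on_SucI[OF assms(1), where f' = "\<lambda>x v. L (frechet_derivative f (at x) v)"])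
    show "((\<lambda>x. L (f x)) has_derivative (\<lambda>v. L (frechet_derivative f (at x) v))) (at x)" if "x \<in> S" for x
      by (rule bounded_linear.has_derivative[OF assms(2) C_k_on_Suc_derivative[OF Suc.prems that]])
    show "C_k_on k S (\<lambda>x. L (frechet_derivative f (at x) v))" for v
      using Suc by auto
  qed
qed

lemma C_k_on_add:
  assumes "open S" "C_k_on k S f" "C_k_on k S g"
  shows "C_k_on k S (\<lambda>x. f x + g x)"
  using assms(2,3)
proof (induction k arbitrary: f g)
  case (Suc k)
  show ?case
  proof (rule C_k_on_SucI[OF assms(1), where f' = "\<lambda>x v. frechet_derivative f (at x) v + frechet_derivative g (at x) v"])
    show "((\<lambda>x. f x + g x) has_derivative
        (\<lambda>v. frechet_derivative f (at x) v + frechet_derivative g (at x) v)) (at x)" if "x \<in> S" for x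
      by (intro has_derivative_add C_k_on_Suc_derivative[OF Suc.prems(1) that]
          C_k_on_Suc_derivative[OF Suc.prems(2) that])
  qed (use Suc in auto)
qed (auto intro: continuous_intros)

lemma C_k_on_scaleR:
  fixes f :: "'a::euclidean_space \<Rightarrow> real"
  assumes "open S" "C_k_on k S f" "C_k_on k S g"
  shows "C_k_on k S (\<lambda>x. f x *\<^sub>R g x)"
  using assms(2,3)
proof (induction k arbitrary: f g)
  case (Suc k)
  show ?case
  proof (rule C_k_on_SucI[OF assms(1), where f' = "\<lambda>x v. f x *\<^sub>R frechet_derivative g (at x) v
        + frechet_derivative f (at x) v *\<^sub>R g x"])
    show "((\<lambda>x. f x *\<^sub>R g x) has_derivative
        (\<lambda>v. f x *\<^sub>R frechet_derivative g (at x) v + frechet_derivative f (at x) v *\<^sub>R g x)) (at x)"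
      if "x \<in> S" for x
      by (intro has_derivative_scaleR C_k_on_Suc_derivative[OF Suc.prems(1) that]
          C_k_on_Suc_derivative[OF Suc.prems(2) that])
    show "C_k_on k S (\<lambda>x. f x *\<^sub>R frechet_derivative g (at x) v + frechet_derivative f (at x) v *\<^sub>R g x)" for v
      using Suc.prems C_k_on_SucD[OF Suc.prems(1)] C_k_on_SucD[OF Suc.prems(2)]
      by (intro C_k_on_add assms(1) Suc.IH) auto
  qed
qed (auto intro: continuous_intros)

lemma C_k_on_sum:
  assumes "open S" "\<And>i. i \<in> I \<Longrightarrow> C_k_on k S (f i)"
  shows "C_k_on k S (\<lambda>x. \<Sum>i\<in>I. f i x)"
  using assms(2) by (induction I rule: infinite_finite_induct) (auto intro: C_k_on_const C_k_on_add assms(1))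

text \<open>The chain rule applies the derivative of \<open>g\<close> to a vector that varies with
  \<open>x\<close>, while \<open>C_k_on\<close> controls derivatives only in fixed directions.
  Expanding the vector in the basis gives a finite sum of scalar functions times derivatives in
  fixed directions, to which the induction hypothesis applies.\<close>

lemma C_k_on_compose:
  fixes f :: "'a::euclidean_space \<Rightarrow> 'b::euclidean_space"
  assumes "open S" "C_k_on k S f" "C_k_on k T g" "f ` S \<subseteq> T"
  shows "C_k_on k S (\<lambda>x. g (f x))"
  using assms(2,3)
proof (induction k arbitrary: g)
  case 0
  then show ?case using continuous_on_compose2[of T g S f] assms(4) by auto
next
  case (Suc k)
  note d = C_k_on_Suc_derivative[OF Suc.prems(1)] C_k_on_Suc_derivative[OF Suc.prems(2)]
  have eq: "frechet_derivative g (at (f x)) (frechet_derivative f (at x) v)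
     = (\<Sum>b\<in>Basis. (frechet_derivative f (at x) v \<bullet> b) *\<^sub>R frechet_derivative g (at (f x)) b)"
    if "x \<in> S" for x v
  proof -
    have l: "linear (frechet_derivative g (at (f x)))"
      using d(2)[of "f x"] assms(4) that by (intro has_derivative_linear) blast
    have "frechet_derivative g (at (f x)) (frechet_derivative f (at x) v)
      = frechet_derivative g (at (f x)) (\<Sum>b\<in>Basis. (frechet_derivative f (at x) v \<bullet> b) *\<^sub>R b)"
      by (simp add: euclidean_representation)
    then show ?thesis by (simp add: linear_sum[OF l] linear_scale[OF l])
  qed
  show ?case
  proof (rule C_k_on_SucI[OF assms(1)])
    show "((\<lambda>x. g (f x)) has_derivative
        (\<lambda>v. frechet_derivative g (at (f x)) (frechet_derivative f (at x) v))) (at x)" if "x \<in> S" for x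
      using diff_chain_at[OF d(1)[OF that] d(2)[of "f x"]] assms(4) that by (auto simp: o_def)
    have "C_k_on k S (\<lambda>x. \<Sum>b\<in>Basis. (frechet_derivative f (at x) v \<bullet> b) *\<^sub>R frechet_derivative g (at (f x)) b)" for v
    proof (intro C_k_on_sum C_k_on_scaleR assms(1))
      show "C_k_on k S (\<lambda>x. frechet_derivative f (at x) v \<bullet> b)" for b
        by (rule C_k_on_linear_compose[OF assms(1) bounded_linear_inner_left]) (use Suc.prems in auto)
      show "C_k_on k S (\<lambda>x. frechet_derivative g (at (f x)) b)" for b
        by (rule Suc.IH) (use C_k_on_SucD[OF Suc.prems(1)] Suc.prems in auto)
    qed
    then show "C_k_on k S (\<lambda>x. frechet_derivative g (at (f x)) (frechet_derivative f (at x) v))" for v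
      by (rule C_k_on_cong[OF assms(1), rotated]) (simp add: eq)
  qed
qed

lemma C_k_on_Pair:
  assumes "open S" "C_k_on k S f" "C_k_on k S g"
  shows "C_k_on k S (\<lambda>x. (f x, g x))"
proof -
  have "C_k_on k S (\<lambda>x. (f x, 0) + (0, g x))"
    by (intro C_k_on_add assms(1) C_k_on_linear_compose[OF assms(1) _ assms(2)]
        C_k_on_linear_compose[OF assms(1) _ assms(3)] bounded_linear_Pair
        bounded_linear_ident bounded_linear_zero)
  then show ?thesis by simp
qed

lemma C_k_on_real:
  fixes f :: "real \<Rightarrow> real"
  assumes "open S" "\<And>x. x \<in> S \<Longrightarrow> (f has_real_derivative f' x) (at x)" "C_k_on k S f'"
  shows "C_k_on (Suc k) S f"
proof (rule C_k_on_SucI[OF assms(1), where f' = "\<lambda>x v. f' x * v"])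
  show "C_k_on k S (\<lambda>x. f' x * v)" for v
    using C_k_on_linear_compose[OF assms(1) bounded_linear_mult_left assms(3)] .
qed (use assms(2) in \<open>auto simp: has_field_derivative_def\<close>)

subsection \<open>Smooth functions on arbitrary sets\<close>

lemma smooth_onE:
  assumes "smooth_on S f" "x \<in> S"
  obtains W g where "open W" "x \<in> W" "\<And>k. C_k_on k W g" "\<And>y. y \<in> S \<Longrightarrow> y \<in> W \<Longrightarrow> g y = f y"
proof -
  have "\<exists>W g. open W \<and> x \<in> W \<and> (\<forall>k. C_k_on k W g) \<and> (\<forall>y\<in>S \<inter> W. g y = f y)"
    using assms(1) unfolding smooth_on_def by (rule bspec[OF _ assms(2)])
  then show ?thesis by (auto intro: that)
qed

lemma smooth_onI:
  assumes "\<And>x. x \<in> S \<Longrightarrow> \<exists>W g. open W \<and> x \<in> W \<and> (\<forall>k. C_k_on k W g) \<and> (\<forall>y\<in>S \<inter> W. g y = f y)"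
  shows "smooth_on S f"
  unfolding smooth_on_def using assms by (rule ballI)

lemma smooth_onI_open:
  assumes "open W" "S \<subseteq> W" "\<And>k. C_k_on k W f"
  shows "smooth_on S f"
  by (rule smooth_onI) (use assms in \<open>auto intro!: exI[of _ W] exI[of _ f]\<close>)

lemma smooth_on_subset:
  assumes "smooth_on S f" "T \<subseteq> S" shows "smooth_on T f"
proof (rule smooth_onI)
  fix x assume "x \<in> T"
  then have "x \<in> S" using assms(2) by blast
  with assms(1) obtain W g where "open W" "x \<in> W" "\<And>k. C_k_on k W g" "\<And>y. y \<in> S \<Longrightarrow> y \<in> W \<Longrightarrow> g y = f y"
    by (rule smooth_onE) (rule that)
  then show "\<exists>W g. open W \<and> x \<in> W \<and> (\<forall>k. C_k_on k W g) \<and> (\<forall>y\<in>T \<inter> W. g y = f y)"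
    using assms(2) by (intro exI[of _ W] exI[of _ g]) auto
qed

lemma smooth_on_cong:
  assumes "smooth_on S f" "\<And>x. x \<in> S \<Longrightarrow> f x = g x"
  shows "smooth_on S g"
proof (rule smooth_onI)
  fix x assume "x \<in> S"
  with assms(1) obtain W h where "open W" "x \<in> W" "\<And>k. C_k_on k W h" "\<And>y. y \<in> S \<Longrightarrow> y \<in> W \<Longrightarrow> h y = f y"
    by (rule smooth_onE) (rule that)
  then show "\<exists>W h. open W \<and> x \<in> W \<and> (\<forall>k. C_k_on k W h) \<and> (\<forall>y\<in>S \<inter> W. h y = g y)"
    using assms(2) by (intro exI[of _ W] exI[of _ h]) auto
qed

lemma smooth_on_local:
  assumes "\<And>x. x \<in> S \<Longrightarrow> \<exists>W. open W \<and> x \<in> W \<and> smooth_on (S \<inter> W) f"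
  shows "smooth_on S f"
proof (rule smooth_onI)
  fix x assume x: "x \<in> S"
  then obtain W where W: "open W" "x \<in> W" "smooth_on (S \<inter> W) f" using assms by blast
  obtain W' g where W': "open W'" "x \<in> W'" "\<And>k. C_k_on k W' g"
      "\<And>y. y \<in> S \<inter> W \<Longrightarrow> y \<in> W' \<Longrightarrow> g y = f y"
    by (rule smooth_onE[OF W(3) IntI[OF x W(2)]]) (rule that)
  show "\<exists>W g. open W \<and> x \<in> W \<and> (\<forall>k. C_k_on k W g) \<and> (\<forall>y\<in>S \<inter> W. g y = f y)"
    by (rule exI[of _ "W \<inter> W'"], rule exI[of _ g]) (use W W' in \<open>auto intro: C_k_on_subset\<close>)
qed

lemma smooth_on_continuous:
  assumes "smooth_on S f" shows "continuous_on S f"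
  unfolding continuous_on_eq_continuous_within
proof
  fix x assume x: "x \<in> S"
  obtain W g where W: "open W" "x \<in> W" "\<And>k. C_k_on k W g" "\<And>y. y \<in> S \<Longrightarrow> y \<in> W \<Longrightarrow> g y = f y"
    by (rule smooth_onE[OF assms(1) x]) (rule that)
  have "isCont g x" using W(1-3) C_k_on_continuous[of 0 W g] by (auto simp: continuous_on_eq_continuous_at)
  then have "continuous (at x within S) g" by (rule continuous_at_imp_continuous_at_within)
  moreover have "\<forall>\<^sub>F y in at x within S. g y = f y"
    using W by (auto simp: eventually_at_topological)
  ultimately show "continuous (at x within S) f"
    using W x by (simp add: continuous_within filterlim_cong)
qed

lemma smooth_on_has_derivative:
  assumes "smooth_on S f" and x: "x \<in> S"
  shows "\<exists>D. (f has_derivative D) (at x within S)"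
proof -
  obtain W g where W: "open W" "x \<in> W" "\<And>k. C_k_on k W g" "\<And>y. y \<in> S \<Longrightarrow> y \<in> W \<Longrightarrow> g y = f y"
    by (rule smooth_onE[OF assms(1) x]) (rule that)
  have "(g has_derivative frechet_derivative g (at x)) (at x)"
    by (rule C_k_on_Suc_derivative) (use W in auto)
  then have "(g has_derivative frechet_derivative g (at x)) (at x within S)"
    by (rule has_derivative_at_withinI)
  then have "(f has_derivative frechet_derivative g (at x)) (at x within S)"
    by (rule has_derivative_transform_eventually)
      (use W assms(2) in \<open>auto simp: eventually_at_topological\<close>)
  then show ?thesis by blast
qed

lemma smooth_on_compose:
  fixes f :: "'a::euclidean_space \<Rightarrow> 'b::euclidean_space"
  assumes "smooth_on S f" "smooth_on T g" "f ` S \<subseteq> T"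
  shows "smooth_on S (\<lambda>x. g (f x))"
proof (rule smooth_onI)
  fix x assume x: "x \<in> S"
  obtain W F where W: "open W" "x \<in> W" "\<And>k. C_k_on k W F" "\<And>y. y \<in> S \<Longrightarrow> y \<in> W \<Longrightarrow> F y = f y"
    by (rule smooth_onE[OF assms(1) x]) (rule that)
  have fx: "f x \<in> T" using x assms(3) by blast
  obtain X G where X: "open X" "f x \<in> X" "\<And>k. C_k_on k X G" "\<And>y. y \<in> T \<Longrightarrow> y \<in> X \<Longrightarrow> G y = g y"
    by (rule smooth_onE[OF assms(2) fx]) (rule that)
  \<comment> \<open>The extension \<open>F\<close> agrees with \<open>f\<close> only on
    \<open>S\<close>, so elsewhere it may leave the domain \<open>X\<close> of \<open>G\<close>; it
    is cut down to the preimage of \<open>X\<close>.\<close>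
  define Y where "Y = W \<inter> F -` X"
  have Y: "open Y" unfolding Y_def
    using C_k_on_continuous[OF W(3)] W(1) X(1) by (simp add: continuous_open_preimage)
  have "C_k_on k Y (\<lambda>x. G (F x))" for k
    by (rule C_k_on_compose[OF Y _ X(3)[of k]]) (auto simp: Y_def intro: C_k_on_subset W(3))
  moreover have "x \<in> Y" using x W X by (auto simp: Y_def)
  moreover have "\<forall>y\<in>S \<inter> Y. G (F y) = g (f y)" using W(4) X(4) assms(3) by (auto simp: Y_def)
  ultimately show "\<exists>W h. open W \<and> x \<in> W \<and> (\<forall>k. C_k_on k W h) \<and> (\<forall>y\<in>S \<inter> W. h y = g (f y))"
    using Y by blast
qed

lemma smooth_on_Pair:
  assumes "smooth_on S f" "smooth_on S g"
  shows "smooth_on S (\<lambda>x. (f x, g x))"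
proof (rule smooth_onI)
  fix x assume x: "x \<in> S"
  obtain W F where W: "open W" "x \<in> W" "\<And>k. C_k_on k W F" "\<And>y. y \<in> S \<Longrightarrow> y \<in> W \<Longrightarrow> F y = f y"
    by (rule smooth_onE[OF assms(1) x]) (rule that)
  obtain X G where X: "open X" "x \<in> X" "\<And>k. C_k_on k X G" "\<And>y. y \<in> S \<Longrightarrow> y \<in> X \<Longrightarrow> G y = g y"
    by (rule smooth_onE[OF assms(2) x]) (rule that)
  have "C_k_on k (W \<inter> X) (\<lambda>x. (F x, G x))" for k
    using W X by (intro C_k_on_Pair) (auto intro: C_k_on_subset)
  then show "\<exists>W h. open W \<and> x \<in> W \<and> (\<forall>k. C_k_on k W h) \<and> (\<forall>y\<in>S \<inter> W. h y = (f y, g y))"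
    using W X by (intro exI[of _ "W \<inter> X"] exI[of _ "\<lambda>x. (F x, G x)"]) auto
qed

lemma smooth_on_linear: "bounded_linear L \<Longrightarrow> smooth_on S L"
  by (rule smooth_onI_open[of UNIV]) (auto intro: C_k_on_linear)

lemma smooth_on_const: "smooth_on S (\<lambda>x. d)"
  by (rule smooth_onI_open[of UNIV]) (auto intro: C_k_on_const)

lemma smooth_on_id: "smooth_on S (\<lambda>x. x)"
  using smooth_on_linear[OF bounded_linear_ident] .

lemma smooth_on_add:
  fixes f g :: "'a::euclidean_space \<Rightarrow> 'b::euclidean_space"
  assumes "smooth_on S f" "smooth_on S g"
  shows "smooth_on S (\<lambda>x. f x + g x)"
proof -
  have "smooth_on UNIV (\<lambda>p. fst p + snd p :: 'b)"
    by (intro smooth_on_linear bounded_linear_add bounded_linear_fst bounded_linear_snd)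
  from smooth_on_compose[OF smooth_on_Pair[OF assms] this] show ?thesis by simp
qed

lemma smooth_on_scaleR:
  fixes f :: "'a::euclidean_space \<Rightarrow> real" and g :: "'a \<Rightarrow> 'b::euclidean_space"
  assumes "smooth_on S f" "smooth_on S g"
  shows "smooth_on S (\<lambda>x. f x *\<^sub>R g x)"
proof -
  have "smooth_on UNIV (\<lambda>p. fst p *\<^sub>R snd p :: 'b)"
    by (rule smooth_onI_open[of UNIV])
      (intro C_k_on_scaleR C_k_on_linear bounded_linear_fst bounded_linear_snd open_UNIV subset_UNIV)+
  from smooth_on_compose[OF smooth_on_Pair[OF assms] this] show ?thesis by simp
qed

lemma smooth_on_mult:
  fixes f g :: "'a::euclidean_space \<Rightarrow> real"
  assumes "smooth_on S f" "smooth_on S g"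
  shows "smooth_on S (\<lambda>x. f x * g x)"
  using smooth_on_scaleR[OF assms] by simp

lemma smooth_on_diff:
  fixes f g :: "'a::euclidean_space \<Rightarrow> real"
  assumes "smooth_on S f" "smooth_on S g"
  shows "smooth_on S (\<lambda>x. f x - g x)"
  using smooth_on_add[OF assms(1) smooth_on_scaleR[OF smooth_on_const[of S "-1"] assms(2)]] by simp

text \<open>Each function is, up to sign, the derivative of the other, so the induction on the order
  has to carry both at once.\<close>

lemma smooth_on_cos_sin: "smooth_on S (cos :: real \<Rightarrow> real)" "smooth_on S (sin :: real \<Rightarrow> real)"
proof -
  have neg: "bounded_linear (\<lambda>x::real. - x)"
    by (rule bounded_linear_minus[OF bounded_linear_ident])
  have "C_k_on k UNIV (cos :: real \<Rightarrow> real) \<and> C_k_on k UNIV (sin :: real \<Rightarrow> real)" for k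
  proof (induction k)
    case (Suc k)
    have "C_k_on k UNIV (\<lambda>x::real. - sin x)"
      using C_k_on_linear_compose[OF open_UNIV neg] Suc.IH by blast
    then have "C_k_on (Suc k) UNIV (cos :: real \<Rightarrow> real)"
      by (rule C_k_on_real[OF open_UNIV DERIV_cos])
    moreover have "C_k_on (Suc k) UNIV (sin :: real \<Rightarrow> real)"
      by (rule C_k_on_real[OF open_UNIV DERIV_sin]) (use Suc.IH in simp)
    ultimately show ?case by blast
  qed (auto intro: continuous_intros)
  then show "smooth_on S (cos :: real \<Rightarrow> real)" "smooth_on S (sin :: real \<Rightarrow> real)"
    by (auto intro: smooth_onI_open[of UNIV])
qed

subsection \<open>Flat functions and smooth steps\<close>

text \<open>The functions exp(-1/u)/u^n, extended by 0, are closed under differentiation up to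
  linear combinations, so the whole family is shown to be smooth at once. Index 0 is the classical
  smooth function that is flat at the origin; the higher indices arise from its derivatives.\<close>

definition flat :: "nat \<Rightarrow> real \<Rightarrow> real"
  where "flat n u = (if u > 0 then exp (- (1 / u)) / u ^ n else 0)"

text \<open>A quadratic bound is what differentiability at 0 calls for. It comes from comparing
  exp(1/u) with the single term of index n + 2 of its power series: n powers of 1/u absorb the
  denominator and two are left over.\<close>

lemma flat_bound: "\<bar>flat n u\<bar> \<le> fact (n + 2) * u\<^sup>2"
proof (cases "u > 0")
  case True
  define m C where "m = n + 2" and "C = (fact (n + 2) :: real)"
  have C: "C > 0" by (simp add: C_def)
  have "(\<Sum>k\<in>{n + 2}. (1 / u) ^ k /\<^sub>R fact k) \<le> exp (1 / u)"
    unfolding exp_def by (rule sum_le_suminf[OF summable_exp_generic]) (use True in auto)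
  then have "(1 / u) ^ m / C \<le> exp (1 / u)"
    by (simp add: m_def C_def divide_inverse_commute)
  then have "1 \<le> exp (1 / u) * C * u ^ m"
    using True C by (simp add: power_one_over field_simps)
  then have "exp (- (1 / u)) \<le> C * u ^ m"
    by (simp add: exp_minus field_simps)
  then have "exp (- (1 / u)) / u ^ n \<le> C * u\<^sup>2"
    using True by (simp add: m_def power_add field_simps power2_eq_square)
  then show ?thesis using True by (simp add: flat_def C_def)
qed (simp add: flat_def)

lemma DERIV_flat: "(flat n has_real_derivative flat (n + 2) u - real n * flat (n + 1) u) (at u)"
proof -
  consider "u > 0" | "u < 0" | "u = 0" by linarith
  then show ?thesis
  proof cases
    case 1
    have "((\<lambda>u. exp (- (1 / u)) / u ^ n) has_real_derivative flat (n + 2) u - real n * flat (n + 1) u) (at u)"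
      using 1 by (auto intro!: derivative_eq_intros simp: flat_def field_simps power2_eq_square)
         (cases n; simp add: field_simps)
    then show ?thesis
      by (rule has_field_derivative_transform_within_open[of _ _ _ "{0<..}"]) (use 1 in \<open>auto simp: flat_def\<close>)
  next
    case 2
    have "((\<lambda>u. 0) has_real_derivative flat (n + 2) u - real n * flat (n + 1) u) (at u)"
      using 2 by (simp add: flat_def)
    then show ?thesis
      by (rule has_field_derivative_transform_within_open[of _ _ _ "{..<0}"]) (use 2 in \<open>auto simp: flat_def\<close>)
  next
    case 3
    \<comment> \<open>Every member of the family vanishes on the nonpositive half-line, so the
      derivative claimed at the origin is 0; the quadratic bound makes the difference quotient at
      most a constant times |h|.\<close>
    have "((\<lambda>h. (flat n (0 + h) - flat n 0) / h) \<longlongrightarrow> 0) (at 0)"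
    proof (rule Lim_null_comparison)
      have "norm ((flat n (0 + h) - flat n 0) / h) \<le> fact (n + 2) * \<bar>h\<bar>" if "h \<noteq> 0" for h
      proof -
        have "\<bar>flat n h\<bar> \<le> fact (n + 2) * \<bar>h\<bar> * \<bar>h\<bar>"
          using flat_bound[of n h] unfolding power2_eq_square mult.assoc abs_mult_self_eq .
        then show ?thesis using that by (simp add: flat_def[of _ 0] pos_divide_le_eq )
      qed
      then show "\<forall>\<^sub>F h in at 0. norm ((flat n (0 + h) - flat n 0) / h) \<le> fact (n + 2) * \<bar>h\<bar>"
        by (auto simp: eventually_at intro: exI[of _ 1])
      show "((\<lambda>h::real. fact (n + 2) * \<bar>h\<bar>) \<longlongrightarrow> 0) (at 0)"
        by (auto intro!: tendsto_eq_intros)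
    qed
    then show ?thesis using 3 by (simp add: DERIV_def flat_def[of _ 0])
  qed
qed

lemma smooth_on_flat: "smooth_on S (flat n)"
proof -
  have "C_k_on k UNIV (flat n)" for k
  \<comment> \<open>The index stays arbitrary because differentiation raises it.\<close>
  proof (induction k arbitrary: n)
    case 0
    show ?case using DERIV_flat by (auto intro!: continuous_at_imp_continuous_on DERIV_isCont)
  next
    case (Suc k)
    have "C_k_on k UNIV (\<lambda>u. flat (n + 2) u + (- real n) *\<^sub>R flat (n + 1) u)"
      by (intro C_k_on_add C_k_on_scaleR C_k_on_const Suc.IH open_UNIV)
    then show ?case by (intro C_k_on_real[OF open_UNIV DERIV_flat]) simp
  qed
  then show ?thesis by (auto intro: smooth_onI_open[of UNIV])
qed

lemma DERIV_flat0: "(flat 0 has_real_derivative flat 2 u) (at u)"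
  using DERIV_flat[of 0 u] by (simp add: numeral_2_eq_2)

lemma flat_pos: "u > 0 \<Longrightarrow> flat n u > 0" and flat_nonneg: "flat n u \<ge> 0"
  and flat_eq_0: "u \<le> 0 \<Longrightarrow> flat n u = 0"
  by (auto simp: flat_def)

lemma flat0_less: "u < v \<Longrightarrow> 0 < v \<Longrightarrow> flat 0 u < flat 0 v"
  by (auto simp: flat_def frac_less2)

lemma flat0_mono: "u \<le> v \<Longrightarrow> flat 0 u \<le> flat 0 v"
  using flat0_less[of u v] by (cases "v > 0"; cases "u = v") (auto simp: flat_eq_0)

text \<open>A smooth step from 0 to 1 on [0, d], written as \<open>flat 0\<close> of a nonincreasing
  function instead of the usual quotient f(u) / (f(u) + f(d - u)). Its derivative is then visibly
  nonnegative: a product of two values of \<open>flat 2\<close> over a positive constant.\<close>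

definition step :: "real \<Rightarrow> real \<Rightarrow> real"
  where "step d u = 1 - flat 0 (flat 0 d - flat 0 u) / flat 0 (flat 0 d)"

lemma smooth_on_step: "smooth_on S (step d)"
proof -
  have "smooth_on S (\<lambda>u. 1 - flat 0 (flat 0 d - flat 0 u) * (1 / flat 0 (flat 0 d)))"
    by (intro smooth_on_diff smooth_on_mult smooth_on_const smooth_on_compose[of S _ UNIV "flat 0"] smooth_on_flat) auto
  then show ?thesis by (rule smooth_on_cong) (simp add: step_def)
qed

lemma step_props:
  assumes "d > 0"
  shows "u \<le> 0 \<Longrightarrow> step d u = 0" "u \<ge> d \<Longrightarrow> step d u = 1" "u > 0 \<Longrightarrow> step d u > 0"
    "step d u \<ge> 0" "step d u \<le> 1"
    "\<exists>D\<ge>0. (step d has_real_derivative D) (at u)"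
proof -
  have p: "flat 0 d > 0" "flat 0 (flat 0 d) > 0" using assms by (auto intro: flat_pos)
  show "u \<le> 0 \<Longrightarrow> step d u = 0" using p by (simp add: step_def flat_eq_0)
  show "u \<ge> d \<Longrightarrow> step d u = 1" using flat0_mono[of d u] by (simp add: step_def flat_eq_0)
  have "flat 0 (flat 0 d - flat 0 u) \<le> flat 0 (flat 0 d)" using flat_nonneg[of 0 u] by (intro flat0_mono) simp
  then show "step d u \<ge> 0" using p by (simp add: step_def)
  show "step d u \<le> 1" using p flat_nonneg[of 0 "flat 0 d - flat 0 u"] by (simp add: step_def)
  show "step d u > 0" if "u > 0"
    using flat0_less[of "flat 0 d - flat 0 u" "flat 0 d"] flat_pos[OF that, of 0] p by (simp add: step_def)
  have "(step d has_real_derivative flat 2 (flat 0 d - flat 0 u) * flat 2 u / flat 0 (flat 0 d)) (at u)"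
  proof -
    have "((\<lambda>u. flat 0 d - flat 0 u) has_real_derivative - flat 2 u) (at u)"
      by (auto intro!: derivative_eq_intros DERIV_flat0)
    from DERIV_diff[OF DERIV_const[of 1] DERIV_cdivide[OF DERIV_chain2[OF DERIV_flat0 this]]]
    show ?thesis by (simp add: step_def[abs_def])
  qed
  then show "\<exists>D\<ge>0. (step d has_real_derivative D) (at u)"
    using flat_nonneg p by (intro exI conjI) auto
qed

subsection \<open>Smooth atlases\<close>

text \<open>What remains of \<open>smooth_manifold\<close> without the half-space and separation
  conditions. In this form the notion passes to products and to restrictions to arbitrary subsets,
  so it covers boundaries, products with intervals and, once established there, the open book with
  its charts in affine subspaces.\<close>

definition smooth_atlas :: "('a, 'e::euclidean_space) atlas \<Rightarrow> bool"
  where "smooth_atlas M \<longleftrightarrow>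
    (\<forall>U \<kappa>. (U, \<kappa>) \<in> M \<longrightarrow> inj_on \<kappa> U \<and> openin (mtop M) U) \<and>
    (\<forall>U \<kappa> U' \<kappa>'. (U, \<kappa>) \<in> M \<longrightarrow> (U', \<kappa>') \<in> M \<longrightarrow>
       smooth_on (\<kappa> ` (U \<inter> U')) (\<kappa>' \<circ> inv_into U \<kappa>))"

lemma smooth_atlasD:
  assumes "smooth_atlas M" "(U, \<kappa>) \<in> M"
  shows "inj_on \<kappa> U" "openin (mtop M) U"
    "(U', \<kappa>') \<in> M \<Longrightarrow> smooth_on (\<kappa> ` (U \<inter> U')) (\<kappa>' \<circ> inv_into U \<kappa>)"
  using assms by (auto simp: smooth_atlas_def)

lemma chart_subset_points: "(U, \<kappa>) \<in> M \<Longrightarrow> U \<subseteq> points M"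
  by (auto simp: points_def)

lemma pointsE:
  assumes "x \<in> points M" obtains U \<kappa> where "(U, \<kappa>) \<in> M" "x \<in> U"
  using assms by (auto simp: points_def)

lemma openin_mtop_iff:
  "openin (mtop M) S \<longleftrightarrow> S \<subseteq> points M \<and>
    (\<forall>U \<kappa>. (U, \<kappa>) \<in> M \<longrightarrow> (\<exists>W. open W \<and> S \<inter> U = U \<inter> \<kappa> -` W))"
  unfolding openin_mtop openin_pullback_topology by (auto simp: Int_commute)

lemma openin_mtop_chartE:
  assumes "openin (mtop M) S" "(U, \<kappa>) \<in> M"
  obtains W where "open W" "\<And>x. x \<in> U \<Longrightarrow> x \<in> S \<longleftrightarrow> \<kappa> x \<in> W"
proof -
  obtain W where "open W" "S \<inter> U = U \<inter> \<kappa> -` W"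
    using assms unfolding openin_mtop_iff by metis
  then show ?thesis by (intro that[of W]) auto
qed

lemma openin_mtopI:
  assumes "S \<subseteq> points M"
    and "\<And>U \<kappa>. (U, \<kappa>) \<in> M \<Longrightarrow> \<exists>W. open W \<and> (\<forall>x\<in>U. x \<in> S \<longleftrightarrow> \<kappa> x \<in> W)"
  shows "openin (mtop M) S"
  unfolding openin_mtop_iff
proof (intro conjI allI impI assms(1))
  fix U \<kappa> assume "(U, \<kappa>) \<in> M"
  then obtain W where "open W" "\<forall>x\<in>U. x \<in> S \<longleftrightarrow> \<kappa> x \<in> W" using assms(2) by blast
  then show "\<exists>W. open W \<and> S \<inter> U = U \<inter> \<kappa> -` W" by (intro exI[of _ W]) auto
qed

lemma continuous_on_preimageE:
  assumes "continuous_on S f" "open W"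
  obtains T where "open T" "\<And>x. x \<in> S \<Longrightarrow> f x \<in> W \<longleftrightarrow> x \<in> T"
proof -
  have "openin (top_of_set S) (S \<inter> f -` W)"
    by (rule continuous_openin_preimage_gen[OF assms])
  then obtain T where "open T" "S \<inter> f -` W = S \<inter> T" by (auto simp: openin_open)
  then show ?thesis by (intro that[of T]) auto
qed

lemma smooth_atlasI:
  assumes inj: "\<And>U \<kappa>. (U, \<kappa>) \<in> M \<Longrightarrow> inj_on \<kappa> U"
    and dom: "\<And>U \<kappa> U' \<kappa>'. (U, \<kappa>) \<in> M \<Longrightarrow> (U', \<kappa>') \<in> M \<Longrightarrow> \<exists>W. open W \<and> (\<forall>x\<in>U. x \<in> U' \<longleftrightarrow> \<kappa> x \<in> W)"
    and sm: "\<And>U \<kappa> U' \<kappa>'. (U, \<kappa>) \<in> M \<Longrightarrow> (U', \<kappa>') \<in> M \<Longrightarrow>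
       \<exists>g. smooth_on (\<kappa> ` (U \<inter> U')) g \<and> (\<forall>x\<in>U \<inter> U'. g (\<kappa> x) = \<kappa>' x)"
  shows "smooth_atlas M"
  unfolding smooth_atlas_def
proof (intro conjI allI impI inj)
  fix U \<kappa> assume "(U, \<kappa>) \<in> M"
  then show "openin (mtop M) U"
    by (intro openin_mtopI chart_subset_points dom)
next
  fix U \<kappa> U' \<kappa>' assume c: "(U, \<kappa>) \<in> M" "(U', \<kappa>') \<in> M"
  then obtain g where "smooth_on (\<kappa> ` (U \<inter> U')) g" "\<forall>x\<in>U \<inter> U'. g (\<kappa> x) = \<kappa>' x" using sm by metis
  then show "smooth_on (\<kappa> ` (U \<inter> U')) (\<kappa>' \<circ> inv_into U \<kappa>)"
    by (elim smooth_on_cong) (use inj[OF c(1)] in auto)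
qed

text \<open>Transition maps are used through the relation g (\<kappa> x) = \<kappa>' x, which keeps
  \<open>inv_into\<close> out of later arguments.\<close>

lemma smooth_atlas_transition:
  assumes "smooth_atlas M" "(U, \<kappa>) \<in> M" "(U', \<kappa>') \<in> M"
  obtains g where "smooth_on (\<kappa> ` (U \<inter> U')) g" "\<And>x. x \<in> U \<Longrightarrow> x \<in> U' \<Longrightarrow> g (\<kappa> x) = \<kappa>' x"
  by (rule that[OF smooth_atlasD(3)[OF assms]]) (use smooth_atlasD(1)[OF assms(1,2)] in auto)

text \<open>Openness in \<open>mtop\<close> is tested in all charts. A set that is open in one chart
  passes the test in the others because the transition maps are continuous.\<close>

lemma openin_mtop_chart:
  assumes M: "smooth_atlas M" and c: "(U, \<kappa>) \<in> M" and W: "open W"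
  shows "openin (mtop M) (U \<inter> \<kappa> -` W)"
proof (rule openin_mtopI)
  show "U \<inter> \<kappa> -` W \<subseteq> points M" using chart_subset_points[OF c] by blast
  fix U' \<kappa>' assume c': "(U', \<kappa>') \<in> M"
  obtain W1 where W1: "open W1" "\<And>x. x \<in> U' \<Longrightarrow> x \<in> U \<longleftrightarrow> \<kappa>' x \<in> W1"
    using openin_mtop_chartE[OF smooth_atlasD(2)[OF M c] c'] by metis
  obtain g where g: "smooth_on (\<kappa>' ` (U' \<inter> U)) g" "\<And>x. x \<in> U' \<Longrightarrow> x \<in> U \<Longrightarrow> g (\<kappa>' x) = \<kappa> x"
    using smooth_atlas_transition[OF M c' c] by metis
  obtain W2 where "open W2" "\<And>e. e \<in> \<kappa>' ` (U' \<inter> U) \<Longrightarrow> g e \<in> W \<longleftrightarrow> e \<in> W2"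
    using continuous_on_preimageE[OF smooth_on_continuous[OF g(1)] W] by metis
  moreover from this have "\<kappa> x \<in> W \<longleftrightarrow> \<kappa>' x \<in> W2" if "x \<in> U'" "x \<in> U" for x
    using g(2)[OF that] that by (metis IntI imageI)
  ultimately show "\<exists>W'. open W' \<and> (\<forall>x\<in>U'. x \<in> U \<inter> \<kappa> -` W \<longleftrightarrow> \<kappa>' x \<in> W')"
    using W1 by (intro exI[of _ "W1 \<inter> W2"]) auto
qed

lemma openin_mtop_basis:
  assumes "smooth_atlas M"
  shows "openin (mtop M) S \<longleftrightarrow>
    (\<forall>x\<in>S. \<exists>U \<kappa> W. (U, \<kappa>) \<in> M \<and> open W \<and> x \<in> U \<and> \<kappa> x \<in> W \<and> U \<inter> \<kappa> -` W \<subseteq> S)" (is "_ = ?R")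
proof
  assume S: "openin (mtop M) S"
  show ?R
  proof
    fix x assume x: "x \<in> S"
    then have "x \<in> points M" using openin_subset[OF S] by (auto simp: topspace_mtop)
    then obtain U \<kappa> where U: "(U, \<kappa>) \<in> M" "x \<in> U" by (rule pointsE)
    obtain W where "open W" "\<And>x. x \<in> U \<Longrightarrow> x \<in> S \<longleftrightarrow> \<kappa> x \<in> W" by (rule openin_mtop_chartE[OF S U(1)]) (rule that)
    then show "\<exists>U \<kappa> W. (U, \<kappa>) \<in> M \<and> open W \<and> x \<in> U \<and> \<kappa> x \<in> W \<and> U \<inter> \<kappa> -` W \<subseteq> S"
      using U x by (intro exI[of _ U] exI[of _ \<kappa>] exI[of _ W]) auto
  qed
next
  assume R: ?R
  show "openin (mtop M) S"
  proof (subst openin_subopen, intro ballI)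
    fix x assume "x \<in> S"
    then obtain U \<kappa> W where "(U, \<kappa>) \<in> M" "open W" "x \<in> U" "\<kappa> x \<in> W" "U \<inter> \<kappa> -` W \<subseteq> S" using R by metis
    then show "\<exists>T. openin (mtop M) T \<and> x \<in> T \<and> T \<subseteq> S"
      by (intro exI[of _ "U \<inter> \<kappa> -` W"]) (auto intro: openin_mtop_chart[OF assms])
  qed
qed

text \<open>Injectivity of a chart turns the relative openness of the image of an overlap into a
  description of the overlap as the preimage of an open set.\<close>

lemma smooth_manifold_imp_smooth_atlas:
  assumes "smooth_manifold M" shows "smooth_atlas M"
proof (rule smooth_atlasI)
  have 1: "\<forall>(U, \<kappa>)\<in>M. inj_on \<kappa> U \<and> (\<exists>b c. openin (top_of_set {y. c \<le> b \<bullet> y}) (\<kappa> ` U))"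
    and 2: "\<forall>(U, \<kappa>)\<in>M. \<forall>(U', \<kappa>')\<in>M. openin (top_of_set (\<kappa> ` U)) (\<kappa> ` (U \<inter> U')) \<and>
       smooth_on (\<kappa> ` (U \<inter> U')) (\<kappa>' \<circ> inv_into U \<kappa>)"
    using assms unfolding smooth_manifold_def by blast+
  show inj: "inj_on \<kappa> U" if "(U, \<kappa>) \<in> M" for U \<kappa> using 1 that by fast
  fix U \<kappa> U' \<kappa>' assume c: "(U, \<kappa>) \<in> M" "(U', \<kappa>') \<in> M"
  have 3: "openin (top_of_set (\<kappa> ` U)) (\<kappa> ` (U \<inter> U'))" "smooth_on (\<kappa> ` (U \<inter> U')) (\<kappa>' \<circ> inv_into U \<kappa>)"
    using 2 c by fast+
  then obtain W where W: "open W" "\<kappa> ` (U \<inter> U') = \<kappa> ` U \<inter> W" by (auto simp: openin_open)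
  have "x \<in> U' \<longleftrightarrow> \<kappa> x \<in> W" if "x \<in> U" for x
  proof
    assume "\<kappa> x \<in> W"
    then have "\<kappa> x \<in> \<kappa> ` (U \<inter> U')" using W(2) that by blast
    then show "x \<in> U'" using inj[OF c(1)] that by (auto simp: inj_on_def)
  qed (use W(2) that in blast)
  then show "\<exists>W. open W \<and> (\<forall>x\<in>U. x \<in> U' \<longleftrightarrow> \<kappa> x \<in> W)" using W(1) by blast
  show "\<exists>g. smooth_on (\<kappa> ` (U \<inter> U')) g \<and> (\<forall>x\<in>U \<inter> U'. g (\<kappa> x) = \<kappa>' x)"
    using 3(2) inj[OF c(1)] by (intro exI conjI) auto
qed

section \<open>Products, restrictions and subsets of Euclidean spaces as atlases\<close>

lemma mem_prod_atlas:
  "(D, \<xi>) \<in> M \<times>\<^sub>A N \<longleftrightarrow> (\<exists>U \<kappa> U' \<kappa>'. (U, \<kappa>) \<in> M \<and> (U', \<kappa>') \<in> N \<and> D = U \<times> U' \<and> \<xi> = map_prod \<kappa> \<kappa>')"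
  by (force simp: prod_atlas_def image_iff)

lemma prod_atlasI: "(U, \<kappa>) \<in> M \<Longrightarrow> (U', \<kappa>') \<in> N \<Longrightarrow> (U \<times> U', map_prod \<kappa> \<kappa>') \<in> M \<times>\<^sub>A N"
  unfolding mem_prod_atlas by blast

lemma points_prod: "points (M \<times>\<^sub>A N) = points M \<times> points N"
  by (force simp: prod_atlas_def points_def)

lemma mem_sub_atlas: "(D, \<xi>) \<in> sub_atlas S M \<longleftrightarrow> (\<exists>U. (U, \<xi>) \<in> M \<and> D = U \<inter> S)"
  by (force simp: sub_atlas_def image_iff)

lemma points_sub: "points (sub_atlas S M) = points M \<inter> S"
  by (force simp: sub_atlas_def points_def)

lemma smooth_atlas_prod:
  assumes M: "smooth_atlas M" and N: "smooth_atlas N"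
  shows "smooth_atlas (M \<times>\<^sub>A N)"
proof (rule smooth_atlasI)
  show "inj_on \<xi> D" if "(D, \<xi>) \<in> M \<times>\<^sub>A N" for D \<xi>
    using that smooth_atlasD(1)[OF M] smooth_atlasD(1)[OF N] by (auto simp: mem_prod_atlas inj_on_def)
  fix D \<xi> D' \<xi>' assume "(D, \<xi>) \<in> M \<times>\<^sub>A N" "(D', \<xi>') \<in> M \<times>\<^sub>A N"
  then obtain U \<kappa> V \<mu> U' \<kappa>' V' \<mu>' where c: "(U, \<kappa>) \<in> M" "(U', \<kappa>') \<in> M" "(V, \<mu>) \<in> N" "(V', \<mu>') \<in> N"
    and [simp]: "D = U \<times> V" "\<xi> = map_prod \<kappa> \<mu>" "D' = U' \<times> V'" "\<xi>' = map_prod \<kappa>' \<mu>'"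
    unfolding mem_prod_atlas by metis
  obtain W where W: "open W" "\<And>x. x \<in> U \<Longrightarrow> x \<in> U' \<longleftrightarrow> \<kappa> x \<in> W"
    using openin_mtop_chartE[OF smooth_atlasD(2)[OF M c(2)] c(1)] by metis
  obtain X where X: "open X" "\<And>x. x \<in> V \<Longrightarrow> x \<in> V' \<longleftrightarrow> \<mu> x \<in> X"
    using openin_mtop_chartE[OF smooth_atlasD(2)[OF N c(4)] c(3)] by metis
  show "\<exists>W. open W \<and> (\<forall>x\<in>D. x \<in> D' \<longleftrightarrow> \<xi> x \<in> W)"
    by (rule exI[of _ "W \<times> X"]) (use W X in \<open>auto intro: open_Times\<close>)
  obtain g where g: "smooth_on (\<kappa> ` (U \<inter> U')) g" "\<And>x. x \<in> U \<Longrightarrow> x \<in> U' \<Longrightarrow> g (\<kappa> x) = \<kappa>' x"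
    using smooth_atlas_transition[OF M c(1,2)] by metis
  obtain h where h: "smooth_on (\<mu> ` (V \<inter> V')) h" "\<And>x. x \<in> V \<Longrightarrow> x \<in> V' \<Longrightarrow> h (\<mu> x) = \<mu>' x"
    using smooth_atlas_transition[OF N c(3,4)] by metis
  have "smooth_on (\<xi> ` (D \<inter> D')) (\<lambda>e. (g (fst e), h (snd e)))"
    by (intro smooth_on_Pair smooth_on_compose[OF smooth_on_linear[OF bounded_linear_fst] g(1)]
        smooth_on_compose[OF smooth_on_linear[OF bounded_linear_snd] h(1)]) auto
  then show "\<exists>g. smooth_on (\<xi> ` (D \<inter> D')) g \<and> (\<forall>x\<in>D \<inter> D'. g (\<xi> x) = \<xi>' x)"
    by (intro exI conjI) (use g(2) h(2) in auto)
qed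

text \<open>Both topologies have the products of chart preimages of open sets as a basis.\<close>

lemma mtop_prod:
  assumes M: "smooth_atlas M" and N: "smooth_atlas N"
  shows "mtop (M \<times>\<^sub>A N) = prod_topology (mtop M) (mtop N)"
  unfolding topology_eq
proof (intro allI iffI)
  fix S assume "openin (mtop (M \<times>\<^sub>A N)) S"
  then have S: "\<forall>x\<in>S. \<exists>U \<kappa> W. (U, \<kappa>) \<in> M \<times>\<^sub>A N \<and> open W \<and> x \<in> U \<and> \<kappa> x \<in> W \<and> U \<inter> \<kappa> -` W \<subseteq> S"
    using openin_mtop_basis[OF smooth_atlas_prod[OF M N]] by blast
  show "openin (prod_topology (mtop M) (mtop N)) S"
    unfolding openin_prod_topology_alt
  proof (intro allI impI)
    fix x y assume "(x, y) \<in> S"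
    then obtain D \<xi> W where c: "(D, \<xi>) \<in> M \<times>\<^sub>A N" and D: "open W" "(x, y) \<in> D" "\<xi> (x, y) \<in> W" "D \<inter> \<xi> -` W \<subseteq> S"
      using S by metis
    obtain U \<kappa> U' \<kappa>' where c: "(U, \<kappa>) \<in> M" "(U', \<kappa>') \<in> N" "D = U \<times> U'" "\<xi> = map_prod \<kappa> \<kappa>'"
      using c unfolding mem_prod_atlas by metis
    have "(\<kappa> x, \<kappa>' y) \<in> W" using D(3) c(4) by simp
    with D(1) obtain A B where AB: "open A" "open B" "\<kappa> x \<in> A" "\<kappa>' y \<in> B" "A \<times> B \<subseteq> W"
      by (rule open_prod_elim) auto
    show "\<exists>P Q. openin (mtop M) P \<and> openin (mtop N) Q \<and> x \<in> P \<and> y \<in> Q \<and> P \<times> Q \<subseteq> S"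
      by (intro exI[of _ "U \<inter> \<kappa> -` A"] exI[of _ "U' \<inter> \<kappa>' -` B"] conjI openin_mtop_chart[OF M c(1) AB(1)]
          openin_mtop_chart[OF N c(2) AB(2)]) (use c AB D in \<open>auto intro!: subsetD[OF D(4)] subsetD[OF AB(5)]\<close>)
  qed
next
  fix S assume S: "openin (prod_topology (mtop M) (mtop N)) S"
  show "openin (mtop (M \<times>\<^sub>A N)) S"
    unfolding openin_mtop_basis[OF smooth_atlas_prod[OF M N]]
  proof
    fix p assume p: "p \<in> S"
    obtain x y where [simp]: "p = (x, y)" by fastforce
    have "\<exists>P Q. openin (mtop M) P \<and> openin (mtop N) Q \<and> x \<in> P \<and> y \<in> Q \<and> P \<times> Q \<subseteq> S"
      using S p unfolding openin_prod_topology_alt by simp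
    then obtain P Q where P: "openin (mtop M) P" "x \<in> P" and Q: "openin (mtop N) Q" "y \<in> Q" and PQ: "P \<times> Q \<subseteq> S"
      by blast
    obtain U \<kappa> W where U: "(U, \<kappa>) \<in> M" "open W" "x \<in> U" "\<kappa> x \<in> W" "U \<inter> \<kappa> -` W \<subseteq> P"
      using P openin_mtop_basis[OF M] by metis
    obtain U' \<kappa>' W' where U': "(U', \<kappa>') \<in> N" "open W'" "y \<in> U'" "\<kappa>' y \<in> W'" "U' \<inter> \<kappa>' -` W' \<subseteq> Q"
      using Q openin_mtop_basis[OF N] by metis
    have "(U \<times> U', map_prod \<kappa> \<kappa>') \<in> M \<times>\<^sub>A N" using U U' unfolding mem_prod_atlas by metis
    moreover have "(U \<times> U') \<inter> map_prod \<kappa> \<kappa>' -` (W \<times> W') \<subseteq> S" 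
      by (clarsimp, rule subsetD[OF PQ], rule SigmaI) (use U(5) U'(5) in auto)
    ultimately show "\<exists>U \<kappa> W. (U, \<kappa>) \<in> M \<times>\<^sub>A N \<and> open W \<and> p \<in> U \<and> \<kappa> p \<in> W \<and> U \<inter> \<kappa> -` W \<subseteq> S"
      using U U' open_Times[OF U(2) U'(2)]
      by (intro exI[of _ "U \<times> U'"] exI[of _ "map_prod \<kappa> \<kappa>'"] exI[of _ "W \<times> W'"]) auto
  qed
qed

lemma smooth_atlas_sub:
  assumes M: "smooth_atlas M"
  shows "smooth_atlas (sub_atlas S M)"
proof (rule smooth_atlasI)
  show "inj_on \<xi> D" if "(D, \<xi>) \<in> sub_atlas S M" for D \<xi>
    using that smooth_atlasD(1)[OF M] by (auto simp: mem_sub_atlas inj_on_def)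
  fix D \<kappa> D' \<kappa>' assume "(D, \<kappa>) \<in> sub_atlas S M" "(D', \<kappa>') \<in> sub_atlas S M"
  then obtain U U' where c: "(U, \<kappa>) \<in> M" "(U', \<kappa>') \<in> M" and [simp]: "D = U \<inter> S" "D' = U' \<inter> S"
    unfolding mem_sub_atlas by metis
  obtain W where W: "open W" "\<And>x. x \<in> U \<Longrightarrow> x \<in> U' \<longleftrightarrow> \<kappa> x \<in> W"
    using openin_mtop_chartE[OF smooth_atlasD(2)[OF M c(2)] c(1)] by metis
  show "\<exists>W. open W \<and> (\<forall>x\<in>D. x \<in> D' \<longleftrightarrow> \<kappa> x \<in> W)"
    by (rule exI[of _ W]) (use W in auto)
  obtain g where g: "smooth_on (\<kappa> ` (U \<inter> U')) g" "\<And>x. x \<in> U \<Longrightarrow> x \<in> U' \<Longrightarrow> g (\<kappa> x) = \<kappa>' x"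
    using smooth_atlas_transition[OF M c(1,2)] by metis
  then show "\<exists>g. smooth_on (\<kappa> ` (D \<inter> D')) g \<and> (\<forall>x\<in>D \<inter> D'. g (\<kappa> x) = \<kappa>' x)"
    by (intro exI[of _ g]) (auto intro: smooth_on_subset)
qed

lemma mtop_sub:
  assumes M: "smooth_atlas M"
  shows "mtop (sub_atlas S M) = subtopology (mtop M) S"
  unfolding topology_eq
proof (intro allI iffI)
  fix T assume T: "openin (mtop (sub_atlas S M)) T"
  have sub: "T \<subseteq> S" using openin_subset[OF T] by (simp add: topspace_mtop points_sub)
  show "openin (subtopology (mtop M) S) T"
  proof (subst openin_subopen, intro ballI)
    fix x assume "x \<in> T"
    then obtain D \<kappa> W where c: "(D, \<kappa>) \<in> sub_atlas S M" "open W" "x \<in> D" "\<kappa> x \<in> W" "D \<inter> \<kappa> -` W \<subseteq> T"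
      using T unfolding openin_mtop_basis[OF smooth_atlas_sub[OF M]] by metis
    then obtain U where U: "(U, \<kappa>) \<in> M" "D = U \<inter> S" unfolding mem_sub_atlas by metis
    show "\<exists>P. openin (subtopology (mtop M) S) P \<and> x \<in> P \<and> P \<subseteq> T"
      unfolding openin_subtopology
      by (rule exI[of _ "(U \<inter> \<kappa> -` W) \<inter> S"], rule conjI, rule exI[of _ "U \<inter> \<kappa> -` W"])
        (use openin_mtop_chart[OF M U(1) c(2)] c U sub in auto)
  qed
next
  fix T assume "openin (subtopology (mtop M) S) T"
  then obtain P where P: "openin (mtop M) P" "T = P \<inter> S" by (auto simp: openin_subtopology)
  show "openin (mtop (sub_atlas S M)) T"
  proof (rule openin_mtopI)
    show "T \<subseteq> points (sub_atlas S M)"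
      using openin_subset[OF P(1)] P(2) by (auto simp: topspace_mtop points_sub)
    fix D \<kappa> assume "(D, \<kappa>) \<in> sub_atlas S M"
    then obtain U where U: "(U, \<kappa>) \<in> M" "D = U \<inter> S" unfolding mem_sub_atlas by metis
    then show "\<exists>W. open W \<and> (\<forall>x\<in>D. x \<in> T \<longleftrightarrow> \<kappa> x \<in> W)"
      using openin_mtop_chartE[OF P(1) U(1)] P(2) by (metis IntE IntI)
  qed
qed

text \<open>A subset of a Euclidean space with the identity as its single chart. It serves as a
  parameter space, for instance for time, between which smooth maps come from functions that are
  \<open>smooth_on\<close> the set.\<close>

abbreviation euclid :: "'e::euclidean_space set \<Rightarrow> ('e, 'e) atlas"
  where "euclid S \<equiv> {(S, id)}"

lemma points_euclid: "points (euclid S) = S"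
  by (auto simp: points_def)

lemma smooth_atlas_euclid: "smooth_atlas (euclid S)"
  by (rule smooth_atlasI) (auto intro: exI[of _ UNIV] exI[of _ "\<lambda>x. x"] smooth_on_id)

lemma mtop_euclid: "mtop (euclid S) = top_of_set S"
  unfolding topology_eq openin_mtop_iff openin_open points_euclid by auto

lemma prod_euclid: "euclid S \<times>\<^sub>A euclid T = euclid (S \<times> T)"
  by (simp add: prod_atlas_def map_prod.id)

lemma points_interval: "a < b \<Longrightarrow> points (interval a b) = {a..b}"
  by (auto simp: points_def interval_def)

lemma smooth_atlas_interval: "smooth_atlas (interval a b)"
proof (rule smooth_atlasI)
  fix U \<kappa> U' \<kappa>' assume c: "(U, \<kappa>) \<in> interval a b" "(U', \<kappa>') \<in> interval a b"
  then have k: "\<kappa> = id" "\<kappa>' = id" by (auto simp: interval_def)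
  then show "\<exists>g. smooth_on (\<kappa> ` (U \<inter> U')) g \<and> (\<forall>x\<in>U \<inter> U'. g (\<kappa> x) = \<kappa>' x)"
    by (intro exI[of _ "\<lambda>x. x"]) (auto intro: smooth_on_id)
  have "\<exists>W. open W \<and> (\<forall>x\<in>U. x \<in> U' \<longleftrightarrow> x \<in> W)"
  proof (cases "U' = U")
    case True then show ?thesis by (intro exI[of _ UNIV]) auto
  next
    case False
    then show ?thesis using c by (intro exI[of _ "{a<..<b}"]) (auto simp: interval_def)
  qed
  then show "\<exists>W. open W \<and> (\<forall>x\<in>U. x \<in> U' \<longleftrightarrow> \<kappa> x \<in> W)" by (simp add: k)
qed (auto simp: interval_def)

subsection \<open>Smooth maps in charts\<close>

lemma smooth_map_funcset: "smooth_map M N f \<Longrightarrow> x \<in> points M \<Longrightarrow> f x \<in> points N"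
  by (auto simp: smooth_map_def continuous_map_def topspace_mtop)

lemma smooth_map_continuous: "smooth_map M N f \<Longrightarrow> continuous_map (mtop M) (mtop N) f"
  by (simp add: smooth_map_def)

lemma smooth_map_charts:
  assumes "smooth_map M N f" "(U, \<kappa>) \<in> M" "(U', \<kappa>') \<in> N"
  shows "smooth_on (\<kappa> ` (U \<inter> f -` U')) (\<kappa>' \<circ> f \<circ> inv_into U \<kappa>)"
  using assms unfolding smooth_map_def by fast

text \<open>Here \<open>g\<close> represents \<open>f\<close> in one pair of charts. The relation g
  (\<kappa> y) = \<kappa>' (f y), on an explicit open \<open>W\<close> where \<open>f\<close> stays
  in the target chart, makes local representatives easy to compose.\<close>

definition chart_rep where
  "chart_rep U \<kappa> U' \<kappa>' f W g \<longleftrightarrow> open W \<and> smooth_on (\<kappa> ` U \<inter> W) g \<and>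
    (\<forall>y\<in>U. \<kappa> y \<in> W \<longrightarrow> f y \<in> U' \<and> g (\<kappa> y) = \<kappa>' (f y))"

lemma chart_repD:
  assumes "chart_rep U \<kappa> U' \<kappa>' f W g"
  shows "open W" "smooth_on (\<kappa> ` U \<inter> W) g"
    "y \<in> U \<Longrightarrow> \<kappa> y \<in> W \<Longrightarrow> f y \<in> U'" "y \<in> U \<Longrightarrow> \<kappa> y \<in> W \<Longrightarrow> g (\<kappa> y) = \<kappa>' (f y)"
  using assms by (auto simp: chart_rep_def)

definition smooth_at where
  "smooth_at M N f x \<longleftrightarrow> (\<exists>U \<kappa> U' \<kappa>' W g. (U, \<kappa>) \<in> M \<and> (U', \<kappa>') \<in> N \<and> x \<in> U \<and> \<kappa> x \<in> W \<and>
    chart_rep U \<kappa> U' \<kappa>' f W g)"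

lemma smooth_atI:
  assumes "(U, \<kappa>) \<in> M" "(U', \<kappa>') \<in> N" "x \<in> U" "\<kappa> x \<in> W" "open W" "smooth_on (\<kappa> ` U \<inter> W) g"
    and "\<And>y. y \<in> U \<Longrightarrow> \<kappa> y \<in> W \<Longrightarrow> f y \<in> U' \<and> g (\<kappa> y) = \<kappa>' (f y)"
  shows "smooth_at M N f x"
  unfolding smooth_at_def chart_rep_def using assms
  by (intro exI[of _ U] exI[of _ \<kappa>] exI[of _ U'] exI[of _ \<kappa>'] exI[of _ W] exI[of _ g]) auto

text \<open>One local representative per point is enough: it gives continuity, and in any other pair
  of charts \<open>f\<close> is that representative framed by two transition maps.\<close>

lemma smooth_mapI:
  assumes M: "smooth_atlas M" and N: "smooth_atlas N" and loc: "\<And>x. x \<in> points M \<Longrightarrow> smooth_at M N f x"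
  shows "smooth_map M N f"
  unfolding smooth_map_def
proof (intro conjI ballI)
  show "continuous_map (mtop M) (mtop N) f"
    unfolding continuous_map_eq_topcontinuous_at topcontinuous_at_def topspace_mtop
  proof (intro ballI conjI allI impI)
    show "f \<in> points M \<rightarrow> points N"
    proof
      fix x assume "x \<in> points M"
      from loc[OF this] show "f x \<in> points N"
        using chart_subset_points[of _ _ N] unfolding smooth_at_def chart_rep_def by blast
    qed
    fix x V assume x: "x \<in> points M" and V: "openin (mtop N) V \<and> f x \<in> V"
    obtain U \<kappa> U' \<kappa>' W g where c: "(U, \<kappa>) \<in> M" "(U', \<kappa>') \<in> N" and W: "x \<in> U" "\<kappa> x \<in> W"
      and r: "chart_rep U \<kappa> U' \<kappa>' f W g"
      using loc[OF x] unfolding smooth_at_def by metis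
    note r = chart_repD[OF r]
    obtain P where P: "open P" "\<And>x. x \<in> U' \<Longrightarrow> x \<in> V \<longleftrightarrow> \<kappa>' x \<in> P"
      using openin_mtop_chartE[OF conjunct1[OF V] c(2)] by metis
    obtain Q where Q: "open Q" "\<And>e. e \<in> \<kappa> ` U \<inter> W \<Longrightarrow> g e \<in> P \<longleftrightarrow> e \<in> Q"
      using continuous_on_preimageE[OF smooth_on_continuous[OF r(2)] P(1)] by metis
    show "\<exists>T. openin (mtop M) T \<and> x \<in> T \<and> (\<forall>y\<in>T. f y \<in> V)"
    proof (intro exI[of _ "U \<inter> \<kappa> -` (W \<inter> Q)"] conjI)
      show "openin (mtop M) (U \<inter> \<kappa> -` (W \<inter> Q))"
        by (intro openin_mtop_chart[OF M c(1)] open_Int r(1) Q)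
      have "f y \<in> V \<longleftrightarrow> \<kappa> y \<in> Q" if "y \<in> U" "\<kappa> y \<in> W" for y
        using P(2)[of "f y"] Q(2)[of "\<kappa> y"] r(3,4)[OF that] that by auto
      then show "x \<in> U \<inter> \<kappa> -` (W \<inter> Q)" "\<forall>y\<in>U \<inter> \<kappa> -` (W \<inter> Q). f y \<in> V" using V W by auto
    qed
  qed
  have *: "smooth_on (\<alpha> ` (A \<inter> f -` B)) (\<beta> \<circ> f \<circ> inv_into A \<alpha>)" if AB: "(A, \<alpha>) \<in> M" "(B, \<beta>) \<in> N" for A \<alpha> B \<beta>
  proof (rule smooth_on_local)
    fix e assume "e \<in> \<alpha> ` (A \<inter> f -` B)"
    then obtain x where x: "x \<in> A" "f x \<in> B" "e = \<alpha> x" by auto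
    note inj = smooth_atlasD(1)[OF M AB(1)]
    have "x \<in> points M" using chart_subset_points[OF AB(1)] x by blast
    then obtain U \<kappa> U' \<kappa>' W g where c: "(U, \<kappa>) \<in> M" "(U', \<kappa>') \<in> N" and W: "x \<in> U" "\<kappa> x \<in> W"
      and r: "chart_rep U \<kappa> U' \<kappa>' f W g"
      using loc unfolding smooth_at_def by metis
    note r = chart_repD[OF r]
    obtain X where X: "open X" "\<And>y. y \<in> A \<Longrightarrow> y \<in> U \<inter> \<kappa> -` W \<longleftrightarrow> \<alpha> y \<in> X"
      using openin_mtop_chartE[OF openin_mtop_chart[OF M c(1) r(1)] AB(1)] by metis
    \<comment> \<open>In the charts \<alpha> and \<beta> the map is read as \<open>k\<close> after
      \<open>g\<close> after \<open>h\<close>, with \<open>h\<close> and \<open>k\<close> transition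
      maps of the source and of the target.\<close>
    obtain h where h: "smooth_on (\<alpha> ` (A \<inter> U)) h" "\<And>y. y \<in> A \<Longrightarrow> y \<in> U \<Longrightarrow> h (\<alpha> y) = \<kappa> y"
      using smooth_atlas_transition[OF M AB(1) c(1)] by metis
    obtain k where k: "smooth_on (\<kappa>' ` (U' \<inter> B)) k" "\<And>y. y \<in> U' \<Longrightarrow> y \<in> B \<Longrightarrow> k (\<kappa>' y) = \<beta> y"
      using smooth_atlas_transition[OF N c(2) AB(2)] by metis
    let ?S = "\<alpha> ` (A \<inter> f -` B) \<inter> X"
    have S: "\<exists>y. y \<in> A \<and> y \<in> U \<and> \<alpha> y = e \<and> h e = \<kappa> y \<and> \<kappa> y \<in> W \<and> g (h e) = \<kappa>' (f y) \<and> f y \<in> U' \<inter> B"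
      if "e \<in> ?S" for e
    proof -
      obtain y where y: "y \<in> A" "f y \<in> B" "y \<in> U" "\<kappa> y \<in> W" "\<alpha> y = e" using \<open>e \<in> ?S\<close> X(2) by blast
      then have "h e = \<kappa> y" "f y \<in> U'" "g (\<kappa> y) = \<kappa>' (f y)" using h(2) r(3,4) by auto
      then show ?thesis using y by auto
    qed
    have "smooth_on ?S h" by (rule smooth_on_subset[OF h(1)], rule subsetI, drule S) auto
    then have "smooth_on ?S (\<lambda>e. g (h e))"
      by (rule smooth_on_compose[OF _ r(2)]) (intro image_subsetI, drule S, auto)
    then have "smooth_on ?S (\<lambda>e. k (g (h e)))"
      by (rule smooth_on_compose[OF _ k(1)]) (intro image_subsetI, drule S, auto)
    then have "smooth_on ?S (\<beta> \<circ> f \<circ> inv_into A \<alpha>)"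
      by (rule smooth_on_cong) (drule S, use k(2) inj in auto)
    moreover have "e \<in> X" using X(2)[OF x(1)] W x by auto
    ultimately show "\<exists>W. open W \<and> e \<in> W \<and> smooth_on (\<alpha> ` (A \<inter> f -` B) \<inter> W) (\<beta> \<circ> f \<circ> inv_into A \<alpha>)"
      using X(1) by blast
  qed
  then show "case p of (U, \<kappa>) \<Rightarrow> \<forall>(U', \<kappa>')\<in>N. smooth_on (\<kappa> ` (U \<inter> f -` U')) (\<kappa>' \<circ> f \<circ> inv_into U \<kappa>)" if "p \<in> M" for p
    using that by auto
qed

text \<open>Converse to \<open>smooth_mapI\<close>: continuity makes the preimage of the target
  chart open, which provides \<open>W\<close>.\<close>

lemma smooth_map_chart_rep:
  assumes M: "smooth_atlas M" and N: "smooth_atlas N" and f: "smooth_map M N f"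
    and c: "(U, \<kappa>) \<in> M" "x \<in> U" "(U', \<kappa>') \<in> N" "f x \<in> U'"
  obtains W g where "\<kappa> x \<in> W" "chart_rep U \<kappa> U' \<kappa>' f W g"
proof -
  have o: "openin (mtop M) {y \<in> topspace (mtop M). f y \<in> U'}"
    by (rule openin_continuous_map_preimage[OF smooth_map_continuous[OF f] smooth_atlasD(2)[OF N c(3)]])
  obtain W where W: "open W" "\<And>y. y \<in> U \<Longrightarrow> y \<in> {y \<in> topspace (mtop M). f y \<in> U'} \<longleftrightarrow> \<kappa> y \<in> W"
    by (rule openin_mtop_chartE[OF o c(1)]) (rule that)
  have U: "y \<in> topspace (mtop M)" if "y \<in> U" for y
    using chart_subset_points[OF c(1)] that by (auto simp: topspace_mtop)
  have "\<kappa> ` U \<inter> W \<subseteq> \<kappa> ` (U \<inter> f -` U')" using W(2) by blast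
  then have "smooth_on (\<kappa> ` U \<inter> W) (\<kappa>' \<circ> f \<circ> inv_into U \<kappa>)"
    by (rule smooth_on_subset[OF smooth_map_charts[OF f c(1,3)]])
  then show ?thesis
    by (intro that[of W "\<kappa>' \<circ> f \<circ> inv_into U \<kappa>"])
      (use W U c smooth_atlasD(1)[OF M c(1)] in \<open>auto simp: chart_rep_def\<close>)
qed

lemma smooth_map_compose:
  assumes M: "smooth_atlas M" and N: "smooth_atlas N" and P: "smooth_atlas P"
    and f: "smooth_map M N f" and g: "smooth_map N P g"
  shows "smooth_map M P (\<lambda>x. g (f x))"
proof (rule smooth_mapI[OF M P])
  fix x assume x: "x \<in> points M"
  obtain A \<alpha> where A: "(A, \<alpha>) \<in> M" "x \<in> A" using x by (rule pointsE)
  obtain B \<beta> where B: "(B, \<beta>) \<in> N" "f x \<in> B" using smooth_map_funcset[OF f x] by (rule pointsE)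
  obtain C \<gamma> where C: "(C, \<gamma>) \<in> P" "g (f x) \<in> C"
    using smooth_map_funcset[OF g smooth_map_funcset[OF f x]] by (rule pointsE)
  obtain W f' where W: "\<alpha> x \<in> W" "chart_rep A \<alpha> B \<beta> f W f'"
    by (rule smooth_map_chart_rep[OF M N f A B]) (rule that)
  note f' = chart_repD[OF W(2)]
  obtain X g' where X: "\<beta> (f x) \<in> X" "chart_rep B \<beta> C \<gamma> g X g'"
    by (rule smooth_map_chart_rep[OF N P g B C]) (rule that)
  note g' = chart_repD[OF X(2)]
  obtain Q where Q: "open Q" "\<And>e. e \<in> \<alpha> ` A \<inter> W \<Longrightarrow> f' e \<in> X \<longleftrightarrow> e \<in> Q"
    by (rule continuous_on_preimageE[OF smooth_on_continuous[OF f'(2)] g'(1)]) (rule that)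
  have "f' e \<in> \<beta> ` B \<inter> X" if "e \<in> \<alpha> ` A \<inter> (W \<inter> Q)" for e
    using that f'(3,4) Q(2) by force
  then have sm: "smooth_on (\<alpha> ` A \<inter> (W \<inter> Q)) (\<lambda>e. g' (f' e))"
    by (intro smooth_on_compose[OF smooth_on_subset[OF f'(2)] g'(2)]) auto
  have Qi: "\<alpha> y \<in> Q \<longleftrightarrow> \<beta> (f y) \<in> X" if "y \<in> A" "\<alpha> y \<in> W" for y
    using Q(2)[of "\<alpha> y"] f'(4)[OF that] that by auto
  show "smooth_at M P (\<lambda>x. g (f x)) x"
    by (rule smooth_atI[OF A(1) C(1) A(2) _ _ sm]) (use A W X Q Qi f' g' in auto)
qed

lemma smooth_map_fst: "smooth_atlas M \<Longrightarrow> smooth_atlas N \<Longrightarrow> smooth_map (M \<times>\<^sub>A N) M fst"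
proof (rule smooth_mapI)
  fix p assume "p \<in> points (M \<times>\<^sub>A N)"
  then obtain U \<kappa> U' \<kappa>' where c: "(U, \<kappa>) \<in> M" "(U', \<kappa>') \<in> N" "p \<in> U \<times> U'"
    by (auto simp: points_prod elim!: pointsE)
  show "smooth_at (M \<times>\<^sub>A N) M fst p"
    by (rule smooth_atI[OF prod_atlasI[OF c(1,2)] c(1,3) _ open_UNIV smooth_on_linear[OF bounded_linear_fst]]) auto
qed (auto intro: smooth_atlas_prod)

lemma smooth_map_snd: "smooth_atlas M \<Longrightarrow> smooth_atlas N \<Longrightarrow> smooth_map (M \<times>\<^sub>A N) N snd"
proof (rule smooth_mapI)
  fix p assume "p \<in> points (M \<times>\<^sub>A N)"
  then obtain U \<kappa> U' \<kappa>' where c: "(U, \<kappa>) \<in> M" "(U', \<kappa>') \<in> N" "p \<in> U \<times> U'"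
    by (auto simp: points_prod elim!: pointsE)
  show "smooth_at (M \<times>\<^sub>A N) N snd p"
    by (rule smooth_atI[OF prod_atlasI[OF c(1,2)] c(2,3) _ open_UNIV smooth_on_linear[OF bounded_linear_snd]]) auto
qed (auto intro: smooth_atlas_prod)

lemma smooth_map_Pair:
  assumes M: "smooth_atlas M" and N: "smooth_atlas N" and P: "smooth_atlas P"
    and f: "smooth_map M N f" and g: "smooth_map M P g"
  shows "smooth_map M (N \<times>\<^sub>A P) (\<lambda>x. (f x, g x))"
proof (rule smooth_mapI[OF M smooth_atlas_prod[OF N P]])
  fix x assume x: "x \<in> points M"
  obtain A \<alpha> where A: "(A, \<alpha>) \<in> M" "x \<in> A" using x by (rule pointsE)
  obtain B \<beta> where B: "(B, \<beta>) \<in> N" "f x \<in> B" using smooth_map_funcset[OF f x] by (rule pointsE)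
  obtain C \<gamma> where C: "(C, \<gamma>) \<in> P" "g x \<in> C" using smooth_map_funcset[OF g x] by (rule pointsE)
  obtain W f' where W: "\<alpha> x \<in> W" "chart_rep A \<alpha> B \<beta> f W f'"
    by (rule smooth_map_chart_rep[OF M N f A B]) (rule that)
  obtain X g' where X: "\<alpha> x \<in> X" "chart_rep A \<alpha> C \<gamma> g X g'"
    by (rule smooth_map_chart_rep[OF M P g A C]) (rule that)
  note f' = chart_repD[OF W(2)] and g' = chart_repD[OF X(2)]
  have sm: "smooth_on (\<alpha> ` A \<inter> (W \<inter> X)) (\<lambda>e. (f' e, g' e))"
    by (rule smooth_on_Pair[OF smooth_on_subset[OF f'(2)] smooth_on_subset[OF g'(2)]]) auto
  show "smooth_at M (N \<times>\<^sub>A P) (\<lambda>x. (f x, g x)) x"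
    by (rule smooth_atI[OF A(1) prod_atlasI[OF B(1) C(1)] A(2) _ _ sm]) (use W X f' g' in auto)
qed

lemma smooth_map_cong:
  assumes M: "smooth_atlas M" and N: "smooth_atlas N"
    and f: "smooth_map M N f" and eq: "\<And>x. x \<in> points M \<Longrightarrow> f x = g x"
  shows "smooth_map M N g"
proof (rule smooth_mapI[OF M N])
  fix x assume x: "x \<in> points M"
  obtain A \<alpha> where A: "(A, \<alpha>) \<in> M" "x \<in> A" using x by (rule pointsE)
  obtain B \<beta> where B: "(B, \<beta>) \<in> N" "f x \<in> B" using smooth_map_funcset[OF f x] by (rule pointsE)
  obtain W f' where W: "\<alpha> x \<in> W" "chart_rep A \<alpha> B \<beta> f W f'"
    by (rule smooth_map_chart_rep[OF M N f A B]) (rule that)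
  have "f y = g y" if "y \<in> A" for y using eq chart_subset_points[OF A(1)] that by blast
  then show "smooth_at M N g x"
    using chart_repD[OF W(2)] by (intro smooth_atI[OF A(1) B(1) A(2) W(1)]) auto
qed

lemma smooth_map_local:
  assumes M: "smooth_atlas M" and N: "smooth_atlas N"
    and loc: "\<And>x. x \<in> points M \<Longrightarrow> \<exists>S. openin (mtop M) S \<and> x \<in> S \<and> smooth_map (sub_atlas S M) N f"
  shows "smooth_map M N f"
proof (rule smooth_mapI[OF M N])
  fix x assume x: "x \<in> points M"
  then obtain S where S: "openin (mtop M) S" "x \<in> S" and f: "smooth_map (sub_atlas S M) N f"
    using loc by metis
  obtain A \<alpha> where A: "(A, \<alpha>) \<in> M" "x \<in> A" using x by (rule pointsE)
  then have A': "(A \<inter> S, \<alpha>) \<in> sub_atlas S M" "x \<in> A \<inter> S" using S unfolding mem_sub_atlas by auto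
  then have "x \<in> points (sub_atlas S M)" using chart_subset_points by blast
  then obtain B \<beta> where B: "(B, \<beta>) \<in> N" "f x \<in> B" using smooth_map_funcset[OF f] by (metis pointsE)
  obtain W f' where W: "\<alpha> x \<in> W" "chart_rep (A \<inter> S) \<alpha> B \<beta> f W f'"
    by (rule smooth_map_chart_rep[OF smooth_atlas_sub[OF M] N f A' B]) (rule that)
  note f' = chart_repD[OF W(2)]
  obtain X where X: "open X" "\<And>y. y \<in> A \<Longrightarrow> y \<in> S \<longleftrightarrow> \<alpha> y \<in> X"
    by (rule openin_mtop_chartE[OF S(1) A(1)]) (rule that)
  have sm: "smooth_on (\<alpha> ` A \<inter> (W \<inter> X)) f'"
    by (rule smooth_on_subset[OF f'(2)]) (use X(2) in blast)
  show "smooth_at M N f x"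
    by (rule smooth_atI[OF A(1) B(1) A(2) _ _ sm]) (use A W X S f' in auto)
qed

lemma smooth_map_into_sub:
  assumes M: "smooth_atlas M" and N: "smooth_atlas N"
    and f: "smooth_map M N f" and S: "\<And>x. x \<in> points M \<Longrightarrow> f x \<in> S"
  shows "smooth_map M (sub_atlas S N) f"
proof (rule smooth_mapI[OF M smooth_atlas_sub[OF N]])
  fix x assume x: "x \<in> points M"
  obtain A \<alpha> where A: "(A, \<alpha>) \<in> M" "x \<in> A" using x by (rule pointsE)
  obtain B \<beta> where B: "(B, \<beta>) \<in> N" "f x \<in> B" using smooth_map_funcset[OF f x] by (rule pointsE)
  obtain W f' where W: "\<alpha> x \<in> W" "chart_rep A \<alpha> B \<beta> f W f'"
    by (rule smooth_map_chart_rep[OF M N f A B]) (rule that)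
  have "(B \<inter> S, \<beta>) \<in> sub_atlas S N" using B(1) unfolding mem_sub_atlas by blast
  moreover have "f y \<in> S" if "y \<in> A" for y using S chart_subset_points[OF A(1)] that by blast
  ultimately show "smooth_at M (sub_atlas S N) f x"
    using chart_repD[OF W(2)] by (intro smooth_atI[OF A(1) _ A(2) W(1)]) auto
qed

lemma smooth_map_incl:
  assumes M: "smooth_atlas M"
  shows "smooth_map (sub_atlas S M) M (\<lambda>x. x)"
proof (rule smooth_mapI[OF smooth_atlas_sub[OF M] M])
  fix x assume "x \<in> points (sub_atlas S M)"
  then obtain A \<alpha> where A: "(A, \<alpha>) \<in> M" "x \<in> A" "x \<in> S" by (auto simp: points_sub elim!: pointsE)
  then have "(A \<inter> S, \<alpha>) \<in> sub_atlas S M" unfolding mem_sub_atlas by blast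
  then show "smooth_at (sub_atlas S M) M (\<lambda>x. x) x"
    by (rule smooth_atI[OF _ A(1) _ _ open_UNIV smooth_on_id]) (use A in auto)
qed

lemma smooth_map_ident: "smooth_atlas M \<Longrightarrow> smooth_map M M (\<lambda>x. x)"
  using smooth_map_incl[of M UNIV] by (simp add: sub_atlas_def)

lemma smooth_map_restrict:
  assumes "smooth_atlas M" "smooth_atlas N" "smooth_map M N f"
  shows "smooth_map (sub_atlas S M) N f"
  using smooth_map_compose[OF smooth_atlas_sub[OF assms(1)] assms(1,2) smooth_map_incl[OF assms(1)] assms(3)] .

lemma smooth_map_const:
  assumes M: "smooth_atlas M" and N: "smooth_atlas N" and p: "p \<in> points N"
  shows "smooth_map M N (\<lambda>x. p)"
proof (rule smooth_mapI[OF M N])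
  fix x assume x: "x \<in> points M"
  obtain A \<alpha> where A: "(A, \<alpha>) \<in> M" "x \<in> A" using x by (rule pointsE)
  obtain B \<beta> where B: "(B, \<beta>) \<in> N" "p \<in> B" using p by (rule pointsE)
  show "smooth_at M N (\<lambda>x. p) x"
    by (rule smooth_atI[OF A(1) B(1) A(2) _ open_UNIV smooth_on_const]) (use B in auto)
qed

lemma smooth_map_euclid:
  assumes "smooth_on S f" "\<And>x. x \<in> S \<Longrightarrow> f x \<in> T"
  shows "smooth_map (euclid S) (euclid T) f"
proof (rule smooth_mapI[OF smooth_atlas_euclid smooth_atlas_euclid])
  fix x assume "x \<in> points (euclid S)"
  then show "smooth_at (euclid S) (euclid T) f x"
    using assms by (intro smooth_atI[of S id _ T id _ _ UNIV f]) (auto simp: points_euclid)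
qed

text \<open>The atlas \<open>interval a b\<close> has two half-open charts, while parameter spaces
  use one chart on the closed interval. The identity is smooth both ways, so maps can be moved
  between the two.\<close>

lemma smooth_map_interval_euclid:
  assumes "a < b"
  shows "smooth_map (interval a b) (euclid {a..b}) (\<lambda>x. x)"
    and "smooth_map (euclid {a..b}) (interval a b) (\<lambda>x. x)"
proof -
  \<comment> \<open>The open set \<open>W\<close> excludes the endpoint that the half-open chart
    omits, so that the rest of the interval inside \<open>W\<close> lies in the chart.\<close>
  have ex: "\<exists>U W. (U, id) \<in> interval a b \<and> x \<in> U \<and> x \<in> W \<and> open W \<and> {a..b} \<inter> W \<subseteq> U" if x: "x \<in> {a..b}" for x
  proof (cases "x < b")
    case True
    then show ?thesis using x by (intro exI[of _ "{a..<b}"] exI[of _ "{..<b}"]) (auto simp: interval_def)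
  next
    case False
    then show ?thesis using x assms by (intro exI[of _ "{a<..b}"] exI[of _ "{a<..}"]) (auto simp: interval_def)
  qed
  note gd = smooth_atlas_interval smooth_atlas_euclid
  show "smooth_map (interval a b) (euclid {a..b}) (\<lambda>x. x)"
  proof (rule smooth_mapI[OF gd])
    fix x assume "x \<in> points (interval a b)"
    then obtain U where U: "(U, id) \<in> interval a b" "x \<in> U"
      using ex[of x] assms by (auto simp: points_interval)
    have "U \<subseteq> {a..b}" using chart_subset_points[OF U(1)] points_interval[OF assms] by simp
    then show "smooth_at (interval a b) (euclid {a..b}) (\<lambda>x. x) x"
      by (intro smooth_atI[of U id _ "{a..b}" id, OF U(1) _ U(2) _ open_UNIV smooth_on_id]) auto
  qed
  show "smooth_map (euclid {a..b}) (interval a b) (\<lambda>x. x)"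
  proof (rule smooth_mapI[OF gd(2,1)])
    fix x assume x: "x \<in> points (euclid {a..b})"
    then obtain U W where U: "(U, id) \<in> interval a b" "x \<in> W" "open W" "{a..b} \<inter> W \<subseteq> U"
      using ex[of x] by (auto simp: points_euclid)
    show "smooth_at (euclid {a..b}) (interval a b) (\<lambda>x. x) x"
      by (rule smooth_atI[of "{a..b}" id, OF _ U(1) _ _ U(3) smooth_on_id])
        (use x U in \<open>auto simp: points_euclid\<close>)
  qed
qed

lemma mtop_interval:
  assumes "a < b" shows "mtop (interval a b) = top_of_set {a..b}"
proof -
  note i = smooth_map_interval_euclid[OF assms, THEN smooth_map_continuous]
  have "openin (mtop (interval a b)) S \<longleftrightarrow> openin (mtop (euclid {a..b})) S" for S
  proof
    assume S: "openin (mtop (interval a b)) S"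
    then have "openin (mtop (euclid {a..b})) {x \<in> topspace (mtop (euclid {a..b})). x \<in> S}"
      by (rule openin_continuous_map_preimage[OF i(2)])
    moreover have "{x \<in> topspace (mtop (euclid {a..b})). x \<in> S} = S"
      using openin_subset[OF S] assms by (auto simp: topspace_mtop points_euclid points_interval)
    ultimately show "openin (mtop (euclid {a..b})) S" by simp
  next
    assume S: "openin (mtop (euclid {a..b})) S"
    then have "openin (mtop (interval a b)) {x \<in> topspace (mtop (interval a b)). x \<in> S}"
      by (rule openin_continuous_map_preimage[OF i(1)])
    moreover have "{x \<in> topspace (mtop (interval a b)). x \<in> S} = S"
      using openin_subset[OF S] assms by (auto simp: topspace_mtop points_euclid points_interval)
    ultimately show "openin (mtop (interval a b)) S" by simp
  qed
  then show ?thesis by (simp add: topology_eq mtop_euclid)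
qed

subsection \<open>Kernels of derivatives\<close>

text \<open>Isolated from \<open>smooth_manifold\<close> because it makes derivatives unique at
  boundary points and is inherited by open subsets such as the image of the collar.\<close>

definition half_space_charts :: "('a, 'e::euclidean_space) atlas \<Rightarrow> bool"
  where "half_space_charts M \<longleftrightarrow>
    (\<forall>U \<kappa>. (U, \<kappa>) \<in> M \<longrightarrow> (\<exists>b c. openin (top_of_set {y. c \<le> b \<bullet> y}) (\<kappa> ` U)))"

lemma smooth_manifold_half_space_charts: "smooth_manifold M \<Longrightarrow> half_space_charts M"
  unfolding smooth_manifold_def half_space_charts_def by fast

lemma half_space_charts_sub:
  assumes M: "smooth_atlas M" "half_space_charts M" and S: "openin (mtop M) S"
  shows "half_space_charts (sub_atlas S M)"
  unfolding half_space_charts_def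
proof (intro allI impI)
  fix D \<kappa> assume "(D, \<kappa>) \<in> sub_atlas S M"
  then obtain U where U: "(U, \<kappa>) \<in> M" "D = U \<inter> S" unfolding mem_sub_atlas by metis
  obtain b c where bc: "openin (top_of_set {y. c \<le> b \<bullet> y}) (\<kappa> ` U)"
    using M(2) U(1) unfolding half_space_charts_def by metis
  obtain W where W: "open W" "\<And>x. x \<in> U \<Longrightarrow> x \<in> S \<longleftrightarrow> \<kappa> x \<in> W"
    by (rule openin_mtop_chartE[OF S U(1)]) (rule that)
  have "\<kappa> ` D = \<kappa> ` U \<inter> W" using W(2) U(2) by auto
  then show "\<exists>b c. openin (top_of_set {y. c \<le> b \<bullet> y}) (\<kappa> ` D)"
    using openin_Int_open[OF bc W(1)] by auto
qed

text \<open>A derivative is unique as soon as every direction can be followed a little way within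
  the set, forwards or backwards. In a half-space one of the two signs always works.\<close>

lemma half_space_derivative_unique:
  fixes x :: "'a::euclidean_space"
  assumes S: "openin (top_of_set {y. c \<le> b \<bullet> y}) S" and x: "x \<in> S"
    and D: "(f has_derivative D) (at x within S)" "(f has_derivative D') (at x within S)"
  shows "D = D'"
proof (rule frechet_derivative_unique_within[OF D])
  fix i :: 'a and e :: real assume e: "0 < e"
  obtain W where W: "open W" "S = {y. c \<le> b \<bullet> y} \<inter> W" using S by (auto simp: openin_open)
  then obtain r where r: "r > 0" "ball x r \<subseteq> W" using x by (meson IntE openE)
  \<comment> \<open>The second bound keeps the displacement \<open>d0 * norm i\<close> below
    \<open>r\<close>; the summand 1 takes care of i = 0.\<close>
  define d0 where "d0 = min (e / 2) (r / (2 * (1 + norm i)))"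
  have n: "1 + norm i > 0" by (smt (verit) norm_ge_zero)
  have d0: "d0 > 0" "d0 < e" using e r(1) n by (auto simp: d0_def intro!: divide_pos_pos)
  have "d0 * norm i \<le> r / (2 * (1 + norm i)) * norm i" by (intro mult_right_mono) (auto simp: d0_def)
  also have "\<dots> < r" using r(1) n by (simp add: field_simps) (smt (verit) mult_nonneg_nonneg norm_ge_zero)
  finally have dr: "d0 * norm i < r" .
  define d where "d = (if b \<bullet> i \<ge> 0 then d0 else - d0)"
  have "d * (b \<bullet> i) \<ge> 0" using d0 by (auto simp: d_def mult_le_0_iff)
  then have "c \<le> b \<bullet> (x + d *\<^sub>R i)" using x W by (simp add: inner_add_right)
  moreover have "x + d *\<^sub>R i \<in> W" by (rule subsetD[OF r(2)]) (use dr d0 in \<open>auto simp: d_def dist_norm\<close>)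
  ultimately show "\<exists>d. 0 < \<bar>d\<bar> \<and> \<bar>d\<bar> < e \<and> x + d *\<^sub>R i \<in> S"
    using d0 W by (intro exI[of _ d]) (auto simp: d_def)
qed

lemma chart_derivative_unique:
  assumes "half_space_charts M" "(A, \<alpha>) \<in> M" "x \<in> A"
    and "(f has_derivative D) (at (\<alpha> x) within \<alpha> ` A)" "(f has_derivative D') (at (\<alpha> x) within \<alpha> ` A)"
  shows "D = D'"
  using assms half_space_derivative_unique unfolding half_space_charts_def by blast

lemma chart_derivative:
  assumes M: "smooth_atlas M" and N: "smooth_atlas N" and f: "smooth_map M N f"
    and A: "(A, \<alpha>) \<in> M" "x \<in> A" and B: "(B, \<beta>) \<in> N" "f x \<in> B"
  shows "\<exists>D. ((\<lambda>e. \<beta> (f (inv_into A \<alpha> e))) has_derivative D) (at (\<alpha> x) within \<alpha> ` A)"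
proof -
  obtain W f' where r: "\<alpha> x \<in> W" "chart_rep A \<alpha> B \<beta> f W f'"
    by (rule smooth_map_chart_rep[OF M N f A B]) (rule that)
  note W = chart_repD(1)[OF r(2)] r(1) chart_repD(2-4)[OF r(2)]
  obtain D where D: "(f' has_derivative D) (at (\<alpha> x) within \<alpha> ` A \<inter> W)"
    using smooth_on_has_derivative[OF W(3)] A W(2) by blast
  have "at (\<alpha> x) within \<alpha> ` A \<inter> W = at (\<alpha> x) within \<alpha> ` A"
    using W(1,2) by (intro at_within_nhd[of _ W]) auto
  with D have "(f' has_derivative D) (at (\<alpha> x) within \<alpha> ` A)" by simp
  then have "((\<lambda>e. \<beta> (f (inv_into A \<alpha> e))) has_derivative D) (at (\<alpha> x) within \<alpha> ` A)"
  proof (rule has_derivative_transform_eventually)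
    show "\<forall>\<^sub>F e in at (\<alpha> x) within \<alpha> ` A. f' e = \<beta> (f (inv_into A \<alpha> e))"
    using W smooth_atlasD(1)[OF M A(1)]
    by (auto simp: eventually_at_topological intro!: exI[of _ W])
  qed (use W A smooth_atlasD(1)[OF M A(1)] in auto)
  then show ?thesis by blast
qed

text \<open>Tangent vectors of the source are given in the chart \<open>\<alpha>\<close>. Whether \<open>v\<close> is killed by the derivative
  of \<open>f\<close> does not depend on the chart of \<open>N\<close>, so immersions can be recognized by chasing kernels through
  compositions instead of computing in charts.\<close>

definition dker :: "'a set \<Rightarrow> ('a \<Rightarrow> 'e::euclidean_space) \<Rightarrow> ('b, 'f::euclidean_space) atlas \<Rightarrow> ('a \<Rightarrow> 'b) \<Rightarrow> 'a \<Rightarrow> 'e \<Rightarrow> bool"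
  where "dker A \<alpha> N f x v \<longleftrightarrow> (\<exists>B \<beta> D. (B, \<beta>) \<in> N \<and> f x \<in> B \<and>
    ((\<lambda>e. \<beta> (f (inv_into A \<alpha> e))) has_derivative D) (at (\<alpha> x) within \<alpha> ` A) \<and> D v = 0)"

text \<open>The chain rule in charts. The derivative of the outer map is taken along an open part
  \<open>S\<close> of the middle manifold, which allows for a target chart into which
  \<open>g\<close> does not map all of \<open>B\<close>.\<close>

lemma chart_derivative_compose:
  assumes M: "smooth_atlas M" and N: "smooth_atlas N"
    and f: "smooth_map M N f" and A: "(A, \<alpha>) \<in> M" "x \<in> A" and B: "(B, \<beta>) \<in> N" "f x \<in> B"
    and S: "openin (mtop N) S" "f x \<in> S"
    and D: "((\<lambda>e. \<beta> (f (inv_into A \<alpha> e))) has_derivative D) (at (\<alpha> x) within \<alpha> ` A)"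
    and E: "((\<lambda>e. \<gamma> (g (inv_into B \<beta> e))) has_derivative E) (at (\<beta> (f x)) within \<beta> ` (B \<inter> S))"
  shows "((\<lambda>e. \<gamma> (g (f (inv_into A \<alpha> e)))) has_derivative (\<lambda>v. E (D v))) (at (\<alpha> x) within \<alpha> ` A)"
proof -
  note inj = smooth_atlasD(1)[OF M A(1)] smooth_atlasD(1)[OF N B(1)]
  have T: "openin (mtop M) {y \<in> topspace (mtop M). f y \<in> B \<inter> S}"
    by (rule openin_continuous_map_preimage[OF smooth_map_continuous[OF f]
          openin_Int[OF smooth_atlasD(2)[OF N B(1)] S(1)]])
  obtain W where W: "open W" "\<And>y. y \<in> A \<Longrightarrow> y \<in> {y \<in> topspace (mtop M). f y \<in> B \<inter> S} \<longleftrightarrow> \<alpha> y \<in> W"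
    by (rule openin_mtop_chartE[OF T A(1)]) (rule that)
  have Wi: "f y \<in> B \<inter> S \<longleftrightarrow> \<alpha> y \<in> W" if "y \<in> A" for y
    using W(2)[OF that] chart_subset_points[OF A(1)] that by (auto simp: topspace_mtop)
  have x: "\<alpha> x \<in> W" using Wi A B S by blast
  have at: "at (\<alpha> x) within \<alpha> ` A \<inter> W = at (\<alpha> x) within \<alpha> ` A"
    using W(1) x by (intro at_within_nhd[of _ W]) auto
  have D': "((\<lambda>e. \<beta> (f (inv_into A \<alpha> e))) has_derivative D) (at (\<alpha> x) within \<alpha> ` A \<inter> W)"
    using D at by simp
  have sub: "(\<lambda>e. \<beta> (f (inv_into A \<alpha> e))) ` (\<alpha> ` A \<inter> W) \<subseteq> \<beta> ` (B \<inter> S)"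
    using Wi inj by auto
  have "((\<lambda>e. \<gamma> (g (inv_into B \<beta> e))) has_derivative E)
      (at (\<beta> (f (inv_into A \<alpha> (\<alpha> x)))) within (\<lambda>e. \<beta> (f (inv_into A \<alpha> e))) ` (\<alpha> ` A \<inter> W))"
    using has_derivative_subset[OF E sub] A inj by simp
  from diff_chain_within[OF D' this]
  have c: "((\<lambda>e. \<gamma> (g (inv_into B \<beta> e))) \<circ> (\<lambda>e. \<beta> (f (inv_into A \<alpha> e))) has_derivative E \<circ> D) (at (\<alpha> x) within \<alpha> ` A)"
    by (simp add: at)
  have eq: "((\<lambda>e. \<gamma> (g (inv_into B \<beta> e))) \<circ> (\<lambda>e. \<beta> (f (inv_into A \<alpha> e)))) (\<alpha> y) = \<gamma> (g (f (inv_into A \<alpha> (\<alpha> y))))"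
    if "y \<in> A" "\<alpha> y \<in> W" for y
  proof -
    have "f y \<in> B" using Wi that by blast
    then show ?thesis using that inj by simp
  qed
  have "((\<lambda>e. \<gamma> (g (f (inv_into A \<alpha> e)))) has_derivative E \<circ> D) (at (\<alpha> x) within \<alpha> ` A)"
    by (rule has_derivative_transform_eventually[OF c])
      (use eq W(1) x A in \<open>auto simp: eventually_at_topological intro!: exI[of _ W]\<close>)
  then show ?thesis by (simp add: o_def)
qed

text \<open>The derivative of the composite is \<open>E\<close> after \<open>D\<close>, and
  \<open>E\<close> sends 0 to 0. The final chart is arbitrary; with the identity for
  \<open>g\<close> this yields the independence of kernels from the chart of the target.\<close>

lemma dker_compose_chart:
  assumes M: "smooth_atlas M" and N: "smooth_atlas N" and P: "smooth_atlas P"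
    and f: "smooth_map M N f" and g: "smooth_map N P g"
    and A: "(A, \<alpha>) \<in> M" "x \<in> A" and C: "(C, \<gamma>) \<in> P" "g (f x) \<in> C" and v: "dker A \<alpha> N f x v"
  shows "\<exists>D. ((\<lambda>e. \<gamma> (g (f (inv_into A \<alpha> e)))) has_derivative D) (at (\<alpha> x) within \<alpha> ` A) \<and> D v = 0"
proof -
  obtain B \<beta> D where B: "(B, \<beta>) \<in> N" "f x \<in> B"
    and D: "((\<lambda>e. \<beta> (f (inv_into A \<alpha> e))) has_derivative D) (at (\<alpha> x) within \<alpha> ` A)" "D v = 0"
    using v unfolding dker_def by metis
  obtain E where E: "((\<lambda>e. \<gamma> (g (inv_into B \<beta> e))) has_derivative E) (at (\<beta> (f x)) within \<beta> ` B)"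
    using chart_derivative[OF N P g B C] by metis
  have top: "openin (mtop N) (points N)" "f x \<in> points N"
    using openin_topspace[of "mtop N"] chart_subset_points[OF B(1)] B by (auto simp: topspace_mtop)
  have "B \<inter> points N = B" using chart_subset_points[OF B(1)] by blast
  then have "((\<lambda>e. \<gamma> (g (f (inv_into A \<alpha> e)))) has_derivative (\<lambda>v. E (D v))) (at (\<alpha> x) within \<alpha> ` A)"
    using chart_derivative_compose[OF M N f A B top D(1), of \<gamma> g E] E by simp
  moreover have "E (D v) = 0" using D(2) linear_0[OF has_derivative_linear[OF E]] by simp
  ultimately show ?thesis by blast
qed

lemma dker_compose:
  assumes "smooth_atlas M" "smooth_atlas N" "smooth_atlas P" "smooth_map M N f" "smooth_map N P g"
    and "(A, \<alpha>) \<in> M" "x \<in> A" "dker A \<alpha> N f x v"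
  shows "dker A \<alpha> P (\<lambda>x. g (f x)) x v"
proof -
  have "g (f x) \<in> points P"
    using assms smooth_map_funcset chart_subset_points by (metis in_mono)
  then obtain C \<gamma> where C: "(C, \<gamma>) \<in> P" "g (f x) \<in> C" by (rule pointsE)
  from dker_compose_chart[OF assms(1-7) C assms(8)] C show ?thesis unfolding dker_def by metis
qed

lemma dker_chart:
  assumes "smooth_atlas M" "smooth_atlas N" "smooth_map M N f"
    and "(A, \<alpha>) \<in> M" "x \<in> A" "(B, \<beta>) \<in> N" "f x \<in> B" "dker A \<alpha> N f x v"
  shows "\<exists>D. ((\<lambda>e. \<beta> (f (inv_into A \<alpha> e))) has_derivative D) (at (\<alpha> x) within \<alpha> ` A) \<and> D v = 0"
  using dker_compose_chart[OF assms(1,2,2,3) smooth_map_ident[OF assms(2)] assms(4-8)] .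

lemma dker_Pair:
  assumes "dker A \<alpha> N f x v" "dker A \<alpha> P g x v"
  shows "dker A \<alpha> (N \<times>\<^sub>A P) (\<lambda>x. (f x, g x)) x v"
proof -
  obtain B \<beta> D where B: "(B, \<beta>) \<in> N" "f x \<in> B" "D v = 0"
    and D: "((\<lambda>e. \<beta> (f (inv_into A \<alpha> e))) has_derivative D) (at (\<alpha> x) within \<alpha> ` A)"
    using assms(1) unfolding dker_def by metis
  obtain C \<gamma> E where C: "(C, \<gamma>) \<in> P" "g x \<in> C" "E v = 0"
    and E: "((\<lambda>e. \<gamma> (g (inv_into A \<alpha> e))) has_derivative E) (at (\<alpha> x) within \<alpha> ` A)"
    using assms(2) unfolding dker_def by metis
  have "(B \<times> C, map_prod \<beta> \<gamma>) \<in> N \<times>\<^sub>A P" by (rule prod_atlasI[OF B(1) C(1)])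
  moreover have "((\<lambda>e. map_prod \<beta> \<gamma> (f (inv_into A \<alpha> e), g (inv_into A \<alpha> e))) has_derivative (\<lambda>v. (D v, E v)))
      (at (\<alpha> x) within \<alpha> ` A)"
    using has_derivative_Pair[OF D E] by simp
  ultimately show ?thesis unfolding dker_def
    by (intro exI[of _ "B \<times> C"] exI[of _ "map_prod \<beta> \<gamma>"] exI[of _ "\<lambda>v. (D v, E v)"]) (use B C in \<open>auto simp: zero_prod_def\<close>)
qed

lemma dker_cong:
  assumes "dker A \<alpha> N f x v" "x \<in> A" "inj_on \<alpha> A" "\<And>y. y \<in> A \<Longrightarrow> f y = g y"
  shows "dker A \<alpha> N g x v"
proof -
  obtain B \<beta> D where B: "(B, \<beta>) \<in> N" "f x \<in> B" "D v = 0"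
    and D: "((\<lambda>e. \<beta> (f (inv_into A \<alpha> e))) has_derivative D) (at (\<alpha> x) within \<alpha> ` A)"
    using assms(1) unfolding dker_def by metis
  have "((\<lambda>e. \<beta> (g (inv_into A \<alpha> e))) has_derivative D) (at (\<alpha> x) within \<alpha> ` A)"
    by (rule has_derivative_transform[OF _ _ D]) (use assms in auto)
  then show ?thesis unfolding dker_def using B assms(2,4) by metis
qed

lemma dker_shrink:
  assumes "dker A \<alpha> N f x v" "x \<in> A" "x \<in> S" "inj_on \<alpha> A"
  shows "dker (A \<inter> S) \<alpha> N f x v"
proof -
  obtain B \<beta> D where B: "(B, \<beta>) \<in> N" "f x \<in> B" "D v = 0"
    and D: "((\<lambda>e. \<beta> (f (inv_into A \<alpha> e))) has_derivative D) (at (\<alpha> x) within \<alpha> ` A)"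
    using assms(1) unfolding dker_def by metis
  have inj: "inj_on \<alpha> (A \<inter> S)" using assms(4) by (rule inj_on_subset) auto
  have D': "((\<lambda>e. \<beta> (f (inv_into A \<alpha> e))) has_derivative D) (at (\<alpha> x) within \<alpha> ` (A \<inter> S))"
    by (rule has_derivative_subset[OF D]) auto
  have "((\<lambda>e. \<beta> (f (inv_into (A \<inter> S) \<alpha> e))) has_derivative D) (at (\<alpha> x) within \<alpha> ` (A \<inter> S))"
    by (rule has_derivative_transform[OF _ _ D']) (use assms inj in auto)
  then show ?thesis unfolding dker_def using B by metis
qed

lemma dker_into_sub: "dker A \<alpha> N f x v \<Longrightarrow> f x \<in> S \<Longrightarrow> dker A \<alpha> (sub_atlas S N) f x v"
  unfolding dker_def mem_sub_atlas by blast

text \<open>The end of every kernel chase: in the chart \<alpha> the identity has the identity as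
  its unique derivative, so only 0 is killed.\<close>

lemma dker_ident:
  assumes M: "smooth_atlas M" "half_space_charts M" and A: "(A, \<alpha>) \<in> M" "x \<in> A"
    and v: "dker A \<alpha> M (\<lambda>x. x) x v"
  shows "v = 0"
proof -
  obtain D where D: "((\<lambda>e. \<alpha> (inv_into A \<alpha> e)) has_derivative D) (at (\<alpha> x) within \<alpha> ` A)" "D v = 0"
    using dker_chart[OF M(1) M(1) smooth_map_ident[OF M(1)] A A v] by metis
  have "((\<lambda>e. \<alpha> (inv_into A \<alpha> e)) has_derivative (\<lambda>e. e)) (at (\<alpha> x) within \<alpha> ` A)"
    by (rule has_derivative_transform[OF _ _ has_derivative_ident]) (use A in \<open>auto simp: f_inv_into_f\<close>)
  then have "D = (\<lambda>e. e)" by (rule chart_derivative_unique[OF M(2) A D(1)])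
  with D(2) show ?thesis by simp
qed

text \<open>Immersions can be cancelled. By uniqueness the derivative of the composite is
  \<open>F\<close> after \<open>E\<close> with \<open>F\<close> injective, so a vector killed by the
  composite is already killed by \<open>E\<close>.\<close>

lemma dker_immersion:
  assumes M: "smooth_atlas M" "half_space_charts M" and N: "smooth_atlas N" and P: "smooth_atlas P"
    and f: "smooth_map M N f" and g: "smooth_embedding N P g" and A: "(A, \<alpha>) \<in> M" "x \<in> A"
    and v: "dker A \<alpha> P (\<lambda>x. g (f x)) x v"
  shows "dker A \<alpha> N f x v"
proof -
  have gs: "smooth_map N P g" using g by (simp add: smooth_embedding_def)
  obtain C \<gamma> D where C: "(C, \<gamma>) \<in> P" "g (f x) \<in> C" "D v = 0"
    and D: "((\<lambda>e. \<gamma> (g (f (inv_into A \<alpha> e)))) has_derivative D) (at (\<alpha> x) within \<alpha> ` A)"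
    using v unfolding dker_def by metis
  have x: "x \<in> points M" using chart_subset_points A by blast
  then have fx: "f x \<in> points N" by (rule smooth_map_funcset[OF f])
  obtain B \<beta> where B: "(B, \<beta>) \<in> N" "f x \<in> B" by (rule pointsE[OF fx])
  obtain E where E: "((\<lambda>e. \<beta> (f (inv_into A \<alpha> e))) has_derivative E) (at (\<alpha> x) within \<alpha> ` A)"
    using chart_derivative[OF M(1) N f A B] by metis
  have "\<forall>(U, \<kappa>)\<in>N. \<forall>(U', \<kappa>')\<in>P. \<forall>x\<in>U \<inter> g -` U'. \<exists>D.
       ((\<kappa>' \<circ> g \<circ> inv_into U \<kappa>) has_derivative D) (at (\<kappa> x) within \<kappa> ` (U \<inter> g -` U')) \<and> inj D"
    using g unfolding smooth_embedding_def by blast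
  with B C have "\<exists>F. ((\<gamma> \<circ> g \<circ> inv_into B \<beta>) has_derivative F) (at (\<beta> (f x)) within \<beta> ` (B \<inter> g -` C)) \<and> inj F"
    by fast
  then obtain F where F: "((\<lambda>e. \<gamma> (g (inv_into B \<beta> e))) has_derivative F) (at (\<beta> (f x)) within \<beta> ` (B \<inter> g -` C))" "inj F"
    by (auto simp: o_def)
  have S: "openin (mtop N) {y \<in> topspace (mtop N). g y \<in> C}"
    by (rule openin_continuous_map_preimage[OF smooth_map_continuous[OF gs] smooth_atlasD(2)[OF P C(1)]])
  have "B \<inter> {y \<in> topspace (mtop N). g y \<in> C} = B \<inter> g -` C"
    using chart_subset_points[OF B(1)] by (auto simp: topspace_mtop)
  then have "((\<lambda>e. \<gamma> (g (f (inv_into A \<alpha> e)))) has_derivative (\<lambda>v. F (E v))) (at (\<alpha> x) within \<alpha> ` A)"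
    using F fx C by (intro chart_derivative_compose[OF M(1) N f A B S _ E]) (auto simp: topspace_mtop)
  then have "D = (\<lambda>v. F (E v))" by (rule chart_derivative_unique[OF M(2) A D])
  then have "F (E v) = F 0" using C(3) linear_0[OF has_derivative_linear[OF F(1)]] by simp
  then have "E v = 0" using F(2) by (simp add: inj_eq)
  then show ?thesis using B E unfolding dker_def by metis
qed

text \<open>The one-dimensional case of cancelling an immersion: the chain rule multiplies the
  derivative of \<open>u\<close> by the nonzero number \<open>a'\<close>. It is applied to the two
  profile functions on the collar.\<close>

lemma dker_real_compose:
  fixes u :: "'a \<Rightarrow> real"
  assumes M: "smooth_atlas M" "half_space_charts M" and u: "smooth_map M (euclid T) u"
    and A: "(A, \<alpha>) \<in> M" "x \<in> A" and a: "(a has_real_derivative a') (at (u x))" "a' \<noteq> 0"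
    and v: "dker A \<alpha> (euclid S) (\<lambda>x. a (u x)) x v"
  shows "dker A \<alpha> (euclid T) u x v"
proof -
  obtain D where D: "((\<lambda>e. a (u (inv_into A \<alpha> e))) has_derivative D) (at (\<alpha> x) within \<alpha> ` A)" "D v = 0"
    using v unfolding dker_def by (auto simp: o_def)
  have "x \<in> points M" using chart_subset_points A by blast
  then have ux: "u x \<in> T" using smooth_map_funcset[OF u] by (simp add: points_euclid)
  obtain E where E: "((\<lambda>e. u (inv_into A \<alpha> e)) has_derivative E) (at (\<alpha> x) within \<alpha> ` A)"
    using chart_derivative[OF M(1) smooth_atlas_euclid u A, of T id] ux by auto
  have [simp]: "inv_into A \<alpha> (\<alpha> x) = x" using smooth_atlasD(1)[OF M(1) A(1)] A by simp
  have "(a has_derivative (\<lambda>w. a' * w)) (at (u (inv_into A \<alpha> (\<alpha> x))))"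
    using a(1) by (simp add: has_field_derivative_def)
  from has_derivative_compose[OF E this]
  have "D = (\<lambda>v. a' * E v)" by (rule chart_derivative_unique[OF M(2) A D(1)])
  then have "E v = 0" using D(2) a(2) by simp
  then show ?thesis using E ux unfolding dker_def by (intro exI[of _ T] exI[of _ id] exI[of _ E]) auto
qed

lemma smooth_embeddingI:
  assumes M: "smooth_atlas M" and N: "smooth_atlas N"
    and f: "smooth_map M N f" and e: "embedding_map (mtop M) (mtop N) f"
    and k: "\<And>A \<alpha> x v. (A, \<alpha>) \<in> M \<Longrightarrow> x \<in> A \<Longrightarrow> dker A \<alpha> N f x v \<Longrightarrow> v = 0"
  shows "smooth_embedding M N f"
proof -
  have "\<exists>D. ((\<beta> \<circ> f \<circ> inv_into A \<alpha>) has_derivative D) (at (\<alpha> x) within \<alpha> ` (A \<inter> f -` B)) \<and> inj D"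
    if A: "(A, \<alpha>) \<in> M" and B: "(B, \<beta>) \<in> N" and x: "x \<in> A" "f x \<in> B" for A \<alpha> B \<beta> x
  proof -
    obtain D where D: "((\<lambda>e. \<beta> (f (inv_into A \<alpha> e))) has_derivative D) (at (\<alpha> x) within \<alpha> ` A)"
      using chart_derivative[OF M N f A x(1) B x(2)] by metis
    have "v = 0" if "D v = 0" for v
      by (rule k[OF A x(1)]) (use D B x that in \<open>unfold dker_def, metis\<close>)
    then have "inj D" using linear_injective_0[OF has_derivative_linear[OF D]] by simp
    moreover have "((\<beta> \<circ> f \<circ> inv_into A \<alpha>) has_derivative D) (at (\<alpha> x) within \<alpha> ` (A \<inter> f -` B))"
      using has_derivative_subset[OF D, of "\<alpha> ` (A \<inter> f -` B)"] by (auto simp: o_def)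
    ultimately show ?thesis by blast
  qed
  then show ?thesis unfolding smooth_embedding_def using f e by auto
qed

subsection \<open>The boundary of a manifold\<close>

text \<open>Invariance of domain, applied to the transition map on the part of the interior where
  both charts are defined. Membership in \<open>bdry\<close> can therefore be tested in any one
  chart.\<close>

lemma chart_interior_invariant:
  assumes M: "smooth_atlas M" and U: "(U, \<kappa>) \<in> M" and U': "(U', \<kappa>') \<in> M" and x: "x \<in> U" "x \<in> U'"
    and i: "\<kappa> x \<in> interior (\<kappa> ` U)"
  shows "\<kappa>' x \<in> interior (\<kappa>' ` U')"
proof -
  note inj = smooth_atlasD(1)[OF M U'] smooth_atlasD(1)[OF M U]
  obtain W where W: "open W" "\<And>x. x \<in> U \<Longrightarrow> x \<in> U' \<longleftrightarrow> \<kappa> x \<in> W"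
    by (rule openin_mtop_chartE[OF smooth_atlasD(2)[OF M U'] U]) (rule that)
  obtain g where g: "smooth_on (\<kappa> ` (U \<inter> U')) g" "\<And>x. x \<in> U \<Longrightarrow> x \<in> U' \<Longrightarrow> g (\<kappa> x) = \<kappa>' x"
    by (rule smooth_atlas_transition[OF M U U']) (rule that)
  define T where "T = interior (\<kappa> ` U) \<inter> W"
  have T: "\<exists>y\<in>U \<inter> U'. e = \<kappa> y" if "e \<in> T" for e
    using that interior_subset[of "\<kappa> ` U"] W(2) unfolding T_def by blast
  have "continuous_on T g"
    by (rule continuous_on_subset[OF smooth_on_continuous[OF g(1)]]) (use T in blast)
  moreover have "open T" using W(1) by (simp add: T_def open_Int)
  moreover have "inj_on g T"
  proof (rule inj_onI)
    fix d e assume de: "d \<in> T" "e \<in> T" "g d = g e"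
    obtain y z where "y \<in> U \<inter> U'" "d = \<kappa> y" "z \<in> U \<inter> U'" "e = \<kappa> z" using T de by metis
    then show "d = e" using g(2) de(3) inj(1) by (auto simp: inj_on_def)
  qed
  ultimately have "open (g ` T)" by (rule invariance_of_domain)
  moreover have "g ` T \<subseteq> \<kappa>' ` U'" using T g(2) by fastforce
  moreover have "\<kappa>' x \<in> g ` T"
    using g(2)[OF x, symmetric] i x W(2) by (auto simp: T_def intro!: imageI)
  ultimately show ?thesis by (meson interiorI)
qed

lemma bdry_iff:
  assumes "smooth_atlas M" "(U, \<kappa>) \<in> M" "x \<in> U"
  shows "x \<in> bdry M \<longleftrightarrow> \<kappa> x \<notin> interior (\<kappa> ` U)"
  using assms chart_interior_invariant[OF assms(1)] unfolding bdry_def by blast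

lemma bdry_subset: "bdry M \<subseteq> points M"
  by (auto simp: bdry_def points_def)

lemma closedin_bdry:
  assumes "smooth_atlas M" shows "closedin (mtop M) (bdry M)"
  unfolding closedin_def topspace_mtop
proof (intro conjI bdry_subset openin_mtopI)
  fix U \<kappa> assume U: "(U, \<kappa>) \<in> M"
  then show "\<exists>W. open W \<and> (\<forall>x\<in>U. x \<in> points M - bdry M \<longleftrightarrow> \<kappa> x \<in> W)"
    using bdry_iff[OF assms U] chart_subset_points[OF U] by (intro exI[of _ "interior (\<kappa> ` U)"]) auto
qed auto

lemma open_chart_minus_bdry:
  assumes "smooth_atlas M" "(U, \<kappa>) \<in> M"
  shows "open (\<kappa> ` (U - bdry M))"
proof -
  have "\<kappa> ` (U - bdry M) = interior (\<kappa> ` U)"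
    using bdry_iff[OF assms] interior_subset[of "\<kappa> ` U"] by blast
  then show ?thesis by simp
qed

text \<open>In a half-space chart the interior points are those strictly above the bounding
  hyperplane, so boundary points fill a relatively open part of that hyperplane. This determines the
  dimension of the charts around the binding.\<close>

lemma openin_chart_bdry:
  assumes M: "smooth_atlas M" "half_space_charts M" and U: "(U, \<kappa>) \<in> M" and x: "x \<in> U \<inter> bdry M"
  obtains b c where "b \<noteq> 0" "openin (top_of_set {y. b \<bullet> y = c}) (\<kappa> ` (U \<inter> bdry M))"
proof -
  obtain b c where "openin (top_of_set {y. c \<le> b \<bullet> y}) (\<kappa> ` U)"
    using M(2) U unfolding half_space_charts_def by metis
  then obtain W where W: "open W" "\<kappa> ` U = {y. c \<le> b \<bullet> y} \<inter> W" by (auto simp: openin_open)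
  \<comment> \<open>With normal vector 0 the model set is empty or the whole space, so the chart
    image would be open and contain no boundary point.\<close>
  have b: "b \<noteq> 0"
  proof
    assume "b = 0"
    then have "\<kappa> ` U = {} \<or> \<kappa> ` U = W" using W(2) by auto
    then have "\<kappa> x \<in> interior (\<kappa> ` U)" using W(1) x by (auto simp: interior_open)
    then show False using bdry_iff[OF M(1) U] x by blast
  qed
  have in_iff: "y \<in> interior (\<kappa> ` U) \<longleftrightarrow> b \<bullet> y > c" if "y \<in> \<kappa> ` U" for y
    using that W b by (auto simp: interior_Int interior_open interior_halfspace_ge)
  have "\<kappa> ` (U \<inter> bdry M) = {y \<in> \<kappa> ` U. y \<notin> interior (\<kappa> ` U)}"
    using bdry_iff[OF M(1) U] by auto
  also have "\<dots> = {y \<in> \<kappa> ` U. b \<bullet> y \<le> c}"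
    by (rule Collect_cong) (use in_iff in fastforce)
  also have "\<dots> = {y. b \<bullet> y = c} \<inter> W"
    unfolding W(2) by auto
  finally have "\<kappa> ` (U \<inter> bdry M) = {y. b \<bullet> y = c} \<inter> W" .
  then show ?thesis using b W(1) by (intro that[of b c]) (auto simp: openin_open)
qed

subsection \<open>Collars\<close>

lemma sub_atlas_prod: "sub_atlas (S \<times> T) (M \<times>\<^sub>A N) = sub_atlas S M \<times>\<^sub>A sub_atlas T N"
proof -
  have "(D, \<xi>) \<in> sub_atlas (S \<times> T) (M \<times>\<^sub>A N) \<longleftrightarrow> (D, \<xi>) \<in> sub_atlas S M \<times>\<^sub>A sub_atlas T N" for D \<xi>
  proof
    assume "(D, \<xi>) \<in> sub_atlas (S \<times> T) (M \<times>\<^sub>A N)"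
    then obtain U \<kappa> U' \<kappa>' where "(U, \<kappa>) \<in> M" "(U', \<kappa>') \<in> N" "D = (U \<times> U') \<inter> (S \<times> T)" "\<xi> = map_prod \<kappa> \<kappa>'"
      unfolding mem_sub_atlas mem_prod_atlas by metis
    then show "(D, \<xi>) \<in> sub_atlas S M \<times>\<^sub>A sub_atlas T N"
      unfolding mem_sub_atlas mem_prod_atlas Times_Int_Times by blast
  next
    assume "(D, \<xi>) \<in> sub_atlas S M \<times>\<^sub>A sub_atlas T N"
    then obtain U \<kappa> U' \<kappa>' where "(U, \<kappa>) \<in> M" "(U', \<kappa>') \<in> N" "D = (U \<inter> S) \<times> (U' \<inter> T)" "\<xi> = map_prod \<kappa> \<kappa>'"
      unfolding mem_sub_atlas mem_prod_atlas by metis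
    then show "(D, \<xi>) \<in> sub_atlas (S \<times> T) (M \<times>\<^sub>A N)"
      unfolding mem_sub_atlas mem_prod_atlas Times_Int_Times[symmetric] by blast
  qed
  then show ?thesis by auto
qed

lemma sub_euclid: "sub_atlas S (euclid T) = euclid (T \<inter> S)"
  by (simp add: sub_atlas_def)

locale collared =
  fixes V :: "('v, 'e::euclidean_space) atlas" and c :: "'v \<times> real \<Rightarrow> 'v"
  assumes compact_manifold: "compact_manifold V" and collar: "collar V c"
begin

abbreviation "C \<equiv> collar_image V c"
abbreviation "BV \<equiv> bdry V"
abbreviation "I \<equiv> {0..<1::real}"
abbreviation "BVI \<equiv> sub_atlas BV V \<times>\<^sub>A euclid I"

definition cinv :: "'v \<Rightarrow> 'v \<times> real"
  where "cinv = inv_into (BV \<times> I) c"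

lemma atlas_V: "smooth_atlas V"
  and half_space_V: "half_space_charts V"
  and compact_V: "compact_space (mtop V)"
  and Hausdorff_V: "Hausdorff_space (mtop V)"
  using compact_manifold smooth_manifold_imp_smooth_atlas smooth_manifold_half_space_charts
  by (auto simp: compact_manifold_def smooth_manifold_def)

lemma atlas_bdry: "smooth_atlas (sub_atlas BV V)"
  and atlas_C: "smooth_atlas (sub_atlas C V)"
  and atlas_bdry_I: "smooth_atlas BVI"
  by (intro smooth_atlas_sub atlas_V smooth_atlas_prod smooth_atlas_euclid)+

lemma openin_C: "openin (mtop V) C"
  and c_0: "x \<in> BV \<Longrightarrow> c (x, 0) = x"
  and diffeo_c: "diffeo BVI (sub_atlas C V) c"
  using collar by (auto simp: collar_def)

lemma C_subset: "C \<subseteq> points V"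
  using openin_subset[OF openin_C] by (simp add: topspace_mtop)

lemma points_bdry_I: "points BVI = BV \<times> I"
  using bdry_subset[of V] by (auto simp: points_prod points_sub points_euclid)

lemma points_C: "points (sub_atlas C V) = C"
  using C_subset by (auto simp: points_sub)

lemma bij_c: "bij_betw c (BV \<times> I) C"
  and smooth_c: "smooth_map BVI (sub_atlas C V) c"
  and smooth_cinv: "smooth_map (sub_atlas C V) BVI cinv"
  using diffeo_c by (auto simp: diffeo_def points_bdry_I points_C cinv_def)

lemma c_in_C: "y \<in> BV \<Longrightarrow> 0 \<le> u \<Longrightarrow> u < 1 \<Longrightarrow> c (y, u) \<in> C"
  using bij_betwE[OF bij_c] by auto

lemma cinv_c: "y \<in> BV \<Longrightarrow> 0 \<le> u \<Longrightarrow> u < 1 \<Longrightarrow> cinv (c (y, u)) = (y, u)"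
  using bij_c unfolding cinv_def by (intro inv_into_f_f) (auto simp: bij_betw_def)

lemma c_cinv: "x \<in> C \<Longrightarrow> c (cinv x) = x"
  using bij_c unfolding cinv_def bij_betw_def by (intro f_inv_into_f) auto

lemma cinv_in: "x \<in> C \<Longrightarrow> fst (cinv x) \<in> BV" "x \<in> C \<Longrightarrow> 0 \<le> snd (cinv x)" "x \<in> C \<Longrightarrow> snd (cinv x) < 1"
  using smooth_map_funcset[OF smooth_cinv] unfolding points_bdry_I points_C by (auto simp: mem_Times_iff)

lemma C_cases:
  assumes "x \<in> C" obtains y u where "y \<in> BV" "0 \<le> u" "u < 1" "x = c (y, u)" "cinv x = (y, u)"
  using cinv_in[OF assms] c_cinv[OF assms] by (metis that prod.collapse)

lemma bdry_C: "x \<in> BV \<Longrightarrow> x \<in> C" "x \<in> BV \<Longrightarrow> cinv x = (x, 0)"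
  using c_in_C[of x 0] cinv_c[of x 0] c_0 by auto

lemma smooth_c_V: "smooth_map BVI V c"
  using smooth_map_compose[OF atlas_bdry_I atlas_C atlas_V smooth_c smooth_map_incl[OF atlas_V]] .

lemma compactin_bdry: "compactin (mtop V) BV"
  by (rule closedin_compact_space[OF compact_V closedin_bdry[OF atlas_V]])

text \<open>The removed part of the collar is the image of a compact set, as \<open>bdry V\<close>
  is compact and {0..r} stays inside \<open>I\<close>; it is therefore closed in the Hausdorff
  space.\<close>

lemma openin_outer:
  assumes "r < 1"
  shows "openin (mtop V) (points V - c ` (BV \<times> {0..r}))"
proof -
  have "compactin (mtop (sub_atlas BV V)) BV"
    using compactin_bdry by (simp add: mtop_sub[OF atlas_V] compactin_subtopology)
  moreover have "compactin (mtop (euclid I)) {0..r}"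
    using assms by (auto simp: mtop_euclid compactin_subtopology)
  ultimately have "compactin (mtop BVI) (BV \<times> {0..r})"
    unfolding mtop_prod[OF atlas_bdry smooth_atlas_euclid] compactin_Times by blast
  then have "compactin (mtop V) (c ` (BV \<times> {0..r}))"
    by (rule image_compactin[OF _ smooth_map_continuous[OF smooth_c_V]])
  then have "closedin (mtop V) (c ` (BV \<times> {0..r}))"
    by (rule compactin_imp_closedin[OF Hausdorff_V])
  then show ?thesis using openin_diff[OF openin_topspace] by (metis topspace_mtop)
qed

text \<open>The domain is covered by the open sets over \<open>C\<close> and over the complement of
  the collar up to \<open>r\<close>. On the first the map is \<open>f\<close> read through
  \<open>cinv\<close>; on the second it is \<open>g\<close>, because both formulas agree on the
  overlap.\<close>

lemma smooth_map_collar_glue: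
  assumes N: "smooth_atlas N"
    and f: "smooth_map (euclid T \<times>\<^sub>A BVI) N (\<lambda>(s, q). f s q)"
    and g: "smooth_map (euclid T \<times>\<^sub>A V) N (\<lambda>(s, x). g s x)"
    and r: "r < 1" and eq: "\<And>s y u. s \<in> T \<Longrightarrow> y \<in> BV \<Longrightarrow> 0 \<le> u \<Longrightarrow> r \<le> u \<Longrightarrow> u < 1 \<Longrightarrow> f s (y, u) = g s (c (y, u))"
  shows "smooth_map (euclid T \<times>\<^sub>A V) N (\<lambda>(s, x). if x \<in> C then f s (cinv x) else g s x)" (is "smooth_map _ _ ?F")
proof (rule smooth_map_local)
  note E = smooth_atlas_euclid[of T]
  show TV: "smooth_atlas (euclid T \<times>\<^sub>A V)" by (rule smooth_atlas_prod[OF E atlas_V])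
  show "smooth_atlas N" by (rule N)
  have oT: "openin (mtop (euclid T)) T" using openin_topspace[of "top_of_set T"] by (simp add: mtop_euclid)
  fix p assume "p \<in> points (euclid T \<times>\<^sub>A V)"
  then obtain s x where p: "p = (s, x)" "s \<in> T" "x \<in> points V" by (auto simp: points_prod points_euclid)
  show "\<exists>S. openin (mtop (euclid T \<times>\<^sub>A V)) S \<and> p \<in> S \<and> smooth_map (sub_atlas S (euclid T \<times>\<^sub>A V)) N ?F"
  proof (cases "x \<in> C")
    case True
    have TC: "smooth_atlas (euclid T \<times>\<^sub>A sub_atlas C V)" by (rule smooth_atlas_prod[OF E atlas_C])
    have "smooth_map (euclid T \<times>\<^sub>A sub_atlas C V) (euclid T \<times>\<^sub>A BVI) (\<lambda>p. (fst p, cinv (snd p)))"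
      by (intro smooth_map_Pair TC E atlas_bdry_I smooth_map_fst[OF E atlas_C]
          smooth_map_compose[OF TC atlas_C atlas_bdry_I smooth_map_snd[OF E atlas_C] smooth_cinv])
    then have "smooth_map (euclid T \<times>\<^sub>A sub_atlas C V) N (\<lambda>p. case (fst p, cinv (snd p)) of (s, q) \<Rightarrow> f s q)"
      by (rule smooth_map_compose[OF TC smooth_atlas_prod[OF E atlas_bdry_I] N _ f])
    then have "smooth_map (euclid T \<times>\<^sub>A sub_atlas C V) N ?F"
      by (rule smooth_map_cong[OF TC N]) (auto simp: points_prod points_C)
    moreover have "sub_atlas (T \<times> C) (euclid T \<times>\<^sub>A V) = euclid T \<times>\<^sub>A sub_atlas C V"
      by (simp add: sub_atlas_prod sub_euclid)
    moreover have "openin (mtop (euclid T \<times>\<^sub>A V)) (T \<times> C)"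
      by (simp add: mtop_prod[OF E atlas_V] openin_prod_Times_iff oT openin_C)
    ultimately show ?thesis using p True by (intro exI[of _ "T \<times> C"]) auto
  next
    case False
    define S where "S = T \<times> (points V - c ` (BV \<times> {0..r}))"
    have "openin (mtop (euclid T \<times>\<^sub>A V)) S"
      by (simp add: S_def mtop_prod[OF E atlas_V] openin_prod_Times_iff oT openin_outer[OF r])
    moreover have "p \<in> S" using p False c_in_C r by (auto simp: S_def)
    moreover have "smooth_map (sub_atlas S (euclid T \<times>\<^sub>A V)) N ?F"
    proof (rule smooth_map_cong[OF smooth_atlas_sub[OF TV] N smooth_map_restrict[OF TV N g]])
      fix q assume q: "q \<in> points (sub_atlas S (euclid T \<times>\<^sub>A V))"
      then obtain s x where sx: "q = (s, x)" "s \<in> T" "x \<notin> c ` (BV \<times> {0..r})"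
        by (auto simp: points_sub S_def)
      show "(case q of (s, x) \<Rightarrow> g s x) = ?F q"
      proof (cases "x \<in> C")
        case True
        then obtain y u where yu: "y \<in> BV" "0 \<le> u" "u < 1" "x = c (y, u)" "cinv x = (y, u)" by (rule C_cases)
        then have "r \<le> u" using sx(3) by force
        then show ?thesis using True sx yu eq by simp
      qed (simp add: sx)
    qed
    ultimately show ?thesis by blast
  qed
qed

end

subsection \<open>The profile of the Seifert type embedding\<close>

lemma step_mono: "d > 0 \<Longrightarrow> u \<le> v \<Longrightarrow> step d u \<le> step d v"
  unfolding step_def
  by (intro diff_left_mono divide_right_mono flat0_mono flat_nonneg) (simp add: flat0_mono)

text \<open>The collar coordinate of a pushed point that started at \<open>u\<close>. Time
  \<open>s\<close> interpolates linearly between the identity and a map that collapses [0, p] to 0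
  and is the identity from p + d on; the collapsed segment becomes the vertical wall over the
  binding.\<close>

definition stretch :: "real \<Rightarrow> real \<Rightarrow> real \<Rightarrow> real \<Rightarrow> real"
  where "stretch p d s u = (1 - s) * u + s * (u * step d (u - p))"

text \<open>The level of the pushed point. It is -1 on the boundary and reaches at u = q the level s
  - 1 shared by the rest of the page, which is 0 at the end of the isotopy. The flat function makes
  it constant from \<open>q\<close> on without loss of smoothness.\<close>

definition lift :: "real \<Rightarrow> real \<Rightarrow> real \<Rightarrow> real"
  where "lift q s u = s * (1 - flat 0 (q - u) / flat 0 q) - 1"

lemma smooth_on_stretch: "smooth_on S (\<lambda>x. stretch p d (fst x) (snd x))"
  unfolding stretch_def
  by (intro smooth_on_add smooth_on_mult smooth_on_diff smooth_on_const smooth_on_linear[OF bounded_linear_fst]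
      smooth_on_linear[OF bounded_linear_snd] smooth_on_compose[of S _ UNIV "step d"] smooth_on_step) auto

lemma smooth_on_lift: "smooth_on S (\<lambda>x. lift q (fst x) (snd x))"
proof -
  have "smooth_on S (\<lambda>x. fst x * (1 - (1 / flat 0 q) * flat 0 (q - snd x)) - 1)"
    by (intro smooth_on_mult smooth_on_diff smooth_on_const smooth_on_linear[OF bounded_linear_fst]
        smooth_on_linear[OF bounded_linear_snd] smooth_on_compose[of S _ UNIV "flat 0"] smooth_on_flat) auto
  then show ?thesis by (simp add: lift_def)
qed

context
  fixes p d s u :: real
  assumes p: "0 < p" and d: "d > 0" and s: "0 \<le> s" "s \<le> 1" and u: "0 \<le> u"
begin

lemma stretch_bounds: "0 \<le> stretch p d s u" "stretch p d s u \<le> u"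
proof -
  have "u * step d (u - p) \<le> u * 1" by (intro mult_left_mono step_props u d)
  then have "stretch p d s u \<le> (1 - s) * u + s * u"
    unfolding stretch_def using s by (intro add_left_mono mult_left_mono) auto
  then show "stretch p d s u \<le> u" by (simp add: algebra_simps)
  show "0 \<le> stretch p d s u"
    unfolding stretch_def using s u d by (intro add_nonneg_nonneg mult_nonneg_nonneg step_props) auto
qed

text \<open>Strictness fails only at s = 1 on [0, p], the segment that is collapsed; there
  \<open>lift\<close> takes over.\<close>

lemma stretch_mono:
  assumes "u < v" "s < 1 \<or> p < v"
  shows "stretch p d s u < stretch p d s v"
proof -
  have m: "u * step d (u - p) \<le> v * step d (v - p)"
    using u d assms by (intro mult_mono step_mono step_props) auto
  show ?thesis
  proof (cases "s < 1")
    case True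
    then have "(1 - s) * u < (1 - s) * v" using assms by simp
    moreover have "s * (u * step d (u - p)) \<le> s * (v * step d (v - p))" using s m by (intro mult_left_mono)
    ultimately show ?thesis by (simp add: stretch_def)
  next
    case False
    then have 1: "s = 1" "p < v" using s assms by auto
    have "u * step d (u - p) \<le> u * step d (v - p)" using u d assms by (intro mult_left_mono step_mono) auto
    also have "\<dots> < v * step d (v - p)" using 1 assms d by (intro mult_strict_right_mono step_props) auto
    finally show ?thesis using 1 by (simp add: stretch_def)
  qed
qed

text \<open>The derivative (1 - s) + s * (step + u * step') has only nonnegative terms; 1 - s is
  positive before the final time, and \<open>step\<close> is positive beyond
  \<open>p\<close>.\<close>

lemma stretch_deriv: "\<exists>D. (stretch p d s has_real_derivative D) (at u) \<and> (s < 1 \<or> p < u \<longrightarrow> D \<noteq> 0)"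
proof -
  obtain D where D: "D \<ge> 0" "(step d has_real_derivative D) (at (u - p))" using step_props(6)[OF d] by metis
  have "((\<lambda>u. u - p) has_real_derivative 1) (at u)" by (auto intro!: derivative_eq_intros)
  from DERIV_chain2[OF D(2) this] have "((\<lambda>u. step d (u - p)) has_real_derivative D) (at u)" by simp
  then have "(stretch p d s has_real_derivative (1 - s) + s * (step d (u - p) + u * D)) (at u)"
    unfolding stretch_def[abs_def] by (auto intro!: derivative_eq_intros simp: algebra_simps)
  moreover have "(1 - s) + s * (step d (u - p) + u * D) > 0" if "s < 1 \<or> p < u"
  proof (cases "s < 1")
    case True
    then show ?thesis using s u D d by (intro add_pos_nonneg mult_nonneg_nonneg add_nonneg_nonneg step_props) auto
  next
    case False
    then have "step d (u - p) > 0" using that step_props(3)[OF d] by auto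
    then show ?thesis using False s u D by (intro add_nonneg_pos mult_pos_pos add_pos_nonneg mult_nonneg_nonneg) auto
  qed
  ultimately show ?thesis by (metis less_irrefl)
qed

end

lemma stretch_simps:
  assumes "0 < p" "d > 0"
  shows "u \<ge> p + d \<Longrightarrow> stretch p d s u = u" "u \<le> p \<Longrightarrow> stretch p d 1 u = 0" "stretch p d 0 u = u"
    "stretch p d s 0 = 0"
  using step_props[OF assms(2)] assms by (auto simp: stretch_def algebra_simps)

context
  fixes q s u :: real
  assumes q: "0 < q" and s: "0 \<le> s" "s \<le> 1" and u: "0 \<le> u"
begin

lemma lift_bounds: "- 1 \<le> lift q s u" "lift q s u \<le> 0"
proof -
  have "flat 0 (q - u) \<le> flat 0 q" using u by (intro flat0_mono) auto
  moreover have f: "flat 0 q > 0" using q by (rule flat_pos)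
  ultimately have "flat 0 (q - u) / flat 0 q \<le> 1" "flat 0 (q - u) / flat 0 q \<ge> 0" by (auto simp: flat_nonneg)
  then have "0 \<le> s * (1 - flat 0 (q - u) / flat 0 q)" "s * (1 - flat 0 (q - u) / flat 0 q) \<le> 1"
    using s by (auto intro!: mult_le_one)
  then show "- 1 \<le> lift q s u" "lift q s u \<le> 0" unfolding lift_def by auto
qed

lemma lift_mono:
  assumes "u < v" "u < q" shows "lift q 1 u < lift q 1 v"
proof -
  have "flat 0 (q - v) < flat 0 (q - u)" using assms by (intro flat0_less) auto
  then show ?thesis using flat_pos[OF q, of 0] by (simp add: lift_def divide_strict_right_mono)
qed

text \<open>Complements \<open>stretch_deriv\<close>: once p < q, at each time and position at least
  one of the two profiles has nonzero derivative.\<close>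

lemma lift_deriv: "\<exists>D. (lift q s has_real_derivative D) (at u) \<and> (0 < s \<and> u < q \<longrightarrow> D \<noteq> 0)"
proof -
  have "((\<lambda>u. q - u) has_real_derivative - 1) (at u)" by (auto intro!: derivative_eq_intros)
  from DERIV_chain2[OF DERIV_flat0 this]
  have "((\<lambda>u. flat 0 (q - u)) has_real_derivative - flat 2 (q - u)) (at u)" by simp
  from DERIV_diff[OF DERIV_cmult[OF DERIV_diff[OF DERIV_const[of 1] DERIV_cdivide[OF this]]] DERIV_const[of 1]]
  have "(lift q s has_real_derivative s * (flat 2 (q - u) / flat 0 q)) (at u)"
    by (simp add: lift_def[abs_def])
  moreover have "s * (flat 2 (q - u) / flat 0 q) \<noteq> 0" if "0 < s \<and> u < q"
    using that q flat_pos[of "q - u" 2] flat_pos[OF q, of 0] by auto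
  ultimately show ?thesis by blast
qed

end

lemma lift_simps:
  assumes "0 < q"
  shows "u \<ge> q \<Longrightarrow> lift q s u = s - 1" "lift q 0 u = - 1" "lift q s 0 = - 1"
  using flat_pos[OF assms, of 0] by (auto simp: lift_def flat_eq_0)

text \<open>Ensures that at u = p, where the page leaves the vertical wall, the level is already
  within \<open>e\<close> of 0, so that the rounding stays close to the corner.\<close>

lemma lift_near_zero:
  assumes "0 < q" "0 < e"
  obtains p where "0 < p" "p < q" "- e < lift q 1 p"
proof
  have f: "flat 0 q > 0" using assms by (intro flat_pos)
  \<comment> \<open>With p = q - x the level is - flat 0 x / flat 0 q, and flat 0 x is at most 2 *
    x^2. The bound q / 2 keeps p positive, the bound 1 replaces x^2 by x, and the last one makes 2 *
    x smaller than e * flat 0 q.\<close>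
  define x where "x = Min {q / 2, 1, e * flat 0 q / 3}"
  have x: "0 < x" "x \<le> q / 2" "x \<le> 1" "x \<le> e * flat 0 q / 3" using assms f by (auto simp: x_def)
  show "0 < q - x" "q - x < q" using x assms by auto
  have "flat 0 x \<le> 2 * x\<^sup>2" using flat_bound[of 0 x] flat_nonneg[of 0 x] by (simp add: fact_2 numeral_2_eq_2)
  also have "\<dots> \<le> 2 * x" using x by (simp add: power2_eq_square mult_left_le)
  also have "\<dots> < e * flat 0 q" using x(4) mult_pos_pos[OF assms(2) f] by linarith
  finally have "flat 0 x / flat 0 q < e" using f by (simp add: pos_divide_less_eq)
  then show "- e < lift q 1 (q - x)" by (simp add: lift_def)
qed

subsection \<open>Seifert type embeddings\<close>

context collared
begin

text \<open>The tube lemma over the compact boundary: the preimage of \<open>W\<close> in collar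
  coordinates contains the slice over (0, 0), hence a neighbourhood of it that is uniform in the
  boundary point.\<close>

lemma rounding_neighbourhood:
  assumes N: "smooth_atlas N" and i: "smooth_map V N \<iota>"
    and W: "openin (mtop (N \<times>\<^sub>A interval (-1) 0)) W" "\<iota> ` BV \<times> {0} \<subseteq> W"
  obtains e where "0 < e" "e \<le> 1 / 2"
    "\<And>y u t. y \<in> BV \<Longrightarrow> 0 \<le> u \<Longrightarrow> u < e \<Longrightarrow> - e < t \<Longrightarrow> t \<le> 0 \<Longrightarrow> (\<iota> (c (y, u)), t) \<in> W"
proof -
  note int = smooth_map_interval_euclid[of "-1" 0, simplified]
  note E = smooth_atlas_euclid and In = smooth_atlas_interval[of "-1" 0]
  let ?R = "I \<times> {-1..0::real}"
  let ?M = "sub_atlas BV V \<times>\<^sub>A euclid ?R"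
  have M: "smooth_atlas ?M" by (intro smooth_atlas_prod atlas_bdry E)
  note f = smooth_map_fst[OF atlas_bdry E] and g = smooth_map_snd[OF atlas_bdry E]
  have u: "smooth_map ?M (euclid I) (\<lambda>p. fst (snd p))"
    by (rule smooth_map_compose[OF M E E g smooth_map_euclid]) (auto intro: smooth_on_linear bounded_linear_fst)
  have t: "smooth_map ?M (euclid {-1..0}) (\<lambda>p. snd (snd p))"
    by (rule smooth_map_compose[OF M E E g smooth_map_euclid]) (auto intro: smooth_on_linear bounded_linear_snd)
  have "smooth_map ?M (N \<times>\<^sub>A interval (-1) 0) (\<lambda>p. (\<iota> (c (fst p, fst (snd p))), snd (snd p)))"
    by (intro smooth_map_Pair[OF M N In] smooth_map_compose[OF M atlas_V N _ i]
        smooth_map_compose[OF M atlas_bdry_I atlas_V _ smooth_c_V] smooth_map_Pair[OF M atlas_bdry E] f u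
        smooth_map_compose[OF M E In t int(2)])
  from openin_continuous_map_preimage[OF smooth_map_continuous[OF this] W(1)]
  have o: "openin (prod_topology (mtop (sub_atlas BV V)) (top_of_set ?R))
      {p \<in> topspace (mtop ?M). (\<iota> (c (fst p, fst (snd p))), snd (snd p)) \<in> W}"
    (is "openin _ ?P")
    by (simp add: mtop_prod[OF atlas_bdry E] mtop_euclid)
  have C: "compactin (mtop (sub_atlas BV V)) BV"
    using compactin_bdry by (simp add: mtop_sub[OF atlas_V] compactin_subtopology)
  have "BV \<times> {(0, 0)} \<subseteq> ?P"
    using W(2) c_0 bdry_subset[of V] by (auto simp: topspace_mtop points_prod points_sub points_euclid)
  then obtain A B where AB: "BV \<subseteq> A" "openin (top_of_set ?R) B" "(0, 0) \<in> B" "A \<times> B \<subseteq> ?P"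
    using tube_lemma_left[OF o C, of "(0,0)"] by auto
  obtain r where r: "r > 0" "ball (0, 0) r \<inter> ?R \<subseteq> B"
    using AB(2,3) by (meson openin_contains_ball)
  \<comment> \<open>The value r / 2 serves both coordinates, since |u| + |t| bounds the norm. The
    bound 1 / 2 keeps (u, t) in \<open>?R\<close>, and later it places the rounded part at levels
    above -1/2, where \<open>plateau\<close> is 1.\<close>
  define e where "e = min (1 / 2) (r / 2)"
  show ?thesis
  proof (rule that[of e])
    show "0 < e" "e \<le> 1 / 2" using r by (auto simp: e_def)
    fix y u t assume yut: "y \<in> BV" "0 \<le> u" "u < e" "- e < t" "t \<le> (0::real)"
    have "norm (u, t) \<le> norm u + norm t" by (rule norm_Pair_le)
    also have "\<dots> < r" using yut by (auto simp: e_def)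
    finally have "(u, t) \<in> ball (0, 0) r" by (simp add: zero_prod_def[symmetric])
    moreover have "(u, t) \<in> ?R" using yut by (auto simp: e_def)
    ultimately have "(y, (u, t)) \<in> ?P" using r AB yut by blast
    then show "(\<iota> (c (y, u)), t) \<in> W" by simp
  qed
qed

text \<open>The isotopy of the page before composition with \<iota>, as a point of \<open>V\<close>
  and a level, so that its injectivity and smoothness are settled independently of the ambient
  manifold. Outside the collar the page rises rigidly.\<close>

definition pushed :: "real \<Rightarrow> real \<Rightarrow> real \<Rightarrow> real \<Rightarrow> 'v \<Rightarrow> 'v \<times> real"
  where "pushed p d q s x = (if x \<in> C
    then (c (fst (cinv x), stretch p d s (snd (cinv x))), lift q s (snd (cinv x))) else (x, s - 1))"

lemma pushed_c:
  "y \<in> BV \<Longrightarrow> 0 \<le> u \<Longrightarrow> u < 1 \<Longrightarrow> pushed p d q s (c (y, u)) = (c (y, stretch p d s u), lift q s u)"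
  by (simp add: pushed_def cinv_c c_in_C)

lemma pushed_out: "x \<notin> C \<Longrightarrow> pushed p d q s x = (x, s - 1)"
  by (simp add: pushed_def)

context
  fixes p d q :: real
  assumes par: "0 < p" "p < q" "q < 1" "0 < d" "p + d < 1"
begin

lemma cinv_pushed:
  assumes "x \<in> C" "0 \<le> s" "s \<le> 1"
  shows "cinv (fst (pushed p d q s x)) = (fst (cinv x), stretch p d s (snd (cinv x)))"
    "fst (pushed p d q s x) \<in> C"
proof -
  have "0 \<le> stretch p d s (snd (cinv x))" "stretch p d s (snd (cinv x)) < 1"
    using stretch_bounds[of p d s "snd (cinv x)"] par assms cinv_in[OF assms(1)] by auto
  then show "cinv (fst (pushed p d q s x)) = (fst (cinv x), stretch p d s (snd (cinv x)))"
    "fst (pushed p d q s x) \<in> C"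
    using assms(1) cinv_in by (auto simp: pushed_def cinv_c c_in_C)
qed

lemma pushed_in:
  assumes "x \<in> points V" "0 \<le> s" "s \<le> 1"
  shows "fst (pushed p d q s x) \<in> points V" "fst (pushed p d q s x) \<in> C \<longleftrightarrow> x \<in> C" "snd (pushed p d q s x) \<in> {-1..0}"
proof -
  have *: "fst (pushed p d q s x) \<in> points V \<and> (fst (pushed p d q s x) \<in> C \<longleftrightarrow> x \<in> C) \<and> snd (pushed p d q s x) \<in> {-1..0}"
  proof (cases "x \<in> C")
    case True
    then show ?thesis using cinv_pushed(2)[OF True assms(2,3)] C_subset par assms cinv_in[OF True]
        lift_bounds[of q s "snd (cinv x)"] by (auto simp: pushed_def)
  qed (use assms in \<open>auto simp: pushed_out\<close>)
  then show "fst (pushed p d q s x) \<in> points V" "fst (pushed p d q s x) \<in> C \<longleftrightarrow> x \<in> C"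
    "snd (pushed p d q s x) \<in> {-1..0}" by auto
qed

text \<open>Collar points with the same image share the boundary coordinate. Two distances v < w are
  told apart by \<open>stretch\<close> unless s = 1 and w \<le> p; then v < q, and
  \<open>lift\<close> tells them apart.\<close>

lemma pushed_inj:
  assumes "0 \<le> s" "s \<le> 1" shows "inj_on (pushed p d q s) (points V)"
proof (rule inj_onI)
  fix x x' assume x: "x \<in> points V" "x' \<in> points V" and eq: "pushed p d q s x = pushed p d q s x'"
  then have C: "x \<in> C \<longleftrightarrow> x' \<in> C" using pushed_in(2) assms by metis
  show "x = x'"
  proof (cases "x \<in> C")
    case True
    then have C': "x' \<in> C" using C by simp
    let ?u = "snd (cinv x)" and ?u' = "snd (cinv x')"
    have "(fst (cinv x), stretch p d s ?u) = (fst (cinv x'), stretch p d s ?u')"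
      using cinv_pushed(1)[OF True assms] cinv_pushed(1)[OF C' assms] unfolding eq by (rule trans[OF sym])
    then have e: "fst (cinv x) = fst (cinv x')" "stretch p d s ?u = stretch p d s ?u'" by blast+
    have e2: "lift q s ?u = lift q s ?u'" using eq True C' by (simp add: pushed_def)
    have False if "v < w" "0 \<le> v" "stretch p d s v = stretch p d s w" "lift q s v = lift q s w" for v w
    proof (cases "s < 1 \<or> p < w")
      case True
      then show False using stretch_mono[of p d s v w] par assms that by auto
    next
      case False
      then have "s = 1" "v < q" using assms that par by auto
      then show False using lift_mono[of q s v w] par that by auto
    qed
    from this[OF _ cinv_in(2)[OF True] e(2) e2] this[OF _ cinv_in(2)[OF C'] e(2)[symmetric] e2[symmetric]]
    have "?u = ?u'" by (meson linorder_less_linear)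
    then have "cinv x = cinv x'" using e(1) by (rule prod_eqI[rotated])
    from arg_cong[OF this, of c] show ?thesis unfolding c_cinv[OF True] c_cinv[OF C'] .
  qed (use C eq in \<open>auto simp: pushed_out\<close>)
qed

lemma smooth_pushed: "smooth_map (euclid {0..1} \<times>\<^sub>A V) (V \<times>\<^sub>A interval (-1) 0) (\<lambda>(s, x). pushed p d q s x)"
proof -
  note int = smooth_map_interval_euclid[of "-1" 0, simplified]
  note E = smooth_atlas_euclid and In = smooth_atlas_interval[of "-1" 0]
  let ?T = "{0..1::real}"
  let ?M = "euclid ?T \<times>\<^sub>A BVI"
  have M: "smooth_atlas ?M" by (intro smooth_atlas_prod atlas_bdry E)
  have TV: "smooth_atlas (euclid ?T \<times>\<^sub>A V)" by (intro smooth_atlas_prod atlas_V E)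
  have VI: "smooth_atlas (V \<times>\<^sub>A interval (-1) 0)" by (intro smooth_atlas_prod atlas_V In)
  have s: "smooth_map ?M (euclid ?T) fst" by (rule smooth_map_fst[OF E atlas_bdry_I])
  have q: "smooth_map ?M BVI snd" by (rule smooth_map_snd[OF E atlas_bdry_I])
  have y: "smooth_map ?M (sub_atlas BV V) (\<lambda>z. fst (snd z))"
    by (rule smooth_map_compose[OF M atlas_bdry_I atlas_bdry q smooth_map_fst[OF atlas_bdry E]])
  have u: "smooth_map ?M (euclid I) (\<lambda>z. snd (snd z))"
    by (rule smooth_map_compose[OF M atlas_bdry_I E q smooth_map_snd[OF atlas_bdry E]])
  have su: "smooth_map ?M (euclid (?T \<times> I)) (\<lambda>z. (fst z, snd (snd z)))"
    using smooth_map_Pair[OF M E E s u] by (simp add: prod_euclid)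
  have st: "smooth_map (euclid (?T \<times> I)) (euclid I) (\<lambda>x. stretch p d (fst x) (snd x))"
  proof (rule smooth_map_euclid[OF smooth_on_stretch])
    fix x assume "x \<in> ?T \<times> I"
    then have "0 \<le> stretch p d (fst x) (snd x)" "stretch p d (fst x) (snd x) \<le> snd x" "snd x < 1"
      using par by (auto intro!: stretch_bounds)
    then show "stretch p d (fst x) (snd x) \<in> I" by simp
  qed
  have li: "smooth_map (euclid (?T \<times> I)) (euclid {-1..0}) (\<lambda>x. lift q (fst x) (snd x))"
    by (rule smooth_map_euclid[OF smooth_on_lift]) (use par in \<open>auto intro!: lift_bounds\<close>)
  have f1: "smooth_map ?M V (\<lambda>z. c (fst (snd z), stretch p d (fst z) (snd (snd z))))"
    by (rule smooth_map_compose[OF M atlas_bdry_I atlas_V smooth_map_Pair[OF M atlas_bdry E y] smooth_c_V])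
       (use smooth_map_compose[OF M E E su st] in simp)
  have f2: "smooth_map ?M (interval (-1) 0) (\<lambda>z. lift q (fst z) (snd (snd z)))"
    by (rule smooth_map_compose[OF M E In _ int(2)]) (use smooth_map_compose[OF M E E su li] in simp)
  have f: "smooth_map ?M (V \<times>\<^sub>A interval (-1) 0)
      (\<lambda>(s, z). (c (fst z, stretch p d s (snd z)), lift q s (snd z)))"
    using smooth_map_Pair[OF M atlas_V In f1 f2] by (simp add: case_prod_unfold)
  have "smooth_map (euclid ?T) (euclid {-1..0}) (\<lambda>s. s - 1)"
    by (intro smooth_map_euclid smooth_on_diff smooth_on_id smooth_on_const) auto
  from smooth_map_compose[OF E E In this int(2)] smooth_map_compose[OF TV E In smooth_map_fst[OF E atlas_V]]
  have "smooth_map (euclid ?T \<times>\<^sub>A V) (interval (-1) 0) (\<lambda>z. fst z - 1)" by blast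
  from smooth_map_Pair[OF TV atlas_V In smooth_map_snd[OF E atlas_V] this]
  have g: "smooth_map (euclid ?T \<times>\<^sub>A V) (V \<times>\<^sub>A interval (-1) 0) (\<lambda>(s, x). (x, s - 1))"
    by (simp add: case_prod_unfold)
  \<comment> \<open>From max q (p + d) on, \<open>stretch\<close> is the identity and
    \<open>lift\<close> equals s - 1, so the collar formula agrees with the rigid one.\<close>
  have "smooth_map (euclid ?T \<times>\<^sub>A V) (V \<times>\<^sub>A interval (-1) 0)
      (\<lambda>(s, x). if x \<in> C then (c (fst (cinv x), stretch p d s (snd (cinv x))), lift q s (snd (cinv x))) else (x, s - 1))"
    by (rule smooth_map_collar_glue[OF VI f g, of "max q (p + d)"])
      (use par in \<open>auto simp: stretch_simps lift_simps\<close>)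
  then show ?thesis by (simp add: pushed_def[abs_def])
qed

lemma smooth_pushed_at:
  assumes "s \<in> {0..1}" shows "smooth_map V (V \<times>\<^sub>A interval (-1) 0) (pushed p d q s)"
proof -
  note E = smooth_atlas_euclid
  have "smooth_map V (euclid {0..1} \<times>\<^sub>A V) (\<lambda>x. (s, x))"
    by (intro smooth_map_Pair atlas_V E smooth_map_const smooth_map_ident) (use assms in \<open>simp add: points_euclid\<close>)
  from smooth_map_compose[OF atlas_V smooth_atlas_prod[OF E atlas_V]
      smooth_atlas_prod[OF atlas_V smooth_atlas_interval] this smooth_pushed]
  show ?thesis by simp
qed

text \<open>Compactness of \<open>V\<close> and the Hausdorff property turn injectivity into a
  topological embedding. For the immersion a killed vector is followed through the composition:
  \<iota> can be cancelled, and what remains is a question about the collar coordinates.\<close>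

lemma pushed_embedding:
  assumes N: "smooth_atlas N" "Hausdorff_space (mtop N)" and i: "smooth_embedding V N \<iota>" and s: "s \<in> {0..1}"
  shows "smooth_embedding V (N \<times>\<^sub>A interval (-1) 0) (\<lambda>x. (\<iota> (fst (pushed p d q s x)), snd (pushed p d q s x)))"
    (is "smooth_embedding _ _ ?F")
proof (rule smooth_embeddingI[OF atlas_V])
  note int = smooth_map_interval_euclid[of "-1" 0, simplified]
  note E = smooth_atlas_euclid and In = smooth_atlas_interval[of "-1" 0]
  have VI: "smooth_atlas (V \<times>\<^sub>A interval (-1) 0)" by (intro smooth_atlas_prod atlas_V In)
  show NI: "smooth_atlas (N \<times>\<^sub>A interval (-1) 0)" by (intro smooth_atlas_prod N In)
  have ism: "smooth_map V N \<iota>" using i by (simp add: smooth_embedding_def)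
  note P = smooth_pushed_at[OF s]
  have P1: "smooth_map V V (\<lambda>x. fst (pushed p d q s x))"
    by (rule smooth_map_compose[OF atlas_V VI atlas_V P smooth_map_fst[OF atlas_V In]])
  have P2: "smooth_map V (interval (-1) 0) (\<lambda>x. snd (pushed p d q s x))"
    by (rule smooth_map_compose[OF atlas_V VI In P smooth_map_snd[OF atlas_V In]])
  show F: "smooth_map V (N \<times>\<^sub>A interval (-1) 0) ?F"
    by (intro smooth_map_Pair atlas_V N In P2 smooth_map_compose[OF atlas_V atlas_V N(1) P1 ism])
  have "inj_on \<iota> (points V)"
    using i homeomorphic_imp_injective_map
    by (fastforce simp: smooth_embedding_def embedding_map_def topspace_mtop)
  then have "inj_on ?F (points V)"
    using pushed_inj[of s] s pushed_in(1)[of _ s] by (auto simp: inj_on_def prod_eq_iff)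
  moreover have "Hausdorff_space (mtop (N \<times>\<^sub>A interval (-1) 0))"
    by (simp add: mtop_prod[OF N(1) In] Hausdorff_space_prod_topology N(2) mtop_interval Hausdorff_space_subtopology)
  ultimately show "embedding_map (mtop V) (mtop (N \<times>\<^sub>A interval (-1) 0)) ?F"
    using continuous_imp_embedding_map[OF smooth_map_continuous[OF F] compact_V] by (simp add: topspace_mtop)
  fix A0 \<alpha> x v assume A0: "(A0, \<alpha>) \<in> V" "x \<in> A0" and v: "dker A0 \<alpha> (N \<times>\<^sub>A interval (-1) 0) ?F x v"
  note inj = smooth_atlasD(1)[OF atlas_V A0(1)]
  \<comment> \<open>The chart domain may be shrunk to any \<open>S\<close> around \<open>x\<close>;
    below it is the collar or an outer region where the page does not move sideways.\<close>
  have split: "dker (A0 \<inter> S) \<alpha> V (\<lambda>x. fst (pushed p d q s x)) x v \<and>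
      dker (A0 \<inter> S) \<alpha> (interval (-1) 0) (\<lambda>x. snd (pushed p d q s x)) x v"
    if S: "x \<in> S" for S
  proof -
    let ?M = "sub_atlas S V"
    have M: "smooth_atlas ?M" by (intro smooth_atlas_sub atlas_V)
    have v': "dker A0 \<alpha> N (\<lambda>x. \<iota> (fst (pushed p d q s x))) x v"
      using dker_compose[OF atlas_V NI N(1) F smooth_map_fst[OF N(1) In] A0 v] by simp
    have "dker A0 \<alpha> V (\<lambda>x. fst (pushed p d q s x)) x v"
      by (rule dker_immersion[OF atlas_V half_space_V atlas_V N(1) P1 i A0 v'])
    moreover have "dker A0 \<alpha> (interval (-1) 0) (\<lambda>x. snd (pushed p d q s x)) x v"
      using dker_compose[OF atlas_V NI In F smooth_map_snd[OF N(1) In] A0 v] by simp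
    ultimately show ?thesis using dker_shrink A0 S inj by metis
  qed
  show "v = 0"
  proof (cases "x \<in> C")
    case True
    let ?M = "sub_atlas C V" and ?A = "A0 \<inter> C"
    have A: "(?A, \<alpha>) \<in> ?M" "x \<in> ?A" using A0 True by (auto simp: mem_sub_atlas)
    have H: "half_space_charts ?M" by (rule half_space_charts_sub[OF atlas_V half_space_V openin_C])
    have inj': "inj_on \<alpha> ?A" using inj by (rule inj_on_subset) auto
    have y: "smooth_map ?M (sub_atlas BV V) (\<lambda>x. fst (cinv x))" and u: "smooth_map ?M (euclid I) (\<lambda>x. snd (cinv x))"
      using smooth_map_compose[OF atlas_C atlas_bdry_I atlas_bdry smooth_cinv smooth_map_fst[OF atlas_bdry E]]
        smooth_map_compose[OF atlas_C atlas_bdry_I E smooth_cinv smooth_map_snd[OF atlas_bdry E]] .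
    have inC: "fst (pushed p d q s z) \<in> C" if "z \<in> C" for z
      using pushed_in(2)[of z s] that s C_subset by auto
    have R: "smooth_map ?M ?M (\<lambda>x. fst (pushed p d q s x))"
      by (intro smooth_map_into_sub smooth_map_restrict atlas_V atlas_C P1) (use inC points_C in auto)
    obtain y0 u0 where yu: "y0 \<in> BV" "0 \<le> u0" "u0 < 1" "x = c (y0, u0)" "cinv x = (y0, u0)"
      using True by (rule C_cases)
    have "dker ?A \<alpha> ?M (\<lambda>x. fst (pushed p d q s x)) x v"
      by (rule dker_into_sub) (use split[OF True] inC True in auto)
    from dker_compose[OF atlas_C atlas_C atlas_bdry_I R smooth_cinv A this]
    have "dker ?A \<alpha> BVI (\<lambda>x. cinv (fst (pushed p d q s x))) x v" .
    then have k: "dker ?A \<alpha> BVI (\<lambda>x. (fst (cinv x), stretch p d s (snd (cinv x)))) x v"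
      by (rule dker_cong[OF _ A(2) inj']) (use cinv_pushed s in auto)
    have km: "smooth_map ?M BVI (\<lambda>x. (fst (cinv x), stretch p d s (snd (cinv x))))"
    proof (intro smooth_map_Pair atlas_C atlas_bdry E y)
      have "smooth_map ?M (euclid I) (\<lambda>x. snd (cinv (fst (pushed p d q s x))))"
        by (rule smooth_map_compose[OF atlas_C atlas_C E R u])
      then show "smooth_map ?M (euclid I) (\<lambda>x. stretch p d s (snd (cinv x)))"
        by (rule smooth_map_cong[OF atlas_C E]) (use cinv_pushed s points_C in auto)
    qed
    have ky: "dker ?A \<alpha> (sub_atlas BV V) (\<lambda>x. fst (cinv x)) x v"
      using dker_compose[OF atlas_C atlas_bdry_I atlas_bdry km smooth_map_fst[OF atlas_bdry E] A k] by simp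
    have ks: "dker ?A \<alpha> (euclid I) (\<lambda>x. stretch p d s (snd (cinv x))) x v"
      using dker_compose[OF atlas_C atlas_bdry_I E km smooth_map_snd[OF atlas_bdry E] A k] by simp
    have "dker ?A \<alpha> (euclid {-1..0}) (\<lambda>x. snd (pushed p d q s x)) x v"
      using dker_compose[OF atlas_C In E smooth_map_restrict[OF atlas_V In P2] int(1) A] split[OF True] by simp
    then have kl: "dker ?A \<alpha> (euclid {-1..0}) (\<lambda>x. lift q s (snd (cinv x))) x v"
      by (rule dker_cong[OF _ A(2) inj']) (auto simp: pushed_def)
    \<comment> \<open>The profile to cancel depends on the position: \<open>stretch\<close> off the
      collapsed segment, \<open>lift\<close> on it, where s = 1 and u0 \<le> p < q. Either way the
      distance coordinate kills \<open>v\<close>, and with the boundary coordinate so does all of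
      \<open>cinv\<close>.\<close>
    have "dker ?A \<alpha> (euclid I) (\<lambda>x. snd (cinv x)) x v"
    proof (cases "s < 1 \<or> p < u0")
      case True
      obtain D where "(stretch p d s has_real_derivative D) (at u0)" "D \<noteq> 0"
        using stretch_deriv[of p d s u0] par s yu True by auto
      then show ?thesis using yu by (intro dker_real_compose[OF atlas_C H u A _ _ ks]) auto
    next
      case False
      obtain D where "(lift q s has_real_derivative D) (at u0)" "D \<noteq> 0"
        using lift_deriv[of q s u0] par s yu False by auto
      then show ?thesis using yu by (intro dker_real_compose[OF atlas_C H u A _ _ kl]) auto
    qed
    from dker_Pair[OF ky this] have "dker ?A \<alpha> BVI cinv x v" by simp
    from dker_compose[OF atlas_C atlas_bdry_I atlas_C smooth_cinv smooth_c A this]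
    have "dker ?A \<alpha> ?M (\<lambda>x. c (cinv x)) x v" .
    then have "dker ?A \<alpha> ?M (\<lambda>x. x) x v" by (rule dker_cong[OF _ A(2) inj']) (auto simp: c_cinv)
    then show ?thesis by (rule dker_ident[OF atlas_C H A])
  next
    case False
    \<comment> \<open>Beyond max q (p + d) the first component of \<open>pushed\<close> is the
      identity, which kills no nonzero vector.\<close>
    define S where "S = points V - c ` (BV \<times> {0..max q (p + d)})"
    let ?M = "sub_atlas S V" and ?A = "A0 \<inter> S"
    have S: "openin (mtop V) S" unfolding S_def by (rule openin_outer) (use par in auto)
    have xS: "x \<in> S" using False c_in_C par chart_subset_points[OF A0(1)] A0(2) by (auto simp: S_def)
    have A: "(?A, \<alpha>) \<in> ?M" "x \<in> ?A" using A0 xS by (auto simp: mem_sub_atlas)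
    have inj': "inj_on \<alpha> ?A" using inj by (rule inj_on_subset) auto
    have eq: "fst (pushed p d q s z) = z" if z: "z \<in> S" for z
    proof (cases "z \<in> C")
      case True
      then obtain y u where yu: "y \<in> BV" "0 \<le> u" "u < 1" "z = c (y, u)" "cinv z = (y, u)" by (rule C_cases)
      then have "u > max q (p + d)" using z unfolding S_def by force
      then show ?thesis using yu par by (simp add: pushed_c stretch_simps)
    qed (simp add: pushed_out)
    have "dker ?A \<alpha> V (\<lambda>x. x) x v"
      by (rule dker_cong[OF conjunct1[OF split[OF xS]] A(2) inj']) (auto simp: eq)
    then have "dker ?A \<alpha> ?M (\<lambda>x. x) x v" using xS by (rule dker_into_sub)
    then show ?thesis
      by (rule dker_ident[OF smooth_atlas_sub[OF atlas_V] half_space_charts_sub[OF atlas_V half_space_V S] A])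
  qed
qed

end

text \<open>The additional conclusions are what the rotation argument uses: off the collar the page
  lies in level 0, while a collar point goes either over the binding or over a collar point into a
  level of [-1/2, 0].\<close>

lemma seifert_embedding_exists:
  assumes N: "smooth_atlas N" "Hausdorff_space (mtop N)" and i: "smooth_embedding V N \<iota>"
    and W: "openin (mtop (N \<times>\<^sub>A interval (-1) 0)) W" "\<iota> ` BV \<times> {0} \<subseteq> W"
  obtains h where "seifert_embedding N (-1) 0 V \<iota> W h" "\<And>x. x \<in> BV \<Longrightarrow> h x = (\<iota> x, -1)"
    "\<And>x. x \<in> points V \<Longrightarrow> x \<notin> C \<Longrightarrow> h x = (\<iota> x, 0)"
    "\<And>x. x \<in> C \<Longrightarrow> \<exists>x' t. h x = (\<iota> x', t) \<and> - 1 \<le> t \<and> t \<le> 0 \<and> (x' \<in> BV \<or> x' \<in> C \<and> - (1 / 2) \<le> t)"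
proof -
  note E = smooth_atlas_euclid and In = smooth_atlas_interval
  have ism: "smooth_map V N \<iota>" using i by (simp add: smooth_embedding_def)
  obtain e where e: "0 < e" "e \<le> 1 / 2"
    "\<And>y u t. y \<in> BV \<Longrightarrow> 0 \<le> u \<Longrightarrow> u < e \<Longrightarrow> - e < t \<Longrightarrow> t \<le> 0 \<Longrightarrow> (\<iota> (c (y, u)), t) \<in> W"
    by (rule rounding_neighbourhood[OF N(1) ism W]) (rule that)
  \<comment> \<open>The rounding extends horizontally less than q = e / 2 < e and, by the choice of
    \<open>p\<close>, vertically less than \<open>e\<close>, so it stays in \<open>W\<close>. Any
    positive \<open>d\<close> with p + d < 1 lets \<open>stretch\<close> return to the identity
    before the collar ends; half of the available room is taken.\<close>
  define q where "q = e / 2"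
  have q: "0 < q" "q < 1" "q < e" using e by (auto simp: q_def)
  obtain p where p: "0 < p" "p < q" "- e < lift q 1 p" by (rule lift_near_zero[OF q(1) e(1)]) (rule that)
  define d where "d = (1 - p) / 2"
  have d: "0 < d" "p + d < 1" using p q by (auto simp: d_def field_simps)
  note par = p(1,2) q(2) d
  define F where "F s x = (\<iota> (fst (pushed p d q s x)), snd (pushed p d q s x))" for s x
  define h where "h = F 1"
  have F_c: "F s (c (y, u)) = (\<iota> (c (y, stretch p d s u)), lift q s u)" if "y \<in> BV" "0 \<le> u" "u < 1" for s y u
    using that by (simp add: F_def pushed_c)
  have F_out: "F s x = (\<iota> x, s - 1)" if "x \<notin> C" for s x using that by (simp add: F_def pushed_out)
  have F_bdry: "F s x = (\<iota> x, - 1)" if "x \<in> BV" for s x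
    using F_c[of x 0 s] that par q by (simp add: c_0 stretch_simps lift_simps)
  have h_c: "h (c (y, u)) = (\<iota> (if u \<le> p then y else c (y, stretch p d 1 u)), lift q 1 u)"
    if "y \<in> BV" "0 \<le> u" "u < 1" for y u
    using that par F_c by (simp add: h_def stretch_simps c_0)
  have h_out: "h x = (\<iota> x, 0)" if "x \<notin> C" for x using that F_out by (simp add: h_def)
  have st: "0 \<le> stretch p d 1 u" "stretch p d 1 u \<le> u" if "0 \<le> u" for u
    using stretch_bounds[of p d 1 u] par that by auto
  have li: "- 1 \<le> lift q 1 u" "lift q 1 u \<le> 0" if "0 \<le> u" for u
    using lift_bounds[of q 1 u] q that by auto
  have li_mono: "lift q 1 u < lift q 1 v" if "0 \<le> u" "u < v" "u < q" for u v
    using lift_mono[of q 1 u v] q that by auto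
  have li_0: "lift q 1 u = 0" if "q \<le> u" for u using lift_simps(1)[OF q(1) that] by simp
  have iso: "isotopy_of_embeddings V (N \<times>\<^sub>A interval (-1) 0) F"
    unfolding isotopy_of_embeddings_def
  proof (intro conjI ballI)
    show "smooth_embedding V (N \<times>\<^sub>A interval (-1) 0) (F s)" if "s \<in> {0..1}" for s
      using pushed_embedding[OF par(1,2,3,4,5) N i that] by (simp add: F_def[abs_def])
    have IV: "smooth_atlas (interval 0 1 \<times>\<^sub>A V)" and EV: "smooth_atlas (euclid {0..1} \<times>\<^sub>A V)"
      and VI: "smooth_atlas (V \<times>\<^sub>A interval (-1) 0)"
      by (intro smooth_atlas_prod atlas_V In E)+
    have "smooth_map (interval 0 1 \<times>\<^sub>A V) (euclid {0..1} \<times>\<^sub>A V) (\<lambda>z. (fst z, snd z))"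
      by (intro smooth_map_Pair IV E atlas_V smooth_map_snd In
          smooth_map_compose[OF IV In E smooth_map_fst[OF In atlas_V]] smooth_map_interval_euclid) auto
    from smooth_map_compose[OF IV EV VI this smooth_pushed[OF par]]
    have P: "smooth_map (interval 0 1 \<times>\<^sub>A V) (V \<times>\<^sub>A interval (-1) 0) (\<lambda>z. pushed p d q (fst z) (snd z))"
      by (simp add: case_prod_unfold)
    have "smooth_map (interval 0 1 \<times>\<^sub>A V) N (\<lambda>z. \<iota> (fst (pushed p d q (fst z) (snd z))))"
      by (rule smooth_map_compose[OF IV atlas_V N(1) smooth_map_compose[OF IV VI atlas_V P smooth_map_fst[OF atlas_V In]] ism])
    from smooth_map_Pair[OF IV N(1) In this smooth_map_compose[OF IV VI In P smooth_map_snd[OF atlas_V In]]]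
    show "smooth_map (interval 0 1 \<times>\<^sub>A V) (N \<times>\<^sub>A interval (-1) 0) (\<lambda>(s, x). F s x)"
      by (simp add: F_def case_prod_unfold)
  qed
  have F0: "F 0 x = (\<iota> x, - 1)" if "x \<in> points V" for x
  proof (cases "x \<in> C")
    case True
    then obtain y u where "y \<in> BV" "0 \<le> u" "u < 1" "x = c (y, u)" "cinv x = (y, u)" by (rule C_cases)
    then show ?thesis using F_c par q by (simp add: stretch_simps lift_simps)
  qed (simp add: F_out)
  have interior: "h x \<in> points N \<times> {-1<..0}" if x: "x \<in> points V - BV" for x
  proof (cases "x \<in> C")
    case True
    then obtain y u where yu: "y \<in> BV" "0 \<le> u" "u < 1" "x = c (y, u)" "cinv x = (y, u)" by (rule C_cases)
    have "u \<noteq> 0" using yu x c_0 by auto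
    then have "lift q 1 0 < lift q 1 u" using q yu by (intro li_mono) auto
    then have "- 1 < lift q 1 u" by (simp add: lift_simps[OF q(1)])
    moreover have "(if u \<le> p then y else c (y, stretch p d 1 u)) \<in> points V"
      using yu st[OF yu(2)] by (intro subsetD[OF C_subset]) (simp add: c_in_C bdry_C(1))
    ultimately show ?thesis
      using li[OF yu(2)] smooth_map_funcset[OF ism] yu h_c by auto
  qed (use x h_out smooth_map_funcset[OF ism] in auto)
  have range: "h x \<in> \<iota> ` points V \<times> {-1..0}" if x: "x \<in> points V" for x
    using pushed_in(1,3)[OF par x, of 1] by (auto simp: h_def F_def)
  have c_im: "x = c (y, u) \<Longrightarrow> y \<in> BV \<Longrightarrow> 0 \<le> u \<Longrightarrow> u < 1 \<Longrightarrow> x \<in> points V" for x y u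
    using c_in_C C_subset by blast
  have image: "h ` points V - W = (\<iota> ` BV \<times> {-1..0} \<union> \<iota> ` points V \<times> {0}) - W"
  proof (intro subset_antisym subsetI)
    fix z assume z: "z \<in> h ` points V - W"
    then obtain x where x: "x \<in> points V" "z = h x" "h x \<notin> W" by blast
    show "z \<in> (\<iota> ` BV \<times> {-1..0} \<union> \<iota> ` points V \<times> {0}) - W"
    proof (cases "x \<in> C")
      case True
      then obtain y u where yu: "y \<in> BV" "0 \<le> u" "u < 1" "x = c (y, u)" "cinv x = (y, u)" by (rule C_cases)
      \<comment> \<open>The vertical wall, the rounded corner, which lies in \<open>W\<close>, and
        the part at level 0.\<close>
      consider "u \<le> p" | "p < u" "u < q" | "q \<le> u" by linarith
      then show ?thesis
      proof cases
        case 1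
        then show ?thesis using x yu h_c li by auto
      next
        case 2
        have "(\<iota> (c (y, stretch p d 1 u)), lift q 1 u) \<in> W"
          using 2 yu st[OF yu(2)] li[OF yu(2)] li_mono[of p u] p q by (intro e(3)) auto
        then show ?thesis using x yu h_c 2 by simp
      next
        case 3
        then show ?thesis using range[OF x(1)] x yu h_c li_0 by auto
      qed
    qed (use x h_out in auto)
  next
    fix z assume z: "z \<in> (\<iota> ` BV \<times> {-1..0} \<union> \<iota> ` points V \<times> {0}) - W"
    consider y t where "y \<in> BV" "z = (\<iota> y, t)" "-1 \<le> t" "t \<le> 0"
      | x where "x \<in> points V" "x \<notin> C" "z = (\<iota> x, 0)"
      | x where "x \<in> C" "z = (\<iota> x, 0)" using z by auto
    then have "z \<in> h ` points V"
    proof cases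
      case 1
      \<comment> \<open>By the choice of \<open>e\<close>, used with u = 0, a wall point outside
        \<open>W\<close> has level at most - e, hence lies below the level at \<open>p\<close>. The
        parameter found for its level is therefore on the collapsed segment.\<close>
      then have t: "t \<le> - e" using e(3)[of y 0 t] z e(1) c_0 by force
      have "\<exists>u\<ge>0. u \<le> q \<and> lift q 1 u = t"
      proof (rule IVT)
        show "lift q 1 0 \<le> t" "t \<le> lift q 1 q" "0 \<le> q" using 1 q li_0 by (auto simp: lift_simps)
        show "\<forall>u. 0 \<le> u \<and> u \<le> q \<longrightarrow> isCont (lift q 1) u"
          using lift_deriv[of q 1] q DERIV_isCont by fastforce
      qed
      then obtain u where u: "0 \<le> u" "u \<le> q" "lift q 1 u = t" by blast
      have "\<not> p < u" using li_mono[of p u] p t u by auto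
      then have "h (c (y, u)) = z" using 1 u h_c q by simp
      then show ?thesis using c_im[OF refl, of y u] 1 u q by force
    next
      case 2
      then show ?thesis using h_out by force
    next
      case 3
      obtain y v where yv: "y \<in> BV" "0 \<le> v" "v < 1" "x = c (y, v)" "cinv x = (y, v)" using 3(1) by (rule C_cases)
      have v: "e \<le> v" using e(3)[of y v 0] yv z 3 e(1) by force
      \<comment> \<open>At \<open>m\<close> the map \<open>stretch\<close> is the identity and has
        reached \<open>v\<close>, which bounds the range for the intermediate value theorem. A
        solution satisfies u \<ge> v \<ge> e > q and so lies at level 0.\<close>
      define m where "m = max v (p + d)"
      have "\<exists>u\<ge>0. u \<le> m \<and> stretch p d 1 u = v"
      proof (rule IVT)
        show "stretch p d 1 0 \<le> v" "v \<le> stretch p d 1 m" "0 \<le> m" using yv par by (auto simp: stretch_simps m_def)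
        show "\<forall>u. 0 \<le> u \<and> u \<le> m \<longrightarrow> isCont (stretch p d 1) u"
          using stretch_deriv[of p d 1] par DERIV_isCont by fastforce
      qed
      then obtain u where u: "0 \<le> u" "u \<le> m" "stretch p d 1 u = v" by blast
      have u': "e \<le> u" "u < 1" using st(2)[OF u(1)] u v yv par by (auto simp: m_def)
      then have "h (c (y, u)) = z" using 3 u yv h_c[of y u] li_0 q p by simp
      then show ?thesis using c_im[OF refl, of y u] yv u u' by force
    qed
    then show "z \<in> h ` points V - W" using z by blast
  qed
  have "seifert_embedding N (-1) 0 V \<iota> W h"
    unfolding seifert_embedding_def
  proof (intro conjI exI[of _ F])
    show "\<forall>x\<in>points V. F 0 x = (\<iota> x, - 1) \<and> F 1 x = h x" using F0 by (simp add: h_def)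
    show "h ` (points V - BV) \<subseteq> points N \<times> {-1<..0}" using interior by (rule image_subsetI)
    show "h ` points V \<subseteq> \<iota> ` points V \<times> {-1..0}" using range by (rule image_subsetI)
  qed (use iso F_bdry image in auto)
  moreover have "\<exists>x' t. h x = (\<iota> x', t) \<and> - 1 \<le> t \<and> t \<le> 0 \<and> (x' \<in> BV \<or> x' \<in> C \<and> - (1 / 2) \<le> t)"
    if xC: "x \<in> C" for x
  proof -
    obtain y u where yu: "y \<in> BV" "0 \<le> u" "u < 1" "x = c (y, u)" "cinv x = (y, u)" using xC by (rule C_cases)
    show ?thesis
    proof (cases "u \<le> p")
      case True
      then show ?thesis using yu h_c li by auto
    next
      case False
      then have "- (1 / 2) \<le> lift q 1 u" using li_mono[of p u] p e by auto
      moreover have "c (y, stretch p d 1 u) \<in> C" using yu st[OF yu(2)] by (intro c_in_C) auto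
      ultimately show ?thesis using yu h_c li False by auto
    qed
  qed
  ultimately show ?thesis
    using that[of h] F_bdry h_out by (auto simp: h_def)
qed

end

subsection \<open>Atlases transported by a diffeomorphism\<close>

text \<open>Used for the open book in place of computing transition maps across the gluing. Read in
  charts, \<Psi> is a continuous injection from a relatively open subset of an affine space of
  dimension at least that of \<open>N\<close>. Invariance of domain then makes the chart domains
  open, and transitions factor through charts of \<open>N\<close>.\<close>

lemma smooth_atlas_if_diffeo:
  fixes Q :: "('b, 'e::euclidean_space) atlas" and N :: "('a, 'f::euclidean_space) atlas"
  assumes N: "smooth_atlas N" and \<Psi>: "diffeo Q N \<Psi>"
    and inj: "\<And>D \<xi>. (D, \<xi>) \<in> Q \<Longrightarrow> inj_on \<xi> D"
    and dim: "\<And>D \<xi>. (D, \<xi>) \<in> Q \<Longrightarrow> \<exists>A. affine A \<and> int DIM('f) \<le> aff_dim A \<and> openin (top_of_set A) (\<xi> ` D)"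
  shows "smooth_atlas Q"
proof -
  have bij: "bij_betw \<Psi> (points Q) (points N)" and sm: "smooth_map Q N \<Psi>"
    and sm': "smooth_map N Q (inv_into (points Q) \<Psi>)"
    using \<Psi> by (auto simp: diffeo_def)
  have inj\<Psi>: "inj_on \<Psi> (points Q)" using bij by (simp add: bij_betw_def)
  have pre: "openin (mtop Q) {q \<in> points Q. \<Psi> q \<in> S}" if "openin (mtop N) S" for S
    using openin_continuous_map_preimage[OF smooth_map_continuous[OF sm] that] by (simp add: topspace_mtop)
  have imageD: "openin (mtop N) (\<Psi> ` D)" if D: "(D, \<xi>) \<in> Q" for D \<xi>
  proof (rule openin_mtopI)
    have DQ: "D \<subseteq> points Q" using chart_subset_points[OF D] .
    then show "\<Psi> ` D \<subseteq> points N" using bij by (auto simp: bij_betw_def)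
    fix P \<pi> assume P: "(P, \<pi>) \<in> N"
    obtain W where W: "open W" "\<And>q. q \<in> D \<Longrightarrow> q \<in> {q \<in> points Q. \<Psi> q \<in> P} \<longleftrightarrow> \<xi> q \<in> W"
      by (rule openin_mtop_chartE[OF pre[OF smooth_atlasD(2)[OF N P]] D]) (rule that)
    have eq: "\<xi> ` (D \<inter> \<Psi> -` P) = \<xi> ` D \<inter> W" using W(2) DQ by auto
    obtain A where A: "affine A" "int DIM('f) \<le> aff_dim A" "openin (top_of_set A) (\<xi> ` D)" using dim[OF D] by metis
    define g where "g = \<pi> \<circ> \<Psi> \<circ> inv_into D \<xi>"
    have g: "g (\<xi> q) = \<pi> (\<Psi> q)" if "q \<in> D" for q using inj[OF D] that by (simp add: g_def)
    have "openin (top_of_set (UNIV :: 'f set)) (g ` (\<xi> ` (D \<inter> \<Psi> -` P)))"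
    proof (rule invariance_of_domain_affine_sets)
      show "openin (top_of_set A) (\<xi> ` (D \<inter> \<Psi> -` P))" unfolding eq by (rule openin_Int_open[OF A(3) W(1)])
      show "continuous_on (\<xi> ` (D \<inter> \<Psi> -` P)) g"
        unfolding g_def by (rule smooth_on_continuous[OF smooth_map_charts[OF sm D P]])
      show "inj_on g (\<xi> ` (D \<inter> \<Psi> -` P))"
      proof (rule inj_onI)
        fix a b assume ab: "a \<in> \<xi> ` (D \<inter> \<Psi> -` P)" "b \<in> \<xi> ` (D \<inter> \<Psi> -` P)" "g a = g b"
        obtain q where q: "q \<in> D" "\<Psi> q \<in> P" "a = \<xi> q" using ab(1) by blast
        obtain q' where q': "q' \<in> D" "\<Psi> q' \<in> P" "b = \<xi> q'" using ab(2) by blast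
        have "\<pi> (\<Psi> q) = \<pi> (\<Psi> q')" using ab(3) q q' g by simp
        then have "\<Psi> q = \<Psi> q'" using q q' smooth_atlasD(1)[OF N P] by (simp add: inj_on_def)
        then have "q = q'" using q q' inj\<Psi> DQ by (meson inj_onD subsetD)
        then show "a = b" using q q' by simp
      qed
    qed (use A in \<open>auto simp: aff_dim_UNIV\<close>)
    then have "open (g ` (\<xi> ` (D \<inter> \<Psi> -` P)))" by (simp add: openin_open)
    moreover have "y \<in> \<Psi> ` D \<longleftrightarrow> \<pi> y \<in> g ` (\<xi> ` (D \<inter> \<Psi> -` P))" if y: "y \<in> P" for y
    proof
      assume "y \<in> \<Psi> ` D"
      then obtain q where "q \<in> D" "y = \<Psi> q" by blast
      then show "\<pi> y \<in> g ` (\<xi> ` (D \<inter> \<Psi> -` P))" using g[of q] y by force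
    next
      assume "\<pi> y \<in> g ` (\<xi> ` (D \<inter> \<Psi> -` P))"
      then obtain q where "q \<in> D" "\<Psi> q \<in> P" "\<pi> y = \<pi> (\<Psi> q)" using g by auto
      then show "y \<in> \<Psi> ` D" using smooth_atlasD(1)[OF N P] y by (auto simp: inj_on_def)
    qed
    ultimately show "\<exists>W. open W \<and> (\<forall>y\<in>P. y \<in> \<Psi> ` D \<longleftrightarrow> \<pi> y \<in> W)"
      by (intro exI[of _ "g ` (\<xi> ` (D \<inter> \<Psi> -` P))"] conjI ballI)
  qed
  have openD: "openin (mtop Q) D" if D: "(D, \<xi>) \<in> Q" for D \<xi>
  proof -
    have "{q \<in> points Q. \<Psi> q \<in> \<Psi> ` D} = D"
      using inj\<Psi> chart_subset_points[OF D] by (auto simp: inj_on_def subset_iff)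
    then show ?thesis using pre[OF imageD[OF D]] by simp
  qed
  show ?thesis
    unfolding smooth_atlas_def
  proof (intro conjI allI impI inj)
    show "openin (mtop Q) D" if "(D, \<xi>) \<in> Q" for D \<xi> using openD[OF that] .
    fix D \<xi> D' \<xi>' assume D: "(D, \<xi>) \<in> Q" and D': "(D', \<xi>') \<in> Q"
    show "smooth_on (\<xi> ` (D \<inter> D')) (\<xi>' \<circ> inv_into D \<xi>)"
    proof (rule smooth_on_local)
      fix e assume "e \<in> \<xi> ` (D \<inter> D')"
      then obtain q where q: "q \<in> D" "q \<in> D'" "e = \<xi> q" by blast
      have qQ: "q \<in> points Q" using chart_subset_points[OF D] q by blast
      obtain P \<pi> where P: "(P, \<pi>) \<in> N" "\<Psi> q \<in> P" using smooth_map_funcset[OF sm qQ] by (rule pointsE)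
      obtain W where W: "open W" "\<And>q. q \<in> D \<Longrightarrow> q \<in> {q \<in> points Q. \<Psi> q \<in> P} \<longleftrightarrow> \<xi> q \<in> W"
        by (rule openin_mtop_chartE[OF pre[OF smooth_atlasD(2)[OF N P(1)]] D]) (rule that)
      let ?S = "\<xi> ` (D \<inter> D') \<inter> W" and ?\<Phi> = "inv_into (points Q) \<Psi>"
      have S: "\<exists>q. q \<in> D \<and> q \<in> D' \<and> \<Psi> q \<in> P \<and> e = \<xi> q \<and> ?\<Phi> (\<Psi> q) = q \<and> inv_into D \<xi> e = q
          \<and> inv_into P \<pi> (\<pi> (\<Psi> q)) = \<Psi> q" if "e \<in> ?S" for e
      proof -
        obtain q where q: "q \<in> D" "q \<in> D'" "e = \<xi> q" "\<xi> q \<in> W" using \<open>e \<in> ?S\<close> by blast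
        then have "\<Psi> q \<in> P" "q \<in> points Q" using W(2)[of q] by auto
        then show ?thesis using q inj[OF D] inj\<Psi> smooth_atlasD(1)[OF N P(1)] by (intro exI[of _ q]) auto
      qed
      have "smooth_on ?S (\<pi> \<circ> \<Psi> \<circ> inv_into D \<xi>)"
        by (rule smooth_on_subset[OF smooth_map_charts[OF sm D P(1)]]) (use S in blast)
      \<comment> \<open>Forward by \<pi> after \<Psi>, back by the smooth inverse of \<Psi>: the
        composite is the transition map.\<close>
      then have "smooth_on ?S (\<lambda>e. (\<xi>' \<circ> ?\<Phi> \<circ> inv_into P \<pi>) ((\<pi> \<circ> \<Psi> \<circ> inv_into D \<xi>) e))"
        by (rule smooth_on_compose[OF _ smooth_map_charts[OF sm' P(1) D']]) (use S in fastforce)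
      then have "smooth_on ?S (\<xi>' \<circ> inv_into D \<xi>)"
        by (rule smooth_on_cong) (use S in fastforce)
      moreover have "e \<in> W" using W(2)[of q] q qQ P by auto
      ultimately show "\<exists>W. open W \<and> e \<in> W \<and> smooth_on (\<xi> ` (D \<inter> D') \<inter> W) (\<xi>' \<circ> inv_into D \<xi>)"
        using W(1) by blast
    qed
  qed
qed

subsection \<open>Rotating an open book\<close>


lemma mem_push_atlas:
  "(D, \<xi>) \<in> push_atlas f M \<longleftrightarrow> (\<exists>U \<kappa>. (U, \<kappa>) \<in> M \<and> D = f ` U \<and> \<xi> = \<kappa> \<circ> inv_into U f)"
proof
  assume "(D, \<xi>) \<in> push_atlas f M"
  then obtain p where "(D, \<xi>) = (case p of (U, \<kappa>) \<Rightarrow> (f ` U, \<kappa> \<circ> inv_into U f))" "p \<in> M"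
    unfolding push_atlas_def by (rule imageE)
  then obtain U \<kappa> where "(U, \<kappa>) \<in> M" "(D, \<xi>) = (f ` U, \<kappa> \<circ> inv_into U f)"
    by (cases p) simp
  then show "\<exists>U \<kappa>. (U, \<kappa>) \<in> M \<and> D = f ` U \<and> \<xi> = \<kappa> \<circ> inv_into U f" by (intro exI[of _ U] exI[of _ \<kappa>]) simp
next
  assume "\<exists>U \<kappa>. (U, \<kappa>) \<in> M \<and> D = f ` U \<and> \<xi> = \<kappa> \<circ> inv_into U f"
  then obtain U \<kappa> where "(U, \<kappa>) \<in> M" "(D, \<xi>) = (f ` U, \<kappa> \<circ> inv_into U f)" by blast
  then show "(D, \<xi>) \<in> push_atlas f M"
    unfolding push_atlas_def using image_eqI[of "(D, \<xi>)" "\<lambda>(U, \<kappa>). (f ` U, \<kappa> \<circ> inv_into U f)" "(U, \<kappa>)" M] by simp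
qed

text \<open>Rotation about the binding by the angle 2\<pi>\<tau>. A class of the mapping torus is a
  set of pairs, so the flow is defined by translating the whole set, without a choice of
  representative.\<close>

fun rot :: "real \<Rightarrow> ('v \<times> real) set + 'v \<times> complex \<Rightarrow> ('v \<times> real) set + 'v \<times> complex"
  where "rot \<tau> (Inl K) = Inl ((\<lambda>(x, t). (x, t + \<tau>)) ` K)"
  | "rot \<tau> (Inr (x, z)) = Inr (x, cis (2 * pi * \<tau>) * z)"

lemma rot_rot: "rot s (rot t q) = rot (s + t) q"
proof (cases q)
  case (Inl K)
  then show ?thesis by (simp add: image_image case_prod_unfold add_ac)
next
  case (Inr p)
  then show ?thesis by (cases p) (simp add: cis_mult mult.assoc[symmetric] distrib_left)
qed

lemma rot_0: "rot 0 q = q"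
proof (cases q)
  case (Inr p)
  then show ?thesis by (cases p) simp
qed simp

text \<open>The gluing relation depends only on the difference of the times, so translating a class
  gives the class of the translated point.\<close>

lemma rot_mt_class: "rot \<tau> (Inl (mt_class V \<phi> (x, t))) = Inl (mt_class V \<phi> (x, t + \<tau>))"
proof -
  have "(y, s) \<in> (\<lambda>(x, t). (x, t + \<tau>)) ` mt_class V \<phi> (x, t) \<longleftrightarrow> (y, s) \<in> mt_class V \<phi> (x, t + \<tau>)" for y s
  proof -
    have "(y, s) \<in> (\<lambda>(x, t). (x, t + \<tau>)) ` mt_class V \<phi> (x, t) \<longleftrightarrow> (y, s - \<tau>) \<in> mt_class V \<phi> (x, t)"
      by (force simp: image_iff)
    also have "\<dots> \<longleftrightarrow> (y, s) \<in> mt_class V \<phi> (x, t + \<tau>)"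
      by (simp add: mt_class_def algebra_simps)
    finally show ?thesis .
  qed
  then have "(\<lambda>(x, t). (x, t + \<tau>)) ` mt_class V \<phi> (x, t) = mt_class V \<phi> (x, t + \<tau>)"
    by (intro set_eqI) (metis surj_pair)
  then show ?thesis by simp
qed

locale open_book_page = collared V c for V :: "('v, 'e::euclidean_space) atlas" and c +
  fixes \<phi> :: "'v \<Rightarrow> 'v"
  assumes diffeo_\<phi>: "diffeo V V \<phi>" and \<phi>_C: "x \<in> C \<Longrightarrow> \<phi> x = x"
begin

abbreviation "mt x t \<equiv> mt_class V \<phi> (x, t)"
abbreviation "OB \<equiv> open_book V \<phi> c"
abbreviation "cl \<equiv> mt_class V \<phi>"
abbreviation "MT \<equiv> mapping_torus V \<phi>"
abbreviation "tb \<equiv> tube V \<phi> c"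
abbreviation "J a \<equiv> {a<..<a + 1::real}"

section \<open>Equality of classes in the mapping torus\<close>

lemma \<phi>_in: "x \<in> points V \<Longrightarrow> \<phi> x \<in> points V"
  and \<phi>_eq: "x \<in> points V \<Longrightarrow> y \<in> points V \<Longrightarrow> \<phi> x = \<phi> y \<longleftrightarrow> x = y"
  using diffeo_\<phi> by (auto simp: diffeo_def bij_betw_def inj_on_def)

lemma \<phi>_pow_in: "x \<in> points V \<Longrightarrow> (\<phi> ^^ k) x \<in> points V"
  by (induction k) (auto intro: \<phi>_in)

lemma \<phi>_pow_eq: "x \<in> points V \<Longrightarrow> y \<in> points V \<Longrightarrow> (\<phi> ^^ k) x = (\<phi> ^^ k) y \<longleftrightarrow> x = y"
  by (induction k) (auto simp: \<phi>_eq \<phi>_pow_in)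

lemma \<phi>_pow_C: "x \<in> C \<Longrightarrow> (\<phi> ^^ k) x = x"
  by (induction k) (auto simp: \<phi>_C)

lemma mt_mem: "(y, s) \<in> mt x t \<longleftrightarrow> y \<in> points V \<and>
    (\<exists>k::nat. (s = t + real k \<and> (\<phi> ^^ k) y = x) \<or> (t = s + real k \<and> (\<phi> ^^ k) x = y))"
  by (simp add: mt_class_def)

lemma mt_self: "x \<in> points V \<Longrightarrow> (x, t) \<in> mt x t"
  unfolding mt_mem by (auto intro!: exI[of _ 0])

text \<open>The times of equivalent points differ by an integer, the number of applications of
  \<phi>; a gap smaller than 1 forces it to be 0.\<close>

lemma mt_eqD:
  assumes "x \<in> points V" "mt x t = mt x' t'" "\<bar>t - t'\<bar> < 1"
  shows "x = x'" "t = t'"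
proof -
  have "(x, t) \<in> mt x' t'" using mt_self[OF assms(1), of t] assms(2) by simp
  then obtain k :: nat where "(t = t' + real k \<and> (\<phi> ^^ k) x = x') \<or> (t' = t + real k \<and> (\<phi> ^^ k) x' = x)"
    unfolding mt_mem by blast
  moreover from this have "k = 0" using assms(3) by auto
  ultimately show "x = x'" "t = t'" by auto
qed

text \<open>The times are arbitrary here; instead, all powers of \<phi> are injective and fix the
  boundary point.\<close>

lemma mt_eq_bdry:
  assumes "x \<in> points V" "x' \<in> BV" "mt x t = mt x' t'"
  shows "x = x'"
proof -
  have "(x, t) \<in> mt x' t'" using mt_self[OF assms(1), of t] assms(3) by simp
  then obtain k :: nat where "(\<phi> ^^ k) x = x' \<or> (\<phi> ^^ k) x' = x" unfolding mt_mem by blast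
  moreover have x': "(\<phi> ^^ k) x' = x'" using \<phi>_pow_C bdry_C assms(2) by blast
  ultimately show ?thesis using \<phi>_pow_eq[of x x' k] assms bdry_subset[of V] by auto
qed

text \<open>The monodromy enters here: advancing time by one full turn amounts to applying \<phi>.
  Together with \<open>rot_mt_class\<close> this computes the full rotation of a page.\<close>

lemma mt_shift:
  assumes x: "x \<in> points V" shows "mt x (t + 1) = mt (\<phi> x) t"
proof -
  have "(y, s) \<in> mt x (t + 1) \<longleftrightarrow> (y, s) \<in> mt (\<phi> x) t" if y: "y \<in> points V" for y s
  proof
    assume "(y, s) \<in> mt x (t + 1)"
    then obtain k :: nat where "s = t + 1 + real k \<and> (\<phi> ^^ k) y = x \<or> t + 1 = s + real k \<and> (\<phi> ^^ k) x = y"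
      unfolding mt_mem by blast
    then show "(y, s) \<in> mt (\<phi> x) t"
    proof
      assume a: "s = t + 1 + real k \<and> (\<phi> ^^ k) y = x"
      then show ?thesis unfolding mt_mem using y by (intro conjI exI[of _ "Suc k"]) auto
    next
      assume a: "t + 1 = s + real k \<and> (\<phi> ^^ k) x = y"
      show ?thesis
      \<comment> \<open>An exponent 0 changes sides: s = t + 1 is ahead of t by one, and the witness
        is the exponent 1 in the first alternative.\<close>
      proof (cases k)
        case 0
        then show ?thesis unfolding mt_mem using y a by (intro conjI exI[of _ "Suc 0"]) auto
      next
        case (Suc m)
        then show ?thesis unfolding mt_mem using y a
          by (intro conjI exI[of _ m]) (auto simp: funpow_swap1)
      qed
    qed
  next
    assume "(y, s) \<in> mt (\<phi> x) t"
    then obtain k :: nat where "s = t + real k \<and> (\<phi> ^^ k) y = \<phi> x \<or> t = s + real k \<and> (\<phi> ^^ k) (\<phi> x) = y"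
      unfolding mt_mem by blast
    then show "(y, s) \<in> mt x (t + 1)"
    proof
      assume a: "s = t + real k \<and> (\<phi> ^^ k) y = \<phi> x"
      show ?thesis
      proof (cases k)
        case 0
        then show ?thesis unfolding mt_mem using y a by (intro conjI exI[of _ "Suc 0"]) auto
      next
        case (Suc m)
        then have "(\<phi> ^^ m) y = x" using a \<phi>_eq[OF \<phi>_pow_in[OF y] x] by simp
        then show ?thesis unfolding mt_mem using y a Suc by (intro conjI exI[of _ m]) auto
      qed
    next
      assume a: "t = s + real k \<and> (\<phi> ^^ k) (\<phi> x) = y"
      then show ?thesis unfolding mt_mem using y by (intro conjI exI[of _ "Suc k"]) (auto simp: funpow_swap1)
    qed
  qed
  moreover have "y \<in> points V" if "(y, s) \<in> mt x' t'" for y s x' t' using that unfolding mt_mem by blast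
  ultimately show ?thesis by (auto simp del: mt_class_def) blast+
qed

lemma mt_int_shift:
  assumes x: "x \<in> C" shows "mt x (t + of_int n) = mt x t"
proof -
  have 1: "mt x (t + 1) = mt x t" for t using mt_shift[of x t] x \<phi>_C C_subset by auto
  have nat: "mt x (t + real k) = mt x t" for t k
  proof (induction k)
    case (Suc k)
    then show ?case using 1[of "t + real k"] by (simp add: add_ac)
  qed simp
  show ?thesis
  proof (cases "n \<ge> 0")
    case True
    then show ?thesis using nat[of t "nat n"] by simp
  next
    case False
    then show ?thesis using nat[of "t + of_int n" "nat (- n)"] by simp
  qed
qed

text \<open>\<open>Arg2pi\<close> recovers the angle only up to multiples of 2\<pi>. Over the collar
  \<phi> is the identity, so integer shifts of time do not change the class, and \<open>tube\<close>
  may be evaluated with any real angle.\<close>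

lemma tube_rcis:
  assumes "x \<in> BV" "1 \<le> r" "r < 2"
  shows "tube V \<phi> c (x, rcis r (2 * pi * t)) = Inl (mt (c (x, r - 1)) t)"
proof -
  let ?z = "rcis r (2 * pi * t)"
  have n: "norm ?z = r" using assms by simp
  have "?z = of_real r * exp (\<i> * of_real (Arg2pi ?z))" using Arg2pi[of ?z] n by (simp add: is_Arg_def)
  then have "exp (\<i> * of_real (Arg2pi ?z)) = exp (\<i> * of_real (2 * pi * t))"
    using assms by (simp add: rcis_def cis_conv_exp)
  then obtain m :: int where "\<i> * of_real (Arg2pi ?z) = \<i> * of_real (2 * pi * t) + of_real (of_int (2 * m) * pi) * \<i>"
    unfolding exp_eq by blast
  then have "\<i> * of_real (Arg2pi ?z) = \<i> * of_real (2 * pi * t + 2 * pi * m)" by (simp add: algebra_simps)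
  then have "Arg2pi ?z = 2 * pi * t + 2 * pi * m" by (metis complex_i_not_zero mult_left_cancel of_real_eq_iff)
  then have a: "Arg2pi ?z / (2 * pi) = t + m" by (simp add: field_simps)
  have "c (x, r - 1) \<in> C" using assms by (intro c_in_C) auto
  then show ?thesis using assms n a by (simp add: tube_def mt_int_shift)
qed

lemma rcis_Arg2pi: "z = rcis (norm z) (2 * pi * (Arg2pi z / (2 * pi)))"
  using Arg2pi[of z] by (simp add: rcis_def cis_conv_exp is_Arg_def)

text \<open>Reconciles the two clauses of \<open>rot\<close> across the gluing: inside the unit disc
  it is multiplication by a unit complex number, outside it adds \<tau> to the time, and in polar
  form both rotate the disc of radius 2.\<close>

lemma rot_tube:
  assumes "x \<in> BV" "norm z < 2"
  shows "rot \<tau> (tube V \<phi> c (x, z)) = tube V \<phi> c (x, cis (2 * pi * \<tau>) * z)"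
proof (cases "norm z < 1")
  case True
  then show ?thesis by (simp add: tube_def norm_mult)
next
  case False
  define r t where "r = norm z" and "t = Arg2pi z / (2 * pi)"
  have z: "z = rcis r (2 * pi * t)" unfolding r_def t_def by (rule rcis_Arg2pi)
  have "cis (2 * pi * \<tau>) * z = rcis r (2 * pi * (t + \<tau>))"
    unfolding z by (simp add: rcis_def cis_mult algebra_simps)
  moreover have "1 \<le> r" "r < 2" using assms False by (auto simp: r_def)
  ultimately show ?thesis
    unfolding z using assms by (simp add: tube_rcis rot_mt_class del: rot.simps)
qed

text \<open>\<open>Inr\<close> and \<open>Inl\<close> separate the open unit disc from the rest. On
  the rest the normalized arguments lie in [0, 1), so they differ by less than 1 and
  \<open>mt_eqD\<close> applies; injectivity of the collar recovers the modulus.\<close>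

lemma tube_inj: "inj_on (tube V \<phi> c) (BV \<times> ball 0 2)"
proof (rule inj_onI)
  fix p p' assume "p \<in> BV \<times> ball 0 2" "p' \<in> BV \<times> ball 0 2" and eq: "tube V \<phi> c p = tube V \<phi> c p'"
  then obtain x z x' z' where p: "p = (x, z)" "p' = (x', z')" "x \<in> BV" "x' \<in> BV" "norm z < 2" "norm z' < 2"
    by auto
  show "p = p'"
  proof (cases "norm z < 1 \<or> norm z' < 1")
    case True
    then show ?thesis using eq p by (auto simp: tube_def split: if_splits)
  next
    case False
    then have "mt (c (x, norm z - 1)) (Arg2pi z / (2 * pi)) = mt (c (x', norm z' - 1)) (Arg2pi z' / (2 * pi))"
      using eq p by (simp add: tube_def)
    moreover have in1: "c (x, norm z - 1) \<in> points V" using p False c_in_C C_subset by auto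
    moreover have "\<bar>Arg2pi z / (2 * pi) - Arg2pi z' / (2 * pi)\<bar> < 1"
    proof -
      have "0 \<le> Arg2pi w / (2 * pi)" "Arg2pi w / (2 * pi) < 1" for w
        using Arg2pi[of w] by (auto simp: field_simps)
      from this[of z] this[of z'] show ?thesis by linarith
    qed
    ultimately have e: "c (x, norm z - 1) = c (x', norm z' - 1)" "Arg2pi z / (2 * pi) = Arg2pi z' / (2 * pi)"
      using mt_eqD by blast+
    have "(x, norm z - 1) = (x', norm z' - 1)" using arg_cong[OF e(1), of cinv] p False by (simp add: cinv_c)
    then have "x = x'" "norm z = norm z'" by auto
    then show ?thesis using e(2) p rcis_Arg2pi[of z] rcis_Arg2pi[of z'] by simp
  qed
qed

section \<open>The charts of the open book\<close>

lemma mt_inj: "inj_on cl (points V \<times> J a)"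
proof (rule inj_onI)
  fix p p' assume pp: "p \<in> points V \<times> J a" "p' \<in> points V \<times> J a" "cl p = cl p'"
  obtain x t x' t' where [simp]: "p = (x, t)" "p' = (x', t')" by fastforce
  have "\<bar>t - t'\<bar> < 1" using pp by auto
  then show "p = p'" using mt_eqD[of x t x' t'] pp by auto
qed

lemma mem_mapping_torus:
  "(P, \<xi>) \<in> MT \<longleftrightarrow> (\<exists>U \<kappa> a. (U, \<kappa>) \<in> V \<and> P = cl ` (U \<times> J a) \<and>
    \<xi> = map_prod \<kappa> id \<circ> inv_into (U \<times> J a) cl)"
proof -
  have line: "(X, \<eta>) \<in> line \<longleftrightarrow> (\<exists>a. X = J a \<and> \<eta> = id)" for X \<eta> by (auto simp: line_def)
  have "(P0, \<xi>0) \<in> V \<times>\<^sub>A line \<longleftrightarrow>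
      (\<exists>U \<kappa> a. (U, \<kappa>) \<in> V \<and> P0 = U \<times> J a \<and> \<xi>0 = map_prod \<kappa> id)" for P0 and \<xi>0 :: "'v \<times> real \<Rightarrow> 'e \<times> real"
    unfolding mem_prod_atlas line by (intro iffI; elim exE conjE; intro exI conjI; assumption?) simp_all
  then show ?thesis unfolding mapping_torus_def mem_push_atlas by metis
qed

lemma mt_chart:
  assumes "(U, \<kappa>) \<in> V" "x \<in> U" "t \<in> J a"
  shows "inv_into (U \<times> J a) cl (mt x t) = (x, t)"
proof (rule inv_into_f_f)
  show "inj_on cl (U \<times> J a)"
    using chart_subset_points[OF assms(1)] by (intro inj_on_subset[OF mt_inj]) auto
qed (use assms in auto)

text \<open>A chart image is the product of a chart image of \<open>V\<close> with an open interval,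
  so the factor in \<open>V\<close> decides. A chart may see the class through another
  representative; for boundary points \<open>mt_eq_bdry\<close> identifies the two.\<close>

lemma bdry_mapping_torus:
  assumes "x \<in> points V" shows "mt x t \<in> bdry MT \<longleftrightarrow> x \<in> BV"
proof -
  have image: "(map_prod \<kappa> id \<circ> inv_into (U \<times> J a) cl) ` cl ` (U \<times> J a)
      = \<kappa> ` U \<times> J a" if "(U, \<kappa>) \<in> V" for U \<kappa> a
  proof -
    have "(map_prod \<kappa> id \<circ> inv_into (U \<times> J a) cl) (cl p) = map_prod \<kappa> id p"
      if "p \<in> U \<times> J a" for p
      using mt_chart[OF \<open>(U, \<kappa>) \<in> V\<close>] that by (cases p) auto
    then have "(map_prod \<kappa> id \<circ> inv_into (U \<times> J a) cl) ` cl ` (U \<times> J a)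
        = map_prod \<kappa> id ` (U \<times> J a)" unfolding image_image by (rule image_cong[OF refl])
    then show ?thesis by (simp add: map_prod_surj_on)
  qed
  show ?thesis
  proof
    assume "mt x t \<in> bdry MT"
    then obtain P \<xi> where P: "(P, \<xi>) \<in> MT" "mt x t \<in> P" "\<xi> (mt x t) \<notin> interior (\<xi> ` P)"
      unfolding bdry_def by blast
    obtain U \<kappa> a where U: "(U, \<kappa>) \<in> V" "P = cl ` (U \<times> J a)"
      "\<xi> = map_prod \<kappa> id \<circ> inv_into (U \<times> J a) cl"
      using P(1) unfolding mem_mapping_torus by metis
    obtain x' t' where x': "x' \<in> U" "t' \<in> J a" "mt x t = mt x' t'" using P(2) U(2) by auto
    have "\<kappa> x' \<notin> interior (\<kappa> ` U)"
      using P(3) x' mt_chart[OF U(1) x'(1,2)] unfolding U(2,3) image[OF U(1)] by (simp add: interior_Times)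
    then have "x' \<in> BV" using bdry_iff[OF atlas_V U(1) x'(1)] by blast
    then show "x \<in> BV" using mt_eq_bdry[OF assms _ x'(3)] by blast
  next
    assume x: "x \<in> BV"
    obtain U \<kappa> where U: "(U, \<kappa>) \<in> V" "x \<in> U" using assms by (rule pointsE)
    define a where "a = t - 1 / 2"
    have t: "t \<in> J a" by (simp add: a_def)
    define P \<xi> where P: "P = cl ` (U \<times> J a)"
      and \<xi>: "\<xi> = map_prod \<kappa> id \<circ> inv_into (U \<times> J a) cl"
    have "(P, \<xi>) \<in> MT" unfolding mem_mapping_torus P \<xi> using U by blast
    moreover have "mt x t \<in> P" unfolding P using U t by blast
    moreover have "\<xi> (mt x t) \<notin> interior (\<xi> ` P)"
      using bdry_iff[OF atlas_V U] x mt_chart[OF U t] unfolding P \<xi> image[OF U(1)] by (simp add: interior_Times)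
    ultimately show "mt x t \<in> bdry MT" unfolding bdry_def by blast
  qed
qed

definition torus_dom :: "'v set \<Rightarrow> real \<Rightarrow> (('v \<times> real) set + 'v \<times> complex) set"
  where "torus_dom U a = (\<lambda>p. Inl (cl p)) ` ((U - BV) \<times> J a)"

definition tube_dom :: "'v set \<Rightarrow> (('v \<times> real) set + 'v \<times> complex) set"
  where "tube_dom U = tb ` ((U \<inter> BV) \<times> ball 0 2)"

text \<open>Describes a chart by its values on representatives, which is the form used later; the
  literal chart of \<open>open_book\<close>, with its nested \<open>inv_into\<close>, is
  \<open>torus_map\<close>.\<close>

definition torus_chart ::
    "('v \<Rightarrow> 'e) \<Rightarrow> 'v set \<Rightarrow> real \<Rightarrow> (('v \<times> real) set + 'v \<times> complex \<Rightarrow> 'e \<times> complex) \<Rightarrow> bool"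
  where "torus_chart \<kappa> U a \<xi> \<longleftrightarrow>
    (\<forall>x t. x \<in> U - BV \<longrightarrow> t \<in> J a \<longrightarrow> \<xi> (Inl (mt x t)) = (\<kappa> x, of_real t))"

definition tube_chart ::
    "('v \<Rightarrow> 'e) \<Rightarrow> 'v set \<Rightarrow> (('v \<times> real) set + 'v \<times> complex \<Rightarrow> 'e \<times> complex) \<Rightarrow> bool"
  where "tube_chart \<kappa> U \<xi> \<longleftrightarrow>
    (\<forall>x z. x \<in> U \<inter> BV \<longrightarrow> z \<in> ball 0 2 \<longrightarrow> \<xi> (tb (x, z)) = (\<kappa> x, z))"

definition torus_map :: "('v \<Rightarrow> 'e) \<Rightarrow> 'v set \<Rightarrow> real \<Rightarrow> ('v \<times> real) set + 'v \<times> complex \<Rightarrow> 'e \<times> complex"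
  where "torus_map \<kappa> U a = map_prod id of_real \<circ> (map_prod \<kappa> id \<circ> inv_into (U \<times> J a) cl \<circ>
     inv_into (cl ` (U \<times> J a) \<inter> - bdry MT) Inl)"

definition tube_map :: "('v \<Rightarrow> 'e) \<Rightarrow> 'v set \<Rightarrow> ('v \<times> real) set + 'v \<times> complex \<Rightarrow> 'e \<times> complex"
  where "tube_map \<kappa> U = map_prod \<kappa> id \<circ> inv_into ((U \<inter> BV) \<times> ball 0 2) tb"

lemma torus_dom_eq:
  assumes "(U, \<kappa>) \<in> V"
  shows "Inl ` (cl ` (U \<times> J a) \<inter> - bdry MT) = torus_dom U a"
proof -
  have "cl ` (U \<times> J a) \<inter> - bdry MT = cl ` ((U - BV) \<times> J a)"
    using chart_subset_points[OF assms] by (auto simp: bdry_mapping_torus subset_iff)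
  then show ?thesis by (simp add: torus_dom_def image_image)
qed

lemma torus_chart_map: "(U, \<kappa>) \<in> V \<Longrightarrow> torus_chart \<kappa> U a (torus_map \<kappa> U a)"
  unfolding torus_chart_def
proof (intro allI impI)
  fix x t assume U: "(U, \<kappa>) \<in> V" and x: "x \<in> U - BV" "t \<in> J a"
  have "mt x t \<in> cl ` (U \<times> J a) \<inter> - bdry MT"
    using chart_subset_points[OF U] x by (auto simp: bdry_mapping_torus subset_iff)
  then have "inv_into (cl ` (U \<times> J a) \<inter> - bdry MT) Inl
      (Inl (mt x t) :: ('v \<times> real) set + 'v \<times> complex) = mt x t"
    by (intro inv_into_f_f) auto
  then show "torus_map \<kappa> U a (Inl (mt x t)) = (\<kappa> x, of_real t)"
    using mt_chart[OF U _ x(2), of x] x(1) by (simp add: torus_map_def)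
qed

lemma tube_chart_map: "(U, \<kappa>) \<in> V \<Longrightarrow> tube_chart \<kappa> U (tube_map \<kappa> U)"
  unfolding tube_chart_def
proof (intro allI impI)
  fix x and z :: complex assume U: "(U, \<kappa>) \<in> V" and x: "x \<in> U \<inter> BV" "z \<in> ball 0 2"
  have "inv_into ((U \<inter> BV) \<times> ball 0 2) tb (tb (x, z)) = (x, z)"
    by (rule inv_into_f_f[OF inj_on_subset[OF tube_inj]]) (use x in auto)
  then show "tube_map \<kappa> U (tb (x, z)) = (\<kappa> x, z)" by (simp add: tube_map_def)
qed

lemma mem_open_book:
  "(D, \<xi>) \<in> OB \<longleftrightarrow> (\<exists>U \<kappa> a. (U, \<kappa>) \<in> V \<and> D = torus_dom U a \<and> \<xi> = torus_map \<kappa> U a) \<or>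
    (\<exists>U \<kappa>. (U, \<kappa>) \<in> V \<and> D = tube_dom U \<and> \<xi> = tube_map \<kappa> U)"
proof -
  have 1: "(D, \<xi>) \<in> (\<lambda>(U, \<kappa>). (U, map_prod id of_real \<circ> \<kappa>)) `
      push_atlas Inl (sub_atlas (- bdry MT) MT) \<longleftrightarrow>
      (\<exists>U \<kappa> a. (U, \<kappa>) \<in> V \<and> D = torus_dom U a \<and> \<xi> = torus_map \<kappa> U a)" (is "?L \<longleftrightarrow> ?R")
  proof
    assume ?L
    then obtain P \<eta> where P: "(P, \<eta>) \<in> MT" and D: "D = Inl ` (P \<inter> - bdry MT)"
      and \<xi>: "\<xi> = map_prod id of_real \<circ> (\<eta> \<circ> inv_into (P \<inter> - bdry MT) Inl)"
      by (auto simp: push_atlas_def sub_atlas_def)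
    obtain U \<kappa> a where U: "(U, \<kappa>) \<in> V" "P = cl ` (U \<times> J a)"
      "\<eta> = map_prod \<kappa> id \<circ> inv_into (U \<times> J a) cl"
      using P unfolding mem_mapping_torus by metis
    have "D = torus_dom U a" unfolding D U(2) by (rule torus_dom_eq[OF U(1)])
    moreover have "\<xi> = torus_map \<kappa> U a" unfolding \<xi> U(2,3) torus_map_def ..
    ultimately show ?R using U(1) by blast
  next
    assume ?R
    then obtain U \<kappa> a where U: "(U, \<kappa>) \<in> V" and D: "D = torus_dom U a" "\<xi> = torus_map \<kappa> U a" by blast
    define P \<eta> where P: "P = cl ` (U \<times> J a)"
      and \<eta>: "\<eta> = map_prod \<kappa> id \<circ> inv_into (U \<times> J a) cl"
    have "(P, \<eta>) \<in> MT" unfolding mem_mapping_torus P \<eta> using U by blast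
    then have "(P \<inter> - bdry MT, \<eta>) \<in> sub_atlas (- bdry MT) MT"
      unfolding mem_sub_atlas by blast
    from imageI[OF this, of "\<lambda>(U, \<kappa>). (Inl ` U, \<kappa> \<circ> inv_into U Inl)"]
    have "(Inl ` (P \<inter> - bdry MT), \<eta> \<circ> inv_into (P \<inter> - bdry MT) Inl)
        \<in> push_atlas Inl (sub_atlas (- bdry MT) MT)"
      unfolding push_atlas_def by simp
    from imageI[OF this, of "\<lambda>(U, \<kappa>). (U, map_prod id of_real \<circ> \<kappa>)"]
    show ?L unfolding D torus_dom_eq[OF U, symmetric] torus_map_def P \<eta> by simp
  qed
  have 2: "(D, \<xi>) \<in> push_atlas tb (sub_atlas BV V \<times>\<^sub>A {(ball 0 2, id)}) \<longleftrightarrow>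
      (\<exists>U \<kappa>. (U, \<kappa>) \<in> V \<and> D = tube_dom U \<and> \<xi> = tube_map \<kappa> U)"
  proof -
    have "(P0, \<xi>0) \<in> sub_atlas BV V \<times>\<^sub>A {(ball 0 2, id)} \<longleftrightarrow>
        (\<exists>U \<kappa>. (U, \<kappa>) \<in> V \<and> P0 = (U \<inter> BV) \<times> ball 0 2 \<and> \<xi>0 = map_prod \<kappa> id)"
      for P0 and \<xi>0 :: "'v \<times> complex \<Rightarrow> 'e \<times> complex"
      unfolding mem_prod_atlas mem_sub_atlas by auto
    then show ?thesis unfolding mem_push_atlas tube_dom_def tube_map_def by metis
  qed
  show ?thesis unfolding open_book_def Un_iff 1 2 ..
qed

lemma torus_mem: "(U, \<kappa>) \<in> V \<Longrightarrow> (torus_dom U a, torus_map \<kappa> U a) \<in> OB"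
  and tube_mem: "(U, \<kappa>) \<in> V \<Longrightarrow> (tube_dom U, tube_map \<kappa> U) \<in> OB"
  unfolding mem_open_book by blast+

lemma open_book_pointsE:
  assumes "q \<in> points OB"
  obtains x t where "x \<in> points V - BV" "q = Inl (mt x t)"
  | x z where "x \<in> BV" "norm z < 2" "q = tb (x, z)"
proof -
  obtain D \<xi> where "(D, \<xi>) \<in> OB" "q \<in> D" using assms by (rule pointsE)
  then consider U \<kappa> a where "(U, \<kappa>) \<in> V" "q \<in> torus_dom U a" | U \<kappa> where "(U, \<kappa>) \<in> V" "q \<in> tube_dom U"
    unfolding mem_open_book by blast
  then show ?thesis
  proof cases
    case 1
    then obtain x t where "x \<in> U - BV" "q = Inl (mt x t)" by (auto simp: torus_dom_def)
    then show ?thesis using chart_subset_points[OF 1(1)] by (intro that(1)[of x t]) auto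
  next
    case 2
    then show ?thesis using that(2) by (auto simp: tube_dom_def)
  qed
qed

lemma open_book_chart_inj:
  assumes "(D, \<xi>) \<in> OB" shows "inj_on \<xi> D"
  using assms unfolding mem_open_book
proof (elim disjE exE conjE)
  fix U \<kappa> a assume U: "(U, \<kappa>) \<in> V" and D: "D = torus_dom U a" "\<xi> = torus_map \<kappa> U a"
  show "inj_on \<xi> D"
    using torus_chart_map[OF U, of a] smooth_atlasD(1)[OF atlas_V U]
    unfolding D torus_chart_def torus_dom_def by (auto simp: inj_on_def)
next
  fix U \<kappa> assume U: "(U, \<kappa>) \<in> V" and D: "D = tube_dom U" "\<xi> = tube_map \<kappa> U"
  show "inj_on \<xi> D"
    using tube_chart_map[OF U] smooth_atlasD(1)[OF atlas_V U]
    unfolding D tube_chart_def tube_dom_def by (auto simp: inj_on_def)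
qed

text \<open>Both kinds of charts have one dimension more than \<open>V\<close>: a torus chart fills
  an open part of \<open>'e\<close> times the real line in the complex plane, a tube chart an open
  part of a hyperplane times the plane.\<close>

lemma open_book_chart_dim:
  assumes "(D, \<xi>) \<in> OB"
  shows "\<exists>A. affine A \<and> int DIM('e) + 1 \<le> aff_dim A \<and> openin (top_of_set A) (\<xi> ` D)"
  using assms unfolding mem_open_book
proof (elim disjE exE conjE)
  fix U \<kappa> a assume U: "(U, \<kappa>) \<in> V" and D: "D = torus_dom U a" "\<xi> = torus_map \<kappa> U a"
  define A where "A = (UNIV :: 'e set) \<times> range complex_of_real"
  have r: "range complex_of_real = span {1}" by (auto simp: span_singleton scaleR_conv_of_real)
  have s: "subspace A" unfolding A_def r by (intro subspace_Times subspace_UNIV subspace_span)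
  have "dim A = DIM('e) + 1" unfolding A_def r by (subst dim_Times) (auto intro: subspace_span)
  then have "aff_dim A = int DIM('e) + 1" using aff_dim_subspace[OF s] by simp
  moreover have "\<xi> ` D = \<kappa> ` (U - BV) \<times> complex_of_real ` J a"
    using torus_chart_map[OF U, of a] unfolding D torus_chart_def torus_dom_def by (force simp: image_iff)
  moreover have "openin (top_of_set A) (\<kappa> ` (U - BV) \<times> complex_of_real ` J a)"
  proof -
    have "complex_of_real ` J a = range complex_of_real \<inter> {z. Re z \<in> J a}" by auto
    moreover have "open {z. Re z \<in> J a}"
      using open_vimage[OF open_greaterThanLessThan continuous_on_Re[OF continuous_on_id]] by (simp add: vimage_def)
    ultimately have "openin (top_of_set (range complex_of_real)) (complex_of_real ` J a)"
      by (auto simp: openin_open)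
    then show ?thesis unfolding A_def
      using open_chart_minus_bdry[OF atlas_V U] by (intro openin_Times) auto
  qed
  ultimately show ?thesis using subspace_imp_affine[OF s] by (intro exI[of _ A]) auto
next
  fix U \<kappa> assume U: "(U, \<kappa>) \<in> V" and D: "D = tube_dom U" "\<xi> = tube_map \<kappa> U"
  have im: "\<xi> ` D = \<kappa> ` (U \<inter> BV) \<times> ball 0 2"
    using tube_chart_map[OF U] unfolding D tube_chart_def tube_dom_def by (force simp: image_iff)
  show ?thesis
  \<comment> \<open>A chart that misses the boundary contributes an empty image, which is open in
    every affine set; the whole space is large enough.\<close>
  proof (cases "U \<inter> BV = {}")
    case True
    then show ?thesis unfolding im by (intro exI[of _ UNIV]) (simp add: aff_dim_UNIV)
  next
    case False
    then obtain x where "x \<in> U \<inter> BV" by blast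
    then obtain b r where b: "b \<noteq> 0" "openin (top_of_set {y. b \<bullet> y = r}) (\<kappa> ` (U \<inter> BV))"
      by (rule openin_chart_bdry[OF atlas_V half_space_V U])
    define A where "A = {p :: 'e \<times> complex. (b, 0) \<bullet> p = r}"
    have A: "A = {y. b \<bullet> y = r} \<times> UNIV" by (auto simp: A_def)
    have "(b, 0) \<noteq> (0 :: 'e \<times> complex)" using b(1) by (simp add: zero_prod_def)
    then have "aff_dim A = int DIM('e) + 1" unfolding A_def by (simp add: aff_dim_hyperplane)
    moreover have "affine A" unfolding A_def by (rule affine_hyperplane)
    moreover have "openin (top_of_set A) (\<xi> ` D)"
      unfolding im A using b(2) by (intro openin_Times) auto
    ultimately show ?thesis by (intro exI[of _ A]) auto
  qed
qed

text \<open>Smoothness is joint in the point and the angle, because the angle will vary with the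
  level. In suitable charts the map is a translation of the time or a rotation of the disc.\<close>

lemma smooth_rot:
  assumes OB: "smooth_atlas OB"
  shows "smooth_map (OB \<times>\<^sub>A euclid UNIV) OB (\<lambda>(q, \<tau>). rot \<tau> q)"
proof (rule smooth_mapI[OF smooth_atlas_prod[OF OB smooth_atlas_euclid] OB])
  have l: "smooth_on S (\<lambda>p::('e \<times> complex) \<times> real. fst (fst p))" "smooth_on S (\<lambda>p::('e \<times> complex) \<times> real. snd (fst p))"
    "smooth_on S (\<lambda>p::('e \<times> complex) \<times> real. snd p)" for S
    by (auto intro!: smooth_on_linear bounded_linear_compose[OF bounded_linear_fst] bounded_linear_compose[OF bounded_linear_snd]
        bounded_linear_fst bounded_linear_snd)
  fix p assume "p \<in> points (OB \<times>\<^sub>A euclid (UNIV :: real set))"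
  then obtain q \<tau> where p: "p = (q, \<tau>)" "q \<in> points OB" by (auto simp: points_prod)
  have E: "(UNIV, id) \<in> euclid (UNIV :: real set)" by simp
  show "smooth_at (OB \<times>\<^sub>A euclid UNIV) OB (\<lambda>(q, \<tau>). rot \<tau> q) p"
    using p(2)
  proof (cases rule: open_book_pointsE)
    case (1 x t)
    obtain U \<kappa> where U: "(U, \<kappa>) \<in> V" "x \<in> U" using 1(1) by (auto elim: pointsE)
    \<comment> \<open>Unit intervals centred at the times before and after the translation;
      \<open>W\<close> collects the arguments whose translated time remains in the second.\<close>
    define a a' where "a = t - 1 / 2" and "a' = t + \<tau> - 1 / 2"
    define W where "W = {y :: ('e \<times> complex) \<times> real. Re (snd (fst y)) + snd y \<in> J a'}"
    have "continuous_on UNIV (\<lambda>y :: ('e \<times> complex) \<times> real. Re (snd (fst y)) + snd y)"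
      by (intro continuous_intros)
    from open_vimage[OF open_greaterThanLessThan this, of a' "a' + 1"]
    have W: "open W" unfolding W_def vimage_def .
    have c: "torus_chart \<kappa> U a (torus_map \<kappa> U a)" "torus_chart \<kappa> U a' (torus_map \<kappa> U a')"
      using torus_chart_map[OF U(1)] by blast+
    define g where "g y = (fst (fst y), snd (fst y) + of_real (snd y))" for y :: "('e \<times> complex) \<times> real"
    have g: "smooth_on S g" for S
      unfolding g_def[abs_def]
      by (intro smooth_on_Pair smooth_on_add l smooth_on_compose[OF l(3) smooth_on_linear[OF bounded_linear_of_real]]) auto
    show ?thesis
    proof (rule smooth_atI[OF prod_atlasI[OF torus_mem[OF U(1), of a] E] torus_mem[OF U(1), of a'] _ _ W g])
      show "p \<in> torus_dom U a \<times> UNIV" using p 1 U by (auto simp: torus_dom_def a_def)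
      show "map_prod (torus_map \<kappa> U a) id p \<in> W"
        using c(1) 1 U p by (simp add: torus_chart_def W_def a_def a'_def)
      fix y assume y: "y \<in> torus_dom U a \<times> (UNIV :: real set)" "map_prod (torus_map \<kappa> U a) id y \<in> W"
      then obtain x t \<tau> where xt: "y = (Inl (mt x t), \<tau>)" "x \<in> U - BV" "t \<in> J a"
        by (auto simp: torus_dom_def)
      then have 2: "torus_map \<kappa> U a (Inl (mt x t)) = (\<kappa> x, of_real t)" using c(1) by (simp add: torus_chart_def)
      then have 3: "t + \<tau> \<in> J a'" using y(2) xt(1) by (simp add: W_def)
      then have 4: "torus_map \<kappa> U a' (Inl (mt x (t + \<tau>))) = (\<kappa> x, of_real (t + \<tau>))"
        using c(2) xt(2) by (simp add: torus_chart_def)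
      have "Inl (mt x (t + \<tau>)) \<in> torus_dom U a'" using 3 xt(2) unfolding torus_dom_def by blast
      then show "(case y of (q, \<tau>) \<Rightarrow> rot \<tau> q) \<in> torus_dom U a' \<and>
          g (map_prod (torus_map \<kappa> U a) id y) = torus_map \<kappa> U a' (case y of (q, \<tau>) \<Rightarrow> rot \<tau> q)"
        using 2 4 xt(1) by (simp add: rot_mt_class g_def del: rot.simps)
    qed
  next
    case (2 x z)
    obtain U \<kappa> where U: "(U, \<kappa>) \<in> V" "x \<in> U" by (rule pointsE[OF subsetD[OF bdry_subset 2(1)]])
    have c: "tube_chart \<kappa> U (tube_map \<kappa> U)" using tube_chart_map[OF U(1)] .
    \<comment> \<open>Multiplication by \<open>cis\<close> is split into real multiples of z and i
      z, to which the rules for real scalars apply.\<close>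
    define g where "g y = (fst (fst y), cos (2 * pi * snd y) *\<^sub>R snd (fst y) + sin (2 * pi * snd y) *\<^sub>R (\<i> * snd (fst y)))"
      for y :: "('e \<times> complex) \<times> real"
    have cis: "cis s * w = cos s *\<^sub>R w + sin s *\<^sub>R (\<i> * w)" for s w
      by (simp add: complex_eq_iff)
    have m: "smooth_on S (\<lambda>y::('e \<times> complex) \<times> real. 2 * pi * snd y)" for S
      by (intro smooth_on_mult smooth_on_const l)
    have g: "smooth_on S g" for S
      using smooth_on_compose[OF m smooth_on_cos_sin(1)[of UNIV]] smooth_on_compose[OF m smooth_on_cos_sin(2)[of UNIV]]
      unfolding g_def[abs_def]
      by (intro smooth_on_Pair smooth_on_add smooth_on_scaleR l
          smooth_on_compose[OF l(2) smooth_on_linear[OF bounded_linear_mult_right, of UNIV]]) auto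
    show ?thesis
    proof (rule smooth_atI[OF prod_atlasI[OF tube_mem[OF U(1)] E] tube_mem[OF U(1)] _ _ open_UNIV g])
      show "p \<in> tube_dom U \<times> UNIV" using p 2 U by (auto simp: tube_dom_def)
      fix y assume "y \<in> tube_dom U \<times> (UNIV :: real set)"
      then obtain x z \<tau> where xz: "y = (tb (x, z), \<tau>)" "x \<in> U \<inter> BV" "norm z < 2"
        by (auto simp: tube_dom_def)
      define w where "w = cis (2 * pi * \<tau>) * z"
      have w: "norm w < 2" using xz by (simp add: w_def norm_mult)
      have r: "rot \<tau> (tb (x, z)) = tb (x, w)" using xz rot_tube w_def by simp
      have "tube_map \<kappa> U (tb (x, z)) = (\<kappa> x, z)" "tube_map \<kappa> U (tb (x, w)) = (\<kappa> x, w)"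
        using c xz w by (auto simp: tube_chart_def)
      moreover have "tb (x, w) \<in> tube_dom U" using xz w by (auto simp: tube_dom_def)
      ultimately show "(case y of (q, \<tau>) \<Rightarrow> rot \<tau> q) \<in> tube_dom U \<and>
          g (map_prod (tube_map \<kappa> U) id y) = tube_map \<kappa> U (case y of (q, \<tau>) \<Rightarrow> rot \<tau> q)"
        using xz(1) r by (simp add: w_def cis g_def)
    qed simp
  qed
qed

end

text \<open>The smooth inverse of \<Psi> carries a vector killed by the composite back to one killed
  by \<open>j\<close>, which is an immersion. Uniqueness of derivatives is used on \<open>V\<close>,
  whose charts are of full dimension.\<close>

lemma smooth_embedding_diffeo_compose:
  assumes V: "smooth_atlas V" "half_space_charts V" "compact_space (mtop V)" and Q: "smooth_atlas Q"
    and N: "smooth_atlas N" "Hausdorff_space (mtop N)" and j: "smooth_embedding V Q j" and \<Psi>: "diffeo Q N \<Psi>"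
  shows "smooth_embedding V N (\<Psi> \<circ> j)"
proof (rule smooth_embeddingI[OF V(1) N(1)])
  have jm: "smooth_map V Q j" using j by (simp add: smooth_embedding_def)
  have \<Psi>m: "smooth_map Q N \<Psi>" "smooth_map N Q (inv_into (points Q) \<Psi>)" "inj_on \<Psi> (points Q)"
    using \<Psi> by (auto simp: diffeo_def bij_betw_def)
  show s: "smooth_map V N (\<Psi> \<circ> j)"
    using smooth_map_compose[OF V(1) Q N(1) jm \<Psi>m(1)] by (simp add: o_def)
  have "inj_on j (points V)"
    using j homeomorphic_imp_injective_map
    by (fastforce simp: smooth_embedding_def embedding_map_def topspace_mtop)
  moreover have "inj_on \<Psi> (j ` points V)"
    by (rule inj_on_subset[OF \<Psi>m(3)]) (use smooth_map_funcset[OF jm] in blast)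
  ultimately have "inj_on (\<Psi> \<circ> j) (points V)" by (rule comp_inj_on)
  then show "embedding_map (mtop V) (mtop N) (\<Psi> \<circ> j)"
    by (intro continuous_imp_embedding_map smooth_map_continuous s V N) (simp add: topspace_mtop)
  fix A \<alpha> x v assume A: "(A, \<alpha>) \<in> V" "x \<in> A" and v: "dker A \<alpha> N (\<Psi> \<circ> j) x v"
  have "dker A \<alpha> Q (\<lambda>x. inv_into (points Q) \<Psi> ((\<Psi> \<circ> j) x)) x v"
    by (rule dker_compose[OF V(1) N(1) Q s \<Psi>m(2) A v])
  then have "dker A \<alpha> Q (\<lambda>x. j x) x v"
    by (rule dker_cong[OF _ A(2) smooth_atlasD(1)[OF V(1) A(1)]])
      (use smooth_map_funcset[OF jm] chart_subset_points[OF A(1)] \<Psi>m(3) in auto)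
  then have "dker A \<alpha> V (\<lambda>x. x) x v"
    by (rule dker_immersion[OF V(1,2) V(1) Q smooth_map_ident[OF V(1)] j A])
  then show "v = 0" by (rule dker_ident[OF V(1,2) A])
qed

text \<open>The function \<lambda> of the rotation angle. Both flat terms vanish on [-1/2, 0]; they
  are normalized so that the first is 1 at t = 1 and the second is 1 at t = -1, where the other one
  vanishes.\<close>

definition plateau :: "real \<Rightarrow> real"
  where "plateau t = 1 - flat 0 t / flat 0 1 - flat 0 (- (1 / 2) - t) / flat 0 (1 / 2)"

lemma plateau_simps: "- (1 / 2) \<le> t \<Longrightarrow> t \<le> 0 \<Longrightarrow> plateau t = 1" "plateau 1 = 0" "plateau (- 1) = 0"
  using flat_pos[of 1 0] flat_pos[of "1 / 2" 0] by (auto simp: plateau_def flat_eq_0)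

lemma smooth_on_plateau: "smooth_on S plateau"
proof -
  have "smooth_on S (\<lambda>t. 1 - (1 / flat 0 1) * flat 0 t - (1 / flat 0 (1 / 2)) * flat 0 (- (1 / 2) - t))"
    by (intro smooth_on_diff smooth_on_mult smooth_on_const smooth_on_flat
        smooth_on_compose[OF _ smooth_on_flat[of UNIV]] smooth_on_id) auto
  then show ?thesis by (rule smooth_on_cong) (simp add: plateau_def)
qed

text \<open>The action at level \<open>t\<close> is taken at time s * plateau t. Levels are
  preserved, so by additivity the inverse of \<Gamma> s is \<Gamma> (- s), which is smooth for the
  same reason.\<close>

lemma action_isotopy:
  assumes N: "smooth_atlas N" and G: "smooth_map (N \<times>\<^sub>A euclid UNIV) N (\<lambda>(p, t). G t p)"
    and G0: "\<And>p. p \<in> points N \<Longrightarrow> G 0 p = p"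
    and GG: "\<And>s t p. p \<in> points N \<Longrightarrow> G s (G t p) = G (s + t) p"
  defines "\<Gamma> \<equiv> \<lambda>s. \<lambda>(p, t). (G (s * plateau t) p, t)"
  shows "isotopy_of_diffeos (N \<times>\<^sub>A interval (-1) 1) \<Gamma>"
proof -
  let ?J = "interval (-1) 1 :: (real, real) atlas" and ?M = "N \<times>\<^sub>A interval (-1) 1"
  note E = smooth_atlas_euclid and In = smooth_atlas_interval
  have M: "smooth_atlas ?M" by (intro smooth_atlas_prod N In)
  have pM: "points ?M = points N \<times> {-1..1}" by (simp add: points_prod points_interval)
  have GN: "G t p \<in> points N" if "p \<in> points N" for t p
    using smooth_map_funcset[OF G, of "(p, t)"] that by (simp add: points_prod points_euclid)
  \<comment> \<open>The parameter set is left open: {0..1} serves the isotopy, and the whole line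
    serves single times, including the negative ones of the inverses.\<close>
  have \<Gamma>_smooth: "smooth_map (euclid T \<times>\<^sub>A ?M) ?M (\<lambda>(s, x). \<Gamma> s x)" for T
  proof -
    let ?T = "euclid T \<times>\<^sub>A ?M"
    have TM: "smooth_atlas ?T" by (intro smooth_atlas_prod E M)
    note q = smooth_map_snd[OF E M, of T] and s = smooth_map_fst[OF E M, of T]
    have p: "smooth_map ?T N (\<lambda>z. fst (snd z))"
      by (rule smooth_map_compose[OF TM M N q smooth_map_fst[OF N In]])
    have t: "smooth_map ?T ?J (\<lambda>z. snd (snd z))"
      by (rule smooth_map_compose[OF TM M In q smooth_map_snd[OF N In]])
    have t': "smooth_map ?T (euclid {-1..1}) (\<lambda>z. snd (snd z))"
      by (rule smooth_map_compose[OF TM In E t smooth_map_interval_euclid(1)]) simp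
    have st: "smooth_map ?T (euclid (T \<times> {-1..1})) (\<lambda>z. (fst z, snd (snd z)))"
      using smooth_map_Pair[OF TM E E s t'] by (simp add: prod_euclid)
    have "smooth_map (euclid (T \<times> {-1..1})) (euclid UNIV) (\<lambda>x. fst x * plateau (snd x))"
      by (intro smooth_map_euclid smooth_on_mult smooth_on_linear bounded_linear_fst
          smooth_on_compose[OF smooth_on_linear[OF bounded_linear_snd] smooth_on_plateau[of UNIV]]) auto
    from smooth_map_compose[OF TM E E st this]
    have r: "smooth_map ?T (euclid UNIV) (\<lambda>z. fst z * plateau (snd (snd z)))" by simp
    have "smooth_map ?T N (\<lambda>z. G (fst z * plateau (snd (snd z))) (fst (snd z)))"
      using smooth_map_compose[OF TM smooth_atlas_prod[OF N E] N smooth_map_Pair[OF TM N E p r] G] by simp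
    from smooth_map_Pair[OF TM N In this t]
    show ?thesis by (simp add: \<Gamma>_def case_prod_unfold)
  qed
  have \<Gamma>_at: "smooth_map ?M ?M (\<Gamma> s)" for s
  proof -
    have "smooth_map ?M (euclid UNIV \<times>\<^sub>A ?M) (\<lambda>x. (s, x))"
      by (intro smooth_map_Pair M E smooth_map_const smooth_map_ident) (simp add: points_euclid)
    from smooth_map_compose[OF M smooth_atlas_prod[OF E M] M this \<Gamma>_smooth] show ?thesis by simp
  qed
  have inv: "\<Gamma> (- s) (\<Gamma> s x) = x" if "x \<in> points ?M" for s x
    using that by (auto simp: \<Gamma>_def pM GG G0)
  have bij: "bij_betw (\<Gamma> s) (points ?M) (points ?M)" for s
    by (rule bij_betw_byWitness[where f' = "\<Gamma> (- s)"])
      (use inv[of _ s] inv[of _ "- s"] smooth_map_funcset[OF \<Gamma>_at] in auto)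
  have diffeo: "diffeo ?M ?M (\<Gamma> s)" for s
    unfolding diffeo_def
  proof (intro conjI bij \<Gamma>_at)
    show "smooth_map ?M ?M (inv_into (points ?M) (\<Gamma> s))"
    proof (rule smooth_map_cong[OF M M \<Gamma>_at[of "- s"]])
      fix x assume x: "x \<in> points ?M"
      have "\<Gamma> (- s) x \<in> points ?M" by (rule smooth_map_funcset[OF \<Gamma>_at x])
      moreover have "\<Gamma> s (\<Gamma> (- s) x) = x" using inv[OF x, of "- s"] by simp
      ultimately show "\<Gamma> (- s) x = inv_into (points ?M) (\<Gamma> s) x"
        using bij[of s] by (metis bij_betw_def inv_into_f_f)
    qed
  qed
  have "smooth_map (interval 0 1 \<times>\<^sub>A ?M) (euclid {0..1} \<times>\<^sub>A ?M) (\<lambda>z. (fst z, snd z))"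
    by (intro smooth_map_Pair smooth_atlas_prod In E M smooth_map_snd N
        smooth_map_compose[OF smooth_atlas_prod[OF In M] In E smooth_map_fst[OF In M]] smooth_map_interval_euclid) auto
  from smooth_map_compose[OF smooth_atlas_prod[OF In M] smooth_atlas_prod[OF E M] M this \<Gamma>_smooth]
  show ?thesis unfolding isotopy_of_diffeos_def using diffeo by (simp add: case_prod_unfold)
qed

section \<open>The rotation acting on an embedded page\<close>

context open_book_page
begin

text \<open>How \<open>j\<close> stretches the collar is unspecified, but its image is the page and
  its values off the collar are prescribed. Injectivity then leaves only the tube around the binding
  for collar points.\<close>

lemma page_collar:
  assumes j: "page_embedding V \<phi> c \<theta> j" and x: "x \<in> C"
  obtains y z where "y \<in> BV" "norm z < 2" "j x = tube V \<phi> c (y, z)"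
proof -
  have inj: "inj_on j (points V)"
    using j homeomorphic_imp_injective_map
    by (fastforce simp: page_embedding_def smooth_embedding_def embedding_map_def topspace_mtop)
  have xV: "x \<in> points V" using x C_subset by blast
  then have "j x \<in> page V \<phi> c \<theta>" using j unfolding page_embedding_def by blast
  then consider x' where "x' \<in> points V" "j x = Inl (mt x' \<theta>)"
    | y r where "y \<in> BV" "0 \<le> r" "r \<le> 1" "j x = tube V \<phi> c (y, rcis r (2 * pi * \<theta>))"
    unfolding page_def by auto
  then show ?thesis
  proof cases
    case 1
    \<comment> \<open>Otherwise \<open>x'\<close> is off the collar, where \<open>j\<close> is
      prescribed, and has the same image as the collar point \<open>x\<close>.\<close>
    have "x' \<in> C"
    proof (rule ccontr)
      assume "x' \<notin> C"
      then have "j x' = j x" using j 1 unfolding page_embedding_def by auto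
      then have "x' = x" using inj xV 1 by (auto simp: inj_on_def)
      then show False using x \<open>x' \<notin> C\<close> by simp
    qed
    then obtain y u where yu: "y \<in> BV" "0 \<le> u" "u < 1" "x' = c (y, u)" "cinv x' = (y, u)" by (rule C_cases)
    have "j x = tube V \<phi> c (y, rcis (1 + u) (2 * pi * \<theta>))" using 1 yu by (simp add: tube_rcis)
    then show ?thesis using yu by (intro that[of y]) auto
  next
    case 2
    then show ?thesis by (intro that[of y]) auto
  qed
qed

text \<open>Over the collar a full rotation of the tube is the identity, and so is \<phi>. Off the
  collar the claim is \<open>mt_shift\<close>, since \<phi> maps the complement of the collar to
  itself.\<close>

lemma rot_1_page:
  assumes j: "page_embedding V \<phi> c \<theta> j" and x: "x \<in> points V"
  shows "rot 1 (j x) = j (\<phi> x)"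
proof (cases "x \<in> C")
  case True
  with j obtain y z where "y \<in> BV" "norm z < 2" "j x = tube V \<phi> c (y, z)" by (rule page_collar)
  then show ?thesis using True by (simp add: \<phi>_C rot_tube)
next
  case False
  have "\<phi> x \<notin> C"
  proof
    assume "\<phi> x \<in> C"
    then have "\<phi> (\<phi> x) = \<phi> x" by (rule \<phi>_C)
    then have "\<phi> x = x" using \<phi>_eq \<phi>_in x by blast
    then show False using \<open>\<phi> x \<in> C\<close> False by simp
  qed
  then have "j x = Inl (mt x \<theta>)" "j (\<phi> x) = Inl (mt (\<phi> x) \<theta>)"
    using j False x \<phi>_in[OF x] by (auto simp: page_embedding_def)
  then show ?thesis using mt_shift[OF x] by (simp add: rot_mt_class del: rot.simps)
qed

lemma rot_bdry:
  assumes "page_embedding V \<phi> c \<theta> j" "x \<in> BV"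
  shows "rot \<tau> (j x) = j x"
  using assms rot_tube[of x 0 \<tau>] by (simp add: page_embedding_def)

lemma isotopy_exists:
  assumes N: "smooth_atlas N" "Hausdorff_space (mtop N)" and OB: "smooth_atlas OB"
    and \<Psi>: "diffeo OB N \<Psi>" and j: "page_embedding V \<phi> c \<theta> j"
    and W: "openin (mtop (N \<times>\<^sub>A interval (-1) 0)) W" "(\<Psi> \<circ> j) ` BV \<times> {0} \<subseteq> W"
  shows "\<exists>h \<Gamma>. seifert_embedding N (-1) 0 V (\<Psi> \<circ> j) W h \<and> h ` BV \<subseteq> points N \<times> {-1} \<and>
    isotopy_of_diffeos (N \<times>\<^sub>A interval (-1) 1) \<Gamma> \<and>
    (\<forall>s\<in>{0..1}. \<forall>p\<in>points N \<times> {-1, 1}. \<Gamma> s p = p) \<and>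
    (\<forall>p\<in>points (N \<times>\<^sub>A interval (-1) 1). \<Gamma> 0 p = p) \<and>
    (\<forall>x\<in>points V. \<Gamma> 1 (h x) = h (\<phi> x))"
proof -
  let ?\<Phi> = "inv_into (points OB) \<Psi>"
  note E = smooth_atlas_euclid
  have je: "smooth_embedding V OB j" using j by (simp add: page_embedding_def)
  then have jm: "smooth_map V OB j" by (simp add: smooth_embedding_def)
  have \<Psi>m: "smooth_map OB N \<Psi>" "smooth_map N OB ?\<Phi>" and bij: "bij_betw \<Psi> (points OB) (points N)"
    using \<Psi> by (auto simp: diffeo_def)
  have \<Phi>\<Psi>: "?\<Phi> (\<Psi> q) = q" if "q \<in> points OB" for q
    using bij that by (simp add: bij_betw_def)
  have \<Psi>\<Phi>: "\<Psi> (?\<Phi> p) = p" if "p \<in> points N" for p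
    using bij that by (simp add: bij_betw_def f_inv_into_f)
  have emb: "smooth_embedding V N (\<Psi> \<circ> j)"
    by (rule smooth_embedding_diffeo_compose[OF atlas_V half_space_V compact_V OB N je \<Psi>])
  obtain h where h: "seifert_embedding N (-1) 0 V (\<Psi> \<circ> j) W h" "\<And>x. x \<in> BV \<Longrightarrow> h x = ((\<Psi> \<circ> j) x, -1)"
    "\<And>x. x \<in> points V \<Longrightarrow> x \<notin> C \<Longrightarrow> h x = ((\<Psi> \<circ> j) x, 0)"
    "\<And>x. x \<in> C \<Longrightarrow> \<exists>x' t. h x = ((\<Psi> \<circ> j) x', t) \<and> - 1 \<le> t \<and> t \<le> 0 \<and> (x' \<in> BV \<or> x' \<in> C \<and> - (1 / 2) \<le> t)"
    by (rule seifert_embedding_exists[OF N emb W]) (rule that)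
  \<comment> \<open>The rotation transported to \<open>N\<close>; the additive law survives because
    rotations preserve \<open>points OB\<close>.\<close>
  define G where "G t p = \<Psi> (rot t (?\<Phi> p))" for t p
  define \<Gamma> where "\<Gamma> s = (\<lambda>(p, t). (G (s * plateau t) p, t :: real))" for s
  have NE: "smooth_atlas (N \<times>\<^sub>A euclid UNIV)" by (intro smooth_atlas_prod N E)
  have OE: "smooth_atlas (OB \<times>\<^sub>A euclid UNIV)" by (intro smooth_atlas_prod OB E)
  have rot_in: "rot t q \<in> points OB" if "q \<in> points OB" for t q
    using smooth_map_funcset[OF smooth_rot[OF OB], of "(q, t)"] that by (simp add: points_prod points_euclid)
  have "smooth_map (N \<times>\<^sub>A euclid UNIV) (OB \<times>\<^sub>A euclid UNIV) (\<lambda>z. (?\<Phi> (fst z), snd z))"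
    by (intro smooth_map_Pair NE OB E smooth_map_snd N smooth_map_compose[OF NE N(1) OB smooth_map_fst[OF N(1) E] \<Psi>m(2)])
  from smooth_map_compose[OF NE OE OB this smooth_rot[OF OB]]
  have "smooth_map (N \<times>\<^sub>A euclid UNIV) OB (\<lambda>z. rot (snd z) (?\<Phi> (fst z)))" by simp
  from smooth_map_compose[OF NE OB N(1) this \<Psi>m(1)]
  have G: "smooth_map (N \<times>\<^sub>A euclid UNIV) N (\<lambda>(p, t). G t p)" by (simp add: G_def case_prod_unfold)
  have G0: "G 0 p = p" if "p \<in> points N" for p using \<Psi>\<Phi>[OF that] by (simp add: G_def rot_0)
  have GG: "G s (G t p) = G (s + t) p" if "p \<in> points N" for s t p
    using \<Phi>\<Psi>[OF rot_in[OF smooth_map_funcset[OF \<Psi>m(2) that]]] by (simp add: G_def rot_rot)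
  have iso: "isotopy_of_diffeos (N \<times>\<^sub>A interval (-1) 1) \<Gamma>"
    using action_isotopy[OF N(1) G G0 GG] by (simp add: \<Gamma>_def[abs_def])
  have Gj: "G t (\<Psi> (j x)) = \<Psi> (rot t (j x))" if "x \<in> points V" for t x
    using \<Phi>\<Psi>[OF smooth_map_funcset[OF jm that]] by (simp add: G_def)
  \<comment> \<open>Over the collar \<phi> x = x, so \<open>h x\<close> must be fixed: a point over
    the binding is fixed by every rotation, and any other one lies at a level where
    \<open>plateau\<close> is 1, over a collar point that the full rotation fixes. Off the collar
    the level is 0 and the full rotation acts as \<phi>.\<close>
  have final: "\<Gamma> 1 (h x) = h (\<phi> x)" if x: "x \<in> points V" for x
  proof (cases "x \<in> C")
    case True
    then obtain x' t where x': "h x = (\<Psi> (j x'), t)" "- 1 \<le> t" "t \<le> 0" "x' \<in> BV \<or> x' \<in> C \<and> - (1 / 2) \<le> t"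
      using h(4) by force
    have "G (plateau t) (\<Psi> (j x')) = \<Psi> (j x')"
      using x'(4)
    proof
      assume "x' \<in> BV"
      then show ?thesis using Gj bdry_subset[of V] rot_bdry[OF j] by (simp add: subset_iff)
    next
      assume a: "x' \<in> C \<and> - (1 / 2) \<le> t"
      then have "x' \<in> points V" using C_subset by blast
      then show ?thesis using a x'(3) Gj rot_1_page[OF j] \<phi>_C by (simp add: plateau_simps)
    qed
    then show ?thesis using x'(1) \<phi>_C[OF True] by (simp add: \<Gamma>_def)
  next
    case False
    have "\<phi> x \<notin> C" using False \<phi>_eq[OF \<phi>_in[OF x] x] \<phi>_C by auto
    then have "h (\<phi> x) = (\<Psi> (j (\<phi> x)), 0)" using h(3)[OF \<phi>_in[OF x]] by simp
    then show ?thesis using h(3)[OF x False] Gj[OF x] rot_1_page[OF j x] by (simp add: \<Gamma>_def plateau_simps)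
  qed
  show ?thesis
  proof (intro exI[of _ h] exI[of _ \<Gamma>] conjI ballI)
    show "h ` BV \<subseteq> points N \<times> {-1}"
      using h(2) smooth_map_funcset[OF \<Psi>m(1) smooth_map_funcset[OF jm]] bdry_subset[of V] by auto
    show "\<Gamma> s p = p" if "p \<in> points N \<times> {-1, 1}" for s p
      using that G0 by (auto simp: \<Gamma>_def plateau_simps)
    show "\<Gamma> 0 p = p" if "p \<in> points (N \<times>\<^sub>A interval (-1) 1)" for p
      using that G0 by (auto simp: \<Gamma>_def points_prod)
  qed (use h(1) iso final in auto)
qed

end

theorem proposition2p3:
  fixes V :: "('v, real^'m::finite) atlas"
    and \<phi> :: "'v \<Rightarrow> 'v"
    and c :: "'v \<times> real \<Rightarrow> 'v"
    and N :: "('a, real^'n::finite) atlas"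
    and \<Psi> :: "('v \<times> real) set + 'v \<times> complex \<Rightarrow> 'a"
    and j :: "'v \<Rightarrow> ('v \<times> real) set + 'v \<times> complex"
    and \<theta> :: real
    and W :: "('a \<times> real) set"
  assumes "CARD('n) = CARD('m) + 1"
    and "compact_manifold V" and "bdry V \<noteq> {}"
    and "diffeo V V \<phi>"
    and "collar V c" and "\<forall>x\<in>collar_image V c. \<phi> x = x"
    and "closed_manifold N" and "oriented N"
    and "diffeo (open_book V \<phi> c) N \<Psi>"
    and "page_embedding V \<phi> c \<theta> j"
    and "openin (mtop (N \<times>\<^sub>A interval (-1) 0)) W"
    and "(\<Psi> \<circ> j) ` bdry V \<times> {0} \<subseteq> W"
  shows "\<exists>h \<Gamma>.
    seifert_embedding N (-1) 0 V (\<Psi> \<circ> j) W h \<and>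
    h ` bdry V \<subseteq> points N \<times> {-1} \<and>
    isotopy_of_diffeos (N \<times>\<^sub>A interval (-1) 1) \<Gamma> \<and>
    (\<forall>s\<in>{0..1}. \<forall>p\<in>points N \<times> {-1, 1}. \<Gamma> s p = p) \<and>
    (\<forall>p\<in>points (N \<times>\<^sub>A interval (-1) 1). \<Gamma> 0 p = p) \<and>
    (\<forall>x\<in>points V. \<Gamma> 1 (h x) = h (\<phi> x))"
proof -
  interpret open_book_page V c \<phi>
    using assms by unfold_locales auto
  have "smooth_manifold N" using assms(7) by (simp add: closed_manifold_def compact_manifold_def)
  then have N: "smooth_atlas N" "Hausdorff_space (mtop N)"
    using smooth_manifold_imp_smooth_atlas by (auto simp: smooth_manifold_def)
  \<comment> \<open>The dimension count feeds invariance of domain: the charts of the open book have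
    dimension one more than \<open>V\<close>, which has to reach the dimension of
    \<open>N\<close>.\<close>
  have dim: "int DIM(real^'n) = int DIM(real^'m) + 1" using assms(1) by simp
  have "smooth_atlas (open_book V \<phi> c)"
    by (rule smooth_atlas_if_diffeo[OF N(1) assms(9) open_book_chart_inj])
      (use open_book_chart_dim dim in auto)
  from isotopy_exists[OF N this assms(9-12)] show ?thesis .
qed

end
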